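(* Let $\Sigma_A^+$, $\sigma$, $\pi$ and $s_{ij}$ be the subshift of finite type, shift map, coding map and scaling ratios of a recurrent iterated function system $\{\omega_{ij},(a_{ij})\}$ on $\mathbb{R}^q$ as specified in the context. Let $f_1,g_1,\dots,f_m,g_m:\Sigma_A^+\to\mathbb{R}$ be continuous functions with $g_i(x)\neq0$ for all $x\in\Sigma_A^+$, $i=1,\dots,m$, and $\int g_i\,d\mu\ne0$ for all $\mu\in M(\Sigma_A^+,\sigma)$, $i=1,\dots,m$. If $C\subseteq\mathbb{R}^m$ is closed and convex, then $$\dim_H\left(\pi\left\{x\in\Sigma_A^+: A\left(\left(\frac{\sum_{k=0}^{n-1}f_j(\sigma^kx)}{\sum_{k=0}^{n-1}g_j(\sigma^kx)}\right)_{j\in\{1,\dots,m\}}\right)\subseteq C\right\}\right)=\sup\left\{\frac{h(\sigma,\mu)}{-\int\log s_{x_1x_2}(\pi\sigma x)\,d\mu(x)}:\ \mu\in M(\Sigma_A^+,\sigma),\ \left(\frac{\int f_i\,d\mu}{\int g_i\,d\mu}\right)_{i\in\{1,\dots,m\}}\in C\right\}.$$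
   Context: Let $p\ge2$ and let $A=(a_{ij})_{1\le i,j\le p}$ be a matrix of zeros and ones that is irreducible and aperiodic, i.e. some power of $A$ has all entries strictly positive. $\Sigma_A^+=\{x=(x_i)_{i\ge1}\in\{1,\dots,p\}^{\mathbb{N}}: a_{x_ix_{i+1}}=1\ \forall i\}$ with the product topology, and $\sigma$ is the left shift. $M(\Sigma_A^+,\sigma)$ is the set of $\sigma$-invariant Borel probability measures, $h(\sigma,\mu)$ is metric entropy, and $\dim_H$ is Hausdorff dimension (in Euclidean space). For each $(i,j)$ with $a_{ij}=1$ let $\omega_{ij}$ be a Lipschitz contraction map of $\mathbb{R}^q$. There is a unique vector $(E_1,\dots,E_p)$ of non-empty compact subsets of $\mathbb{R}^q$ with $E_i=\bigcup_{j:\,a_{ij}=1}\omega_{ij}(E_j)$; put $E=\bigcup_iE_i$. Assume: (i) each $\omega_{ij}$ is a $C^{1+\gamma}$ diffeomorphism; (ii) its derivative is always a similarity: $|(D\omega_{ij})_x(v)|=s_{ij}(x)|v|$ for all $x,v\in\mathbb{R}^q$; (iii) the open set condition: there exist non-empty bounded open sets $U_1,\dots,U_p\subset\mathbb{R}^q$ such that for each $i$, $\bigcup_{j:\,a_{ij}=1}\omega_{ij}(U_j)\subset U_i$ with the union disjoint. The coding map $\pi:\Sigma_A^+\to E$ sends $x$ to the only point of $\bigcap_{n}\omega_{x_1x_2}\omega_{x_2x_3}\cdots\omega_{x_{n-1}x_n}(E_{x_n})$. $A(\cdot)$ applied to a sequence (not to be confused with the matrix $A$) denotes its set of accumulation points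 (limits of subsequences); for the sequence of ratios in the claim it is taken in $\mathbb{R}^m$ as $n\to\infty$ over the terms with nonzero denominators (i.e. for large $n$). Conventions: $\sup\emptyset=-\infty$ and $\dim_H\emptyset=-\infty$. *)

theory Defs
  imports "HOL-Probability.Probability"
begin

section \<open>Subshifts of finite type\<close>

text \<open>A \<open>p \<times> p\<close> matrix is a function \<open>a\<close> read on \<open>{1..p} \<times> {1..p}\<close> only.\<close>

primrec matrix_power :: "nat \<Rightarrow> (nat \<Rightarrow> nat \<Rightarrow> nat) \<Rightarrow> nat \<Rightarrow> nat \<Rightarrow> nat \<Rightarrow> nat" where
  "matrix_power p a 0 = (\<lambda>i j. if i = j then 1 else 0)"
| "matrix_power p a (Suc n) = (\<lambda>i j. \<Sum>k=1..p. matrix_power p a n i k * a k j)"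

definition zero_one_matrix :: "nat \<Rightarrow> (nat \<Rightarrow> nat \<Rightarrow> nat) \<Rightarrow> bool" where
  "zero_one_matrix p a \<longleftrightarrow> (\<forall>i\<in>{1..p}. \<forall>j\<in>{1..p}. a i j \<in> {0, 1})"

definition irreducible_aperiodic :: "nat \<Rightarrow> (nat \<Rightarrow> nat \<Rightarrow> nat) \<Rightarrow> bool" where
  "irreducible_aperiodic p a \<longleftrightarrow>
     (\<exists>n>0. \<forall>i\<in>{1..p}. \<forall>j\<in>{1..p}. matrix_power p a n i j > 0)"

text \<open>Sequences are indexed from \<open>0\<close>: the entry usually written \<open>x\<^sub>1\<close> is \<open>x 0\<close>. The topology on
  \<^typ>\<open>nat \<Rightarrow> nat\<close> is the product of the discrete topologies; subshifts carry the subspace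
  topology.\<close>

definition subshift :: "nat \<Rightarrow> (nat \<Rightarrow> nat \<Rightarrow> nat) \<Rightarrow> (nat \<Rightarrow> nat) set" where
  "subshift p a = {x. \<forall>i. x i \<in> {1..p} \<and> a (x i) (x (Suc i)) = 1}"

definition left_shift :: "(nat \<Rightarrow> 'a) \<Rightarrow> nat \<Rightarrow> 'a" where
  "left_shift x = (\<lambda>n. x (Suc n))"


section \<open>Invariant measures and metric entropy\<close>

definition invariant_measures ::
    "'a::topological_space set \<Rightarrow> ('a \<Rightarrow> 'a) \<Rightarrow> 'a measure set" where
  "invariant_measures X T =
     {\<mu>. prob_space \<mu> \<and> sets \<mu> = sets (restrict_space borel X) \<and>
         T \<in> measurable \<mu> \<mu> \<and> distr \<mu> \<mu> T = \<mu>}"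

definition finite_partition :: "'a measure \<Rightarrow> 'a set set \<Rightarrow> bool" where
  "finite_partition \<mu> P \<longleftrightarrow> finite P \<and> P \<subseteq> sets \<mu> \<and> disjoint P \<and> \<Union>P = space \<mu>"

text \<open>Null sets contribute \<open>0\<close>, as \<open>0 * ln 0 = 0\<close>.\<close>

definition partition_entropy :: "'a measure \<Rightarrow> 'a set set \<Rightarrow> real" where
  "partition_entropy \<mu> P = - (\<Sum>B\<in>P. measure \<mu> B * ln (measure \<mu> B))"

text \<open>The common refinement of \<open>P, T\<^sup>-\<^sup>1P, \<dots>, T\<^sup>-\<^sup>(\<^sup>n\<^sup>-\<^sup>1\<^sup>)P\<close> (possibly with the empty set as an
  additional member, which does not affect the entropy).\<close>

definition refined_partition ::
    "'a measure \<Rightarrow> ('a \<Rightarrow> 'a) \<Rightarrow> 'a set set \<Rightarrow> nat \<Rightarrow> 'a set set" where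
  "refined_partition \<mu> T P n =
     {{x \<in> space \<mu>. \<forall>k<n. (T ^^ k) x \<in> c k} | c. \<forall>k<n. c k \<in> P}"

definition partition_entropy_rate ::
    "'a measure \<Rightarrow> ('a \<Rightarrow> 'a) \<Rightarrow> 'a set set \<Rightarrow> real" where
  "partition_entropy_rate \<mu> T P =
     lim (\<lambda>n. partition_entropy \<mu> (refined_partition \<mu> T P n) / real n)"

definition metric_entropy :: "('a \<Rightarrow> 'a) \<Rightarrow> 'a measure \<Rightarrow> ereal" where
  "metric_entropy T \<mu> = (SUP P\<in>{P. finite_partition \<mu> P}. ereal (partition_entropy_rate \<mu> T P))"


section \<open>Hausdorff dimension\<close>

text \<open>The case distinction implements \<open>0\<^sup>0 = 1\<close> (for nonempty sets), unlike \<^const>\<open>powr\<close>, so that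
  the \<open>0\<close>-dimensional measure counts points.\<close>

definition diameter_power :: "real \<Rightarrow> 'a::metric_space set \<Rightarrow> real" where
  "diameter_power s U = (if U = {} then 0 else if s = 0 then 1 else diameter U powr s)"

text \<open>Boundedness is required explicitly because \<^const>\<open>diameter\<close> is unspecified on unbounded sets.\<close>

definition hausdorff_measure :: "real \<Rightarrow> 'a::metric_space set \<Rightarrow> ennreal" where
  "hausdorff_measure s S =
     (SUP \<delta>\<in>{0<..}.
        INF U\<in>{U :: nat \<Rightarrow> 'a set. S \<subseteq> (\<Union>i. U i) \<and> (\<forall>i. bounded (U i) \<and> diameter (U i) \<le> \<delta>)}.
          (\<Sum>i. ennreal (diameter_power s (U i))))"

definition hausdorff_dim :: "'a::metric_space set \<Rightarrow> ereal" where
  "hausdorff_dim S =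
     (if S = {} then -\<infinity> else INF s\<in>{s. 0 \<le> s \<and> hausdorff_measure s S = 0}. ereal s)"


section \<open>Recurrent iterated function systems\<close>

text \<open>Differentiable maps whose derivative is locally (that is, on compact sets)
  \<open>\<gamma>\<close>-Hoelder continuous.\<close>

definition C1_holder :: "real \<Rightarrow> ('a::euclidean_space \<Rightarrow> 'a) \<Rightarrow> bool" where
  "C1_holder \<gamma> f \<longleftrightarrow>
     (\<exists>f' :: 'a \<Rightarrow> 'a \<Rightarrow>\<^sub>L 'a.
        (\<forall>x. (f has_derivative blinfun_apply (f' x)) (at x)) \<and>
        (\<forall>K. compact K \<longrightarrow>
           (\<exists>c. \<forall>x\<in>K. \<forall>y\<in>K. norm (f' x - f' y) \<le> c * dist x y powr \<gamma>)))"

definition C1_holder_diffeomorphism :: "real \<Rightarrow> ('a::euclidean_space \<Rightarrow> 'a) \<Rightarrow> bool" where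
  "C1_holder_diffeomorphism \<gamma> f \<longleftrightarrow> bij f \<and> C1_holder \<gamma> f \<and> C1_holder \<gamma> (inv f)"

definition lipschitz_contraction :: "('a::metric_space \<Rightarrow> 'a) \<Rightarrow> bool" where
  "lipschitz_contraction f \<longleftrightarrow> (\<exists>c<1. c-lipschitz_on UNIV f)"

definition recurrent_attractor ::
    "nat \<Rightarrow> (nat \<Rightarrow> nat \<Rightarrow> nat) \<Rightarrow> (nat \<Rightarrow> nat \<Rightarrow> 'a::metric_space \<Rightarrow> 'a) \<Rightarrow> (nat \<Rightarrow> 'a set) \<Rightarrow> bool"
  where
  "recurrent_attractor p a \<omega> E \<longleftrightarrow>
     (\<forall>i\<in>{1..p}. E i \<noteq> {} \<and> compact (E i) \<and> E i = (\<Union>j\<in>{j\<in>{1..p}. a i j = 1}. \<omega> i j ` E j))"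

definition open_set_condition ::
    "nat \<Rightarrow> (nat \<Rightarrow> nat \<Rightarrow> nat) \<Rightarrow> (nat \<Rightarrow> nat \<Rightarrow> 'a::metric_space \<Rightarrow> 'a) \<Rightarrow> bool" where
  "open_set_condition p a \<omega> \<longleftrightarrow>
     (\<exists>U :: nat \<Rightarrow> 'a set. \<forall>i\<in>{1..p}.
        U i \<noteq> {} \<and> bounded (U i) \<and> open (U i) \<and>
        (\<Union>j\<in>{j\<in>{1..p}. a i j = 1}. \<omega> i j ` U j) \<subseteq> U i \<and>
        disjoint_family_on (\<lambda>j. \<omega> i j ` U j) {j\<in>{1..p}. a i j = 1})"

primrec word_map :: "(nat \<Rightarrow> nat \<Rightarrow> 'a \<Rightarrow> 'a) \<Rightarrow> (nat \<Rightarrow> nat) \<Rightarrow> nat \<Rightarrow> 'a \<Rightarrow> 'a" where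
  "word_map \<omega> x 0 = id"
| "word_map \<omega> x (Suc n) = word_map \<omega> x n \<circ> \<omega> (x n) (x (Suc n))"

definition coding_map ::
    "(nat \<Rightarrow> nat \<Rightarrow> 'a \<Rightarrow> 'a) \<Rightarrow> (nat \<Rightarrow> 'a set) \<Rightarrow> (nat \<Rightarrow> nat) \<Rightarrow> 'a" where
  "coding_map \<omega> E x = (THE y. y \<in> (\<Inter>n. word_map \<omega> x n ` E (x n)))"


section \<open>Accumulation points and ergodic sums\<close>

text \<open>Limits of subsequences of \<open>(u n)\<close> with \<open>n\<close> running through \<open>N\<close>.\<close>

definition accumulation_points :: "nat set \<Rightarrow> (nat \<Rightarrow> 'a::topological_space) \<Rightarrow> 'a set" where
  "accumulation_points N u = {l. \<exists>r. strict_mono r \<and> range r \<subseteq> N \<and> (u \<circ> r) \<longlonglongrightarrow> l}"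

definition ergodic_sum :: "('a \<Rightarrow> 'a) \<Rightarrow> ('a \<Rightarrow> real) \<Rightarrow> nat \<Rightarrow> 'a \<Rightarrow> real" where
  "ergodic_sum T f n x = (\<Sum>k<n. f ((T ^^ k) x))"

end

theory Submission
  imports Defs "HOL-Probability.Hoeffding"
begin

text \<open>
  Write \<open>\<psi> x = - ln (s x\<^sub>1 x\<^sub>2 (\<pi> (\<sigma> x)))\<close> and \<open>\<Lambda> n\<close> for its ergodic sums. By bounded distortion the cylinder of
  \<open>x\<close> of length \<open>n\<close> has an image of diameter comparable to \<open>exp (- \<Lambda> n x)\<close>, and by the open set
  condition boundedly many such pieces of size about \<open>d\<close> meet a set of diameter \<open>d\<close>.

  Upper bound: if the \<open>t\<close>-dimensional measure of the image is not zero, the sums of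
  \<open>exp (- t * \<Lambda> n x)\<close> over the words of length \<open>n\<close> do not decay exponentially, even when restricted to
  words with almost constant ratio. Normalised, these weights define empirical measures, which
  accumulate at an invariant measure \<open>\<mu>\<close> whose entropy is at least \<open>t\<close> times the integral of \<open>\<psi>\<close>.

  Lower bound: given \<open>\<mu>\<close>, independent \<open>\<mu>\<close>-random blocks of increasing length are spliced by means of
  connecting words. Almost surely the resulting point has the ergodic averages of \<open>\<mu>\<close>, and its law gives
  cylinders at most about \<open>exp (- h n)\<close>, so that the mass distribution principle applies. No
  ergodicity of \<open>\<mu>\<close> is involved, as the average over a block is used only in the mean.
\<close>

text \<open>Metric entropy is a supremum over all finite partitions, so both bounds rest on the
  generator theorem: on the subshift it is the limit and the infimum of the block entropies per
  letter. A ratio of integrals is not affine in the measure, so averaging words whose ratios are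
  merely close to \<open>C\<close> would give no information. Words with ratios close to one single
  \<open>v\<close> satisfy a linear relation between the two ergodic sums up to a small error, and
  such a relation survives averaging and weak limits. In the lower bound the information of a random
  block is handled like the ergodic sums: only its mean enters, which is at least the block entropy
  minus 1. As block \<open>k\<close> has about \<open>k\<close> letters, \<open>m\<close> blocks
  fill about \<open>m^2 / 2\<close> letters, and all quantities are compared on the scale
  \<open>m^2\<close>. The set of block sequences whose spliced point is coded into a given covering
  set need not be measurable, so the mass distribution principle is run with events that contain
  such sets.\<close>

lemma fekete_nonneg:
  fixes u :: "nat \<Rightarrow> real"
  assumes sub: "\<And>m n. u (m + n) \<le> u m + u n" and nonneg: "\<And>n. 0 \<le> u n"
  obtains L where "(\<lambda>n. u n / real n) \<longlonglongrightarrow> L" "\<And>n. 0 < n \<Longrightarrow> L \<le> u n / real n"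
proof -
  define L where "L = (INF n\<in>{0<..}. u n / real n)"
  have bdd: "bdd_below ((\<lambda>n. u n / real n) ` {0<..})"
    using nonneg by (intro bdd_belowI2[of _ 0]) auto
  have le: "L \<le> u n / real n" if "0 < n" for n
    unfolding L_def using bdd that by (intro cINF_lower) auto
  have mult: "u (k * n) \<le> real k * u n" if "0 < k" for k n
    using that
  proof (induction k rule: nat_induct_non_zero)
    case (Suc k)
    have "u (Suc k * n) \<le> u n + u (k * n)" using sub[of n "k * n"] by simp
    with Suc show ?case by (simp add: algebra_simps)
  qed simp
  have "(\<lambda>n. u n / real n) \<longlonglongrightarrow> L"
  proof (rule LIMSEQ_I)
    fix r :: real assume r: "0 < r"
    have "L < L + r / 2" using r by simp
    then obtain m where m: "0 < m" "u m / real m < L + r / 2"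
      unfolding L_def by (subst (asm) cINF_less_iff) (use bdd in auto)
    \<comment> \<open>A crude common bound for the remainders \<open>u (n mod m)\<close> that are
      left when \<open>n\<close> is divided by \<open>m\<close>; divided by \<open>n\<close> it
      vanishes.\<close>
    define B where "B = (\<Sum>i\<le>m. u i)"
    have B: "u i \<le> B" if "i \<le> m" for i
      unfolding B_def using nonneg that by (intro member_le_sum) auto
    have B0: "0 \<le> B" using B[of 0] nonneg[of 0] by simp
    obtain N :: nat where N: "2 * B / r < real N" using reals_Archimedean2 by blast
    show "\<exists>no. \<forall>n\<ge>no. norm (u n / real n - L) < r"
    proof (intro exI allI impI)
      fix n assume n: "max (Suc N) m \<le> n"
      then have n0: "0 < n" and nm: "m \<le> n" by auto
      define k where "k = n div m"
      have k0: "0 < k" using nm m(1) by (simp add: k_def div_greater_zero_iff)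
      have nk: "n = k * m + n mod m" by (simp add: k_def)
      have "u n \<le> u (k * m) + u (n mod m)" using sub[of "k * m" "n mod m"] nk by simp
      also have "\<dots> \<le> real k * u m + B"
        using mult[OF k0, of m] B[of "n mod m"] m(1) by (intro add_mono) (auto simp: less_imp_le)
      also have "real k * u m = real (k * m) * (u m / real m)" using m(1) by simp
      also have "\<dots> \<le> real n * (u m / real m)"
        using nonneg[of m] nk by (intro mult_right_mono) (simp_all, metis le_add1 of_nat_le_iff of_nat_mult)
      finally have "u n / real n \<le> u m / real m + B / real n"
        using n0 by (simp add: field_simps)
      moreover have "B / real n < r / 2"
      proof -
        have "2 * B / r < real n" using N n by linarith
        then show ?thesis using r n0 by (simp add: field_simps)
      qed
      ultimately have "u n / real n < L + r" using m(2) by linarith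
      moreover have "L \<le> u n / real n" using le n0 by simp
      ultimately show "norm (u n / real n - L) < r" by simp
    qed
  qed
  with le that show ?thesis by blast
qed

section \<open>Entropy of finitely valued random variables\<close>

text \<open>Random variables instead of partitions: joint entropies are entropies of pairs, and
  conditional entropies are differences of such entropies.\<close>

definition var_entropy :: "'w measure \<Rightarrow> ('w \<Rightarrow> 'b) \<Rightarrow> real" where
  "var_entropy M F =
     - (\<Sum>v\<in>F ` space M. measure M (F -` {v} \<inter> space M) * ln (measure M (F -` {v} \<inter> space M)))"

text \<open>Gibbs' inequality: \<open>P\<close> is compared with the array
  \<open>Pxz x z * Pyz y z / Pz z\<close>, in which \<open>x\<close> and \<open>y\<close> are
  conditionally independent given \<open>z\<close> and which has the same total mass. The pointwise
  input is \<open>ln t \<le> t - 1\<close>.\<close>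

lemma sum_entropy_submodular:
  fixes P :: "'x \<Rightarrow> 'y \<Rightarrow> 'z \<Rightarrow> real"
  assumes fin: "finite A" "finite B" "finite C" and nonneg: "\<And>x y z. 0 \<le> P x y z"
  defines "Pxz \<equiv> \<lambda>x z. \<Sum>y\<in>B. P x y z" and "Pyz \<equiv> \<lambda>y z. \<Sum>x\<in>A. P x y z"
    and "Pz \<equiv> \<lambda>z. \<Sum>x\<in>A. \<Sum>y\<in>B. P x y z"
  shows "(\<Sum>x\<in>A. \<Sum>z\<in>C. Pxz x z * ln (Pxz x z)) + (\<Sum>y\<in>B. \<Sum>z\<in>C. Pyz y z * ln (Pyz y z))
     \<le> (\<Sum>x\<in>A. \<Sum>y\<in>B. \<Sum>z\<in>C. P x y z * ln (P x y z)) + (\<Sum>z\<in>C. Pz z * ln (Pz z))"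
proof -
  have Pz_x: "Pz z = (\<Sum>x\<in>A. Pxz x z)" and Pz_y: "Pz z = (\<Sum>y\<in>B. Pyz y z)" for z
    unfolding Pz_def Pxz_def Pyz_def by (auto intro: sum.swap)
  have pos: "0 \<le> Pxz x z" "0 \<le> Pyz y z" "0 \<le> Pz z" for x y z
    unfolding Pz_def Pxz_def Pyz_def using nonneg by (auto intro!: sum_nonneg)
  have le: "P x y z * ln (Pxz x z) + P x y z * ln (Pyz y z) - P x y z * ln (P x y z) - P x y z * ln (Pz z)
      \<le> Pxz x z * Pyz y z / Pz z - P x y z" if "x \<in> A" "y \<in> B" for x y z
  proof (cases "P x y z = 0")
    case True
    then show ?thesis using pos by simp
  next
    case False
    then have P0: "0 < P x y z" using nonneg[of x y z] by simp
    have "P x y z \<le> Pxz x z" "P x y z \<le> Pyz y z"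
      unfolding Pxz_def Pyz_def using that fin nonneg by (auto intro!: member_le_sum)
    moreover have "Pxz x z \<le> Pz z"
      unfolding Pz_x using that fin pos by (auto intro!: member_le_sum)
    ultimately have gt: "0 < Pxz x z" "0 < Pyz y z" "0 < Pz z" using P0 by linarith+
    define t where "t = Pxz x z * Pyz y z / (P x y z * Pz z)"
    have t0: "0 < t" using P0 gt by (simp add: t_def)
    have "ln t = ln (Pxz x z) + ln (Pyz y z) - ln (P x y z) - ln (Pz z)"
      using P0 gt by (simp add: t_def ln_div ln_mult)
    then have "P x y z * ln (Pxz x z) + P x y z * ln (Pyz y z) - P x y z * ln (P x y z) - P x y z * ln (Pz z)
      = P x y z * ln t" by (simp only:) (simp add: algebra_simps)
    also have "\<dots> \<le> P x y z * (t - 1)"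
      using ln_le_minus_one[OF t0] P0 by (intro mult_left_mono) auto
    also have "\<dots> = Pxz x z * Pyz y z / Pz z - P x y z"
      using P0 by (simp add: t_def field_simps)
    finally show ?thesis .
  qed
  have "(\<Sum>z\<in>C. \<Sum>x\<in>A. \<Sum>y\<in>B. P x y z * ln (Pxz x z) + P x y z * ln (Pyz y z)
        - P x y z * ln (P x y z) - P x y z * ln (Pz z))
      \<le> (\<Sum>z\<in>C. \<Sum>x\<in>A. \<Sum>y\<in>B. Pxz x z * Pyz y z / Pz z - P x y z)"
    by (intro sum_mono le) auto
  also have "\<dots> = (\<Sum>z\<in>C. Pz z * Pz z / Pz z - Pz z)"
  proof (rule sum.cong[OF refl])
    fix z
    have "Pz z * Pz z / Pz z = (\<Sum>x\<in>A. Pxz x z) * (\<Sum>y\<in>B. Pyz y z) / Pz z" by (simp flip: Pz_x Pz_y)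
    also have "\<dots> = (\<Sum>x\<in>A. \<Sum>y\<in>B. Pxz x z * Pyz y z / Pz z)"
      by (simp add: sum_product sum_divide_distrib)
    finally show "(\<Sum>x\<in>A. \<Sum>y\<in>B. Pxz x z * Pyz y z / Pz z - P x y z) = Pz z * Pz z / Pz z - Pz z"
      by (simp add: sum_subtractf Pz_def)
  qed
  \<comment> \<open>If \<open>Pz z = 0\<close>, the term vanishes as well, since division by zero
    yields zero.\<close>
  also have "\<dots> = 0" by (intro sum.neutral) auto
  finally have main: "(\<Sum>z\<in>C. \<Sum>x\<in>A. \<Sum>y\<in>B. P x y z * ln (Pxz x z)) + (\<Sum>z\<in>C. \<Sum>x\<in>A. \<Sum>y\<in>B. P x y z * ln (Pyz y z))
      \<le> (\<Sum>z\<in>C. \<Sum>x\<in>A. \<Sum>y\<in>B. P x y z * ln (P x y z)) + (\<Sum>z\<in>C. \<Sum>x\<in>A. \<Sum>y\<in>B. P x y z * ln (Pz z))"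
    by (simp add: sum.distrib sum_subtractf)
  have 1: "(\<Sum>z\<in>C. \<Sum>x\<in>A. \<Sum>y\<in>B. P x y z * ln (Pxz x z)) = (\<Sum>x\<in>A. \<Sum>z\<in>C. Pxz x z * ln (Pxz x z))"
    by (subst sum.swap) (simp add: sum_distrib_right Pxz_def)
  have 2: "(\<Sum>z\<in>C. \<Sum>x\<in>A. \<Sum>y\<in>B. P x y z * ln (Pyz y z)) = (\<Sum>y\<in>B. \<Sum>z\<in>C. Pyz y z * ln (Pyz y z))"
  proof -
    have "(\<Sum>z\<in>C. \<Sum>x\<in>A. \<Sum>y\<in>B. P x y z * ln (Pyz y z)) = (\<Sum>z\<in>C. \<Sum>y\<in>B. Pyz y z * ln (Pyz y z))"
      by (intro sum.cong refl, subst sum.swap) (simp add: sum_distrib_right Pyz_def)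
    then show ?thesis by (simp add: sum.swap[of _ B])
  qed
  have 3: "(\<Sum>z\<in>C. \<Sum>x\<in>A. \<Sum>y\<in>B. P x y z * ln (P x y z)) = (\<Sum>x\<in>A. \<Sum>y\<in>B. \<Sum>z\<in>C. P x y z * ln (P x y z))"
    by (subst sum.swap, intro sum.cong refl, subst sum.swap) simp
  have 4: "(\<Sum>z\<in>C. \<Sum>x\<in>A. \<Sum>y\<in>B. P x y z * ln (Pz z)) = (\<Sum>z\<in>C. Pz z * ln (Pz z))"
    by (simp add: sum_distrib_right Pz_def)
  show ?thesis using main unfolding 1 2 3 4 by simp
qed

text \<open>Values that are not attained contribute \<open>0 * ln 0 = 0\<close>. Summing over a
  fixed finite set of values allows a comparison of entropies term by term under different
  measures.\<close>

lemma var_entropy_superset: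
  assumes "finite V" "F ` space M \<subseteq> V"
  shows "var_entropy M F = - (\<Sum>v\<in>V. measure M (F -` {v} \<inter> space M) * ln (measure M (F -` {v} \<inter> space M)))"
proof -
  have "F -` {v} \<inter> space M = {}" if "v \<in> V - F ` space M" for v using that by auto
  then show ?thesis unfolding var_entropy_def using assms
    by (subst sum.mono_neutral_left[of V]) auto
qed

context prob_space
begin

lemma information_space_exp: "information_space M (exp 1)"
  by unfold_locales simp

lemma var_entropy_eq_entropy:
  assumes "simple_function M F"
  shows "var_entropy M F = entropy (exp 1) (count_space (F ` space M)) F"
proof -
  interpret information_space M "exp 1" by (rule information_space_exp)
  show ?thesis
    unfolding var_entropy_def
      entropy_simple_distributed[OF simple_distributedI[OF assms measure_nonneg refl]]
    by (simp add: log_def)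
qed

lemma var_entropy_compose_le:
  "simple_function M F \<Longrightarrow> var_entropy M (\<lambda>x. h (F x)) \<le> var_entropy M F"
  using information_space.entropy_data_processing[OF information_space_exp, of F h]
  by (simp add: var_entropy_eq_entropy simple_function_compose1 o_def)

lemma var_entropy_compose_inj:
  "simple_function M F \<Longrightarrow> inj_on h (F ` space M) \<Longrightarrow> var_entropy M (\<lambda>x. h (F x)) = var_entropy M F"
  using information_space.entropy_of_inj[OF information_space_exp, of F h]
  by (simp add: var_entropy_eq_entropy simple_function_compose1 o_def)

lemma var_entropy_nonneg: "0 \<le> var_entropy M F"
proof -
  have "x * ln x \<le> 0" if "0 \<le> x" "x \<le> 1" for x :: real
    using that by (cases "x = 0") (auto intro!: mult_nonneg_nonpos)
  then show ?thesis by (simp add: var_entropy_def sum_nonpos)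
qed

lemma var_entropy_le_ln_card:
  assumes F: "simple_function M F" and V: "finite V" "F ` space M \<subseteq> V"
  shows "var_entropy M F \<le> ln (real (card V))"
proof -
  have fin: "finite (F ` space M)" and ne: "F ` space M \<noteq> {}"
    using F not_empty by (auto simp: simple_function_def)
  have "var_entropy M F \<le> ln (real (card (F ` space M)))"
    using information_space.entropy_le_card[OF information_space_exp
        simple_distributedI[OF F measure_nonneg refl]] F
    by (simp add: var_entropy_eq_entropy log_def)
  also have "\<dots> \<le> ln (real (card V))"
  proof -
    have "0 < card (F ` space M)" using fin ne by (simp add: card_gt_0_iff)
    moreover have "card (F ` space M) \<le> card V" by (rule card_mono[OF V])
    ultimately show ?thesis by simp
  qed
  finally show ?thesis .
qed

text \<open>Nonnegativity of the conditional mutual information of \<open>X\<close> and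
  \<open>Y\<close> given \<open>Z\<close>. With \<open>Z\<close> a function of \<open>Y\<close> it
  says that finer conditioning leaves less entropy, and this is how it is mostly applied.\<close>

lemma var_entropy_submodular:
  assumes X: "simple_function M X" and Y: "simple_function M Y" and Z: "simple_function M Z"
  shows "var_entropy M (\<lambda>w. (X w, Y w, Z w)) + var_entropy M Z
         \<le> var_entropy M (\<lambda>w. (X w, Z w)) + var_entropy M (\<lambda>w. (Y w, Z w))"
proof -
  define A B C where "A = X ` space M" and "B = Y ` space M" and "C = Z ` space M"
  define P where "P x y z = prob ((\<lambda>w. (X w, Y w, Z w)) -` {(x, y, z)} \<inter> space M)" for x y z
  have fin: "finite A" "finite B" "finite C"
    using X Y Z by (auto simp: A_def B_def C_def simple_function_def)
  note sf = simple_function_Pair[OF X simple_function_Pair[OF Y Z]]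
    simple_function_Pair[OF X Z] simple_function_Pair[OF Y Z] Z
  have sets: "(\<lambda>w. (X w, Y w, Z w)) -` {v} \<inter> space M \<in> events" for v
    by (rule simple_functionD(2)[OF sf(1)])
  have Pxz: "(\<Sum>y\<in>B. P x y z) = prob ((\<lambda>w. (X w, Z w)) -` {(x, z)} \<inter> space M)" for x z
    unfolding P_def by (subst finite_measure_finite_Union[symmetric])
      (use fin sets in \<open>auto simp: disjoint_family_on_def B_def intro!: arg_cong[where f = prob]\<close>)
  have Pyz: "(\<Sum>x\<in>A. P x y z) = prob ((\<lambda>w. (Y w, Z w)) -` {(y, z)} \<inter> space M)" for y z
    unfolding P_def by (subst finite_measure_finite_Union[symmetric])
      (use fin sets in \<open>auto simp: disjoint_family_on_def A_def intro!: arg_cong[where f = prob]\<close>)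
  have Pz: "(\<Sum>x\<in>A. \<Sum>y\<in>B. P x y z) = prob (Z -` {z} \<inter> space M)" for z
    unfolding Pxz by (subst finite_measure_finite_Union[symmetric])
      (use fin simple_functionD(2)[OF sf(2)] in \<open>auto simp: disjoint_family_on_def A_def intro!: arg_cong[where f = prob]\<close>)
  have 1: "var_entropy M (\<lambda>w. (X w, Y w, Z w)) = - (\<Sum>x\<in>A. \<Sum>y\<in>B. \<Sum>z\<in>C. P x y z * ln (P x y z))"
    by (subst var_entropy_superset[of "A \<times> B \<times> C"])
       (use fin in \<open>auto simp: A_def B_def C_def P_def sum.cartesian_product case_prod_beta\<close>)
  have 2: "var_entropy M (\<lambda>w. (X w, Z w)) = - (\<Sum>x\<in>A. \<Sum>z\<in>C. (\<Sum>y\<in>B. P x y z) * ln (\<Sum>y\<in>B. P x y z))"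
    unfolding Pxz by (subst var_entropy_superset[of "A \<times> C"])
       (use fin in \<open>auto simp: A_def B_def C_def sum.cartesian_product case_prod_beta\<close>)
  have 3: "var_entropy M (\<lambda>w. (Y w, Z w)) = - (\<Sum>y\<in>B. \<Sum>z\<in>C. (\<Sum>x\<in>A. P x y z) * ln (\<Sum>x\<in>A. P x y z))"
    unfolding Pyz by (subst var_entropy_superset[of "B \<times> C"])
       (use fin in \<open>auto simp: A_def B_def C_def sum.cartesian_product case_prod_beta\<close>)
  have 4: "var_entropy M Z = - (\<Sum>z\<in>C. (\<Sum>x\<in>A. \<Sum>y\<in>B. P x y z) * ln (\<Sum>x\<in>A. \<Sum>y\<in>B. P x y z))"
    unfolding Pz by (simp add: var_entropy_def C_def)
  have "\<And>x y z. 0 \<le> P x y z" by (simp add: P_def)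
  from sum_entropy_submodular[OF fin, of P, OF this] show ?thesis
    unfolding 1 2 3 4 by simp
qed

end

text \<open>The left side is the tangent at \<open>y\<close> of the convex function
  \<open>x * ln x\<close>.\<close>

lemma xlnx_tangent: "x * ln y + x - y \<le> x * ln x" if "0 \<le> x" "0 < y" for x y :: real
proof (cases "x = 0")
  case False
  then have "ln (y / x) \<le> y / x - 1" using that by (intro ln_le_minus_one) auto
  then have "x * ln (y / x) \<le> x * (y / x - 1)" using that by (intro mult_left_mono) auto
  then show ?thesis using False that by (simp add: ln_div algebra_simps)
qed (use that in simp)

text \<open>Jensen's inequality for \<open>x * ln x\<close>, by the tangent at the average
  \<open>Q v\<close>. Only the laws of \<open>F\<close> and of the \<open>G j\<close> enter, so the
  variables may live on different spaces.\<close>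

lemma var_entropy_concave:
  assumes J: "finite J" "\<And>j. j \<in> J \<Longrightarrow> 0 \<le> c j" "sum c J = 1"
    and V: "finite V" "F ` space M \<subseteq> V" "\<And>j. j \<in> J \<Longrightarrow> G j ` space (N j) \<subseteq> V"
    and avg: "\<And>v. v \<in> V \<Longrightarrow>
      measure M (F -` {v} \<inter> space M) = (\<Sum>j\<in>J. c j * measure (N j) (G j -` {v} \<inter> space (N j)))"
  shows "(\<Sum>j\<in>J. c j * var_entropy (N j) (G j)) \<le> var_entropy M F"
proof -
  define P where "P j v = measure (N j) (G j -` {v} \<inter> space (N j))" for j v
  define Q where "Q v = (\<Sum>j\<in>J. c j * P j v)" for v
  have "Q v * ln (Q v) \<le> (\<Sum>j\<in>J. c j * (P j v * ln (P j v)))" for v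
  proof (cases "Q v = 0")
    case True
    \<comment> \<open>A vanishing average of nonnegative terms leaves no positive weight on any
      \<open>P j v\<close>, so that all terms on the right vanish too.\<close>
    then have "c j * P j v = 0" if "j \<in> J" for j
      using J that unfolding Q_def P_def by (subst (asm) sum_nonneg_eq_0_iff) auto
    then have "c j * (P j v * ln (P j v)) = 0" if "j \<in> J" for j using that by fastforce
    then have "(\<Sum>j\<in>J. c j * (P j v * ln (P j v))) = 0" by (intro sum.neutral) blast
    then show ?thesis using True by simp
  next
    case False
    then have Q: "0 < Q v" using J unfolding Q_def P_def
      by (metis (no_types, lifting) less_eq_real_def measure_nonneg mult_nonneg_nonneg sum_nonneg)
    have "Q v * ln (Q v) = (\<Sum>j\<in>J. c j * (P j v * ln (Q v) + P j v - Q v))"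
    proof -
      have "(\<Sum>j\<in>J. c j * (P j v * ln (Q v) + P j v - Q v)) = (\<Sum>j\<in>J. c j * P j v) * ln (Q v) + (\<Sum>j\<in>J. c j * P j v) - (\<Sum>j\<in>J. c j) * Q v"
        unfolding sum_distrib_right sum.distrib[symmetric] sum_subtractf[symmetric]
        by (simp add: algebra_simps)
      then show ?thesis using J(3) by (simp add: Q_def)
    qed
    also have "\<dots> \<le> (\<Sum>j\<in>J. c j * (P j v * ln (P j v)))"
      using J Q by (intro sum_mono mult_left_mono xlnx_tangent) (auto simp: P_def)
    finally show ?thesis .
  qed
  then have "(\<Sum>v\<in>V. Q v * ln (Q v)) \<le> (\<Sum>v\<in>V. \<Sum>j\<in>J. c j * (P j v * ln (P j v)))"
    by (intro sum_mono)
  also have "\<dots> = (\<Sum>j\<in>J. c j * (\<Sum>v\<in>V. P j v * ln (P j v)))"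
    by (subst sum.swap) (simp add: sum_distrib_left)
  also have "\<dots> = - (\<Sum>j\<in>J. c j * var_entropy (N j) (G j))"
    using V by (simp add: var_entropy_superset P_def sum_negf)
  finally have "(\<Sum>j\<in>J. c j * var_entropy (N j) (G j)) \<le> - (\<Sum>v\<in>V. Q v * ln (Q v))" by simp
  also have "\<dots> = var_entropy M F"
    using V avg by (subst var_entropy_superset[of V]) (auto simp: Q_def P_def)
  finally show ?thesis .
qed

text \<open>The fibres over attained values are nonempty and pairwise distinct; an empty cell of
  \<open>Q\<close> contributes \<open>0 * ln 0 = 0\<close>.\<close>

lemma partition_entropy_fibres:
  assumes "finite (F ` space M)"
    and "(\<lambda>v. F -` {v} \<inter> space M) ` (F ` space M) = Q - {{}}"
  shows "partition_entropy M Q = var_entropy M F"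
proof -
  have inj: "inj_on (\<lambda>v. F -` {v} \<inter> space M) (F ` space M)"
    by (rule inj_onI) auto
  have fin: "finite Q" using assms by (metis finite_Diff2 finite_imageI finite.emptyI finite_insert)
  have "(\<Sum>B\<in>Q. measure M B * ln (measure M B)) = (\<Sum>B\<in>Q - {{}}. measure M B * ln (measure M B))"
    using fin by (intro sum.mono_neutral_right) auto
  also have "\<dots> = (\<Sum>v\<in>F ` space M. measure M (F -` {v} \<inter> space M) * ln (measure M (F -` {v} \<inter> space M)))"
    unfolding assms(2)[symmetric] by (subst sum.reindex[OF inj]) simp
  finally show ?thesis by (simp add: partition_entropy_def var_entropy_def)
qed

section \<open>Entropy rates of measure preserving maps\<close>

text \<open>Continuity of \<open>x * ln x\<close> matters only at \<open>0\<close>, where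
  \<open>ln\<close> itself is discontinuous; there
  \<open>ln (1 / sqrt x) \<le> 1 / sqrt x - 1\<close> yields the majorant
  \<open>2 * sqrt x\<close>.\<close>

lemma tendsto_xlnx:
  fixes f :: "nat \<Rightarrow> real"
  assumes "f \<longlonglongrightarrow> l" "\<And>i. 0 \<le> f i"
  shows "(\<lambda>i. f i * ln (f i)) \<longlonglongrightarrow> l * ln l"
proof (cases "l = 0")
  case False
  then show ?thesis using assms by (intro tendsto_intros)
next
  case True
  have bound: "\<bar>x * ln x\<bar> \<le> 2 * sqrt x" if "0 \<le> x" "x \<le> 1" for x :: real
  proof (cases "x = 0")
    case False
    then have x: "0 < x" using that by simp
    then have "ln (1 / sqrt x) \<le> 1 / sqrt x - 1" by (intro ln_le_minus_one) simp
    then have "- ln x \<le> 2 / sqrt x" using x by (simp add: ln_div ln_sqrt)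
    then have "x * (- ln x) \<le> x * (2 / sqrt x)" using x by (intro mult_left_mono) auto
    also have "\<dots> = 2 * (x / sqrt x)" by simp
    also have "\<dots> = 2 * sqrt x" using x by (simp only: real_div_sqrt less_imp_le)
    finally show ?thesis using x that by (simp add: abs_mult)
  qed simp
  have "eventually (\<lambda>i. f i \<le> 1) sequentially"
    using order_tendstoD(2)[OF assms(1), of 1] True by (auto elim: eventually_mono)
  then have "eventually (\<lambda>i. norm (f i * ln (f i)) \<le> 2 * sqrt (f i)) sequentially"
    by (rule eventually_mono) (use bound assms(2) in auto)
  moreover have "(\<lambda>i. 2 * sqrt (f i)) \<longlonglongrightarrow> 2 * sqrt l" by (intro tendsto_intros assms)
  ultimately show ?thesis using True by (simp add: Lim_null_comparison)
qed

definition itinerary :: "('w \<Rightarrow> 'w) \<Rightarrow> ('w \<Rightarrow> 'b) \<Rightarrow> nat \<Rightarrow> 'w \<Rightarrow> 'b list" where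
  "itinerary T F n x = map (\<lambda>k. F ((T ^^ k) x)) [0..<n]"

lemma length_itinerary [simp]: "length (itinerary T F n x) = n"
  by (simp add: itinerary_def)

lemma itinerary_Suc: "itinerary T F (Suc n) x = itinerary T F n x @ [F ((T ^^ n) x)]"
  by (simp add: itinerary_def)

lemma itinerary_add: "itinerary T F (m + n) x = itinerary T F m x @ itinerary T F n ((T ^^ m) x)"
proof (induction n)
  case (Suc n)
  have "(T ^^ n) ((T ^^ m) x) = (T ^^ (m + n)) x" by (metis add.commute comp_apply funpow_add)
  with Suc show ?case by (simp add: itinerary_Suc)
qed (simp add: itinerary_def)

lemma itinerary_drop_take:
  assumes "j + m \<le> n"
  shows "itinerary T F m ((T ^^ j) x) = take m (drop j (itinerary T F n x))"
proof -
  obtain r where "n = j + m + r" using assms le_iff_add by blast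
  then show ?thesis by (simp add: itinerary_add)
qed

lemma itinerary_eq_iff:
  "itinerary T F n x = itinerary T F n y \<longleftrightarrow> (\<forall>k<n. F ((T ^^ k) x) = F ((T ^^ k) y))"
  by (auto simp: itinerary_def map_eq_conv)

text \<open>Here \<open>F\<close> sends a point to its own cell, so an itinerary is a sequence of
  cells and its fibre is the corresponding cell of the refinement.\<close>

lemma partition_entropy_refined:
  assumes P: "finite_partition M P" and F: "\<And>B x. B \<in> P \<Longrightarrow> x \<in> B \<Longrightarrow> F x = B"
    and T: "T \<in> space M \<rightarrow> space M"
  shows "partition_entropy M (refined_partition M T P n) = var_entropy M (itinerary T F n)"
proof (rule partition_entropy_fibres)
  have Tk: "(T ^^ k) x \<in> space M" if "x \<in> space M" for k x
    using that T by (induction k) auto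
  have ex: "\<exists>B\<in>P. x \<in> B" if "x \<in> space M" for x using P that by (auto simp: finite_partition_def)
  have FP: "F x \<in> P" "x \<in> F x" if "x \<in> space M" for x using ex[OF that] F by auto
  have mem: "x \<in> B \<longleftrightarrow> F x = B" if "B \<in> P" "x \<in> space M" for x B
    using F that FP by auto
  have "itinerary T F n ` space M \<subseteq> {l. set l \<subseteq> P \<and> length l = n}"
    using FP Tk by (auto simp: itinerary_def)
  moreover have "finite {l. set l \<subseteq> P \<and> length l = n}"
    using P by (intro finite_lists_length_eq) (auto simp: finite_partition_def)
  ultimately show "finite (itinerary T F n ` space M)" by (rule finite_subset)
  have fibre: "itinerary T F n -` {itinerary T F n x} \<inter> space M
      = {y \<in> space M. \<forall>k<n. F ((T ^^ k) y) = F ((T ^^ k) x)}" for x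
    by (auto simp: itinerary_eq_iff)
  have refine: "{y \<in> space M. \<forall>k<n. (T ^^ k) y \<in> c k} = {y \<in> space M. \<forall>k<n. F ((T ^^ k) y) = c k}"
    if "\<forall>k<n. c k \<in> P" for c
  proof -
    have "(T ^^ k) y \<in> c k \<longleftrightarrow> F ((T ^^ k) y) = c k" if "y \<in> space M" "k < n" for k y
      using mem[of "c k" "(T ^^ k) y"] \<open>\<forall>k<n. c k \<in> P\<close> Tk that by blast
    then show ?thesis by blast
  qed
  show "(\<lambda>v. itinerary T F n -` {v} \<inter> space M) ` itinerary T F n ` space M = refined_partition M T P n - {{}}"
  proof (intro set_eqI iffI)
    fix S assume "S \<in> (\<lambda>v. itinerary T F n -` {v} \<inter> space M) ` itinerary T F n ` space M"
    then obtain x where x: "x \<in> space M" "S = itinerary T F n -` {itinerary T F n x} \<inter> space M"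
      by auto
    define c where "c k = F ((T ^^ k) x)" for k
    have c: "\<forall>k<n. c k \<in> P" using FP Tk x(1) by (simp add: c_def)
    have "S = {y \<in> space M. \<forall>k<n. (T ^^ k) y \<in> c k}"
      unfolding refine[OF c] x(2) fibre by (simp only: c_def)
    then have "S \<in> refined_partition M T P n" using c unfolding refined_partition_def by blast
    moreover have "x \<in> S" using x by simp
    ultimately show "S \<in> refined_partition M T P n - {{}}" by blast
  next
    fix S assume "S \<in> refined_partition M T P n - {{}}"
    then obtain c x where c: "S = {y \<in> space M. \<forall>k<n. (T ^^ k) y \<in> c k}" "\<forall>k<n. c k \<in> P" and x: "x \<in> S"
      unfolding refined_partition_def by blast
    have S: "S = {y \<in> space M. \<forall>k<n. F ((T ^^ k) y) = c k}"
      unfolding c(1) by (rule refine[OF c(2)])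
    then have xS: "x \<in> space M" "\<forall>k<n. F ((T ^^ k) x) = c k" using x by simp_all
    then have "S = itinerary T F n -` {itinerary T F n x} \<inter> space M"
      unfolding fibre S by simp
    then show "S \<in> (\<lambda>v. itinerary T F n -` {v} \<inter> space M) ` itinerary T F n ` space M"
      using xS(1) by blast
  qed
qed

context prob_space
begin

text \<open>Submodularity with a constant third variable, whose entropy is nonnegative.\<close>

lemma var_entropy_pair_le:
  assumes "simple_function M X" "simple_function M Y"
  shows "var_entropy M (\<lambda>w. (X w, Y w)) \<le> var_entropy M X + var_entropy M Y"
proof -
  have c: "simple_function M (\<lambda>_. ())" by simp
  have "var_entropy M (\<lambda>w. (X w, Y w, ())) = var_entropy M (\<lambda>w. (X w, Y w))"
    using var_entropy_compose_inj[OF simple_function_Pair[OF assms], of "\<lambda>(x, y). (x, y, ())"]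
    by (simp add: inj_on_def)
  moreover have "var_entropy M (\<lambda>w. (X w, ())) = var_entropy M X"
    using var_entropy_compose_inj[OF assms(1), of "\<lambda>x. (x, ())"] by (simp add: inj_on_def)
  moreover have "var_entropy M (\<lambda>w. (Y w, ())) = var_entropy M Y"
    using var_entropy_compose_inj[OF assms(2), of "\<lambda>x. (x, ())"] by (simp add: inj_on_def)
  ultimately show ?thesis
    using var_entropy_submodular[OF assms c] var_entropy_nonneg[of "\<lambda>_. ()"] by simp
qed

end

section \<open>Entropy rates of stationary processes\<close>

locale measure_preserving_map = prob_space M for M :: "'w measure" +
  fixes T :: "'w \<Rightarrow> 'w"
  assumes T_measurable [measurable]: "T \<in> measurable M M"
    and distr_T: "distr M M T = M"
begin

lemma T_space: "T \<in> space M \<rightarrow> space M"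
  using measurable_space[OF T_measurable] by auto

lemma Tk_measurable [measurable]: "(T ^^ k) \<in> measurable M M"
  by (induction k) (auto intro: measurable_comp[OF _ T_measurable])

lemma distr_Tk: "distr M M (T ^^ k) = M"
proof (induction k)
  case (Suc k)
  have "distr M M (T \<circ> (T ^^ k)) = distr (distr M M (T ^^ k)) M T"
    by (rule distr_distr[symmetric]) auto
  then show ?case using Suc distr_T by (simp only: funpow.simps)
qed (simp add: distr_id2)

lemma measure_vimage_Tk:
  assumes "A \<in> sets M"
  shows "measure M ((T ^^ k) -` A \<inter> space M) = measure M A"
  by (subst (2) distr_Tk[of k, symmetric]) (simp add: measure_distr assms)

lemma simple_function_Tk:
  assumes "simple_function M F"
  shows "simple_function M (\<lambda>x. F ((T ^^ k) x))"
proof -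
  have sp: "(T ^^ k) x \<in> space M" if "x \<in> space M" for x using measurable_space[OF Tk_measurable that] .
  have "(\<lambda>x. F ((T ^^ k) x)) ` space M \<subseteq> F ` space M" using sp by auto
  moreover have "(\<lambda>x. F ((T ^^ k) x)) -` {v} \<inter> space M \<in> sets M" for v
  proof -
    have "(\<lambda>x. F ((T ^^ k) x)) -` {v} \<inter> space M = (T ^^ k) -` (F -` {v} \<inter> space M) \<inter> space M"
      using sp by auto
    then show ?thesis
      using measurable_sets[OF Tk_measurable simple_functionD(2)[OF assms]] by simp
  qed
  ultimately show ?thesis using assms
    by (auto simp: simple_function_def intro: finite_subset)
qed

lemma simple_function_itinerary:
  assumes "simple_function M F"
  shows "simple_function M (itinerary T F n)"
proof (induction n)
  case 0
  then show ?case by (simp add: itinerary_def[abs_def])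
next
  case (Suc n)
  then show ?case unfolding itinerary_Suc[abs_def]
    using simple_function_compose1[OF simple_function_Pair[OF Suc simple_function_Tk[OF assms]], of "\<lambda>(l, v). l @ [v]" n]
    by simp
qed

lemma var_entropy_Tk:
  assumes F: "simple_function M F"
  shows "var_entropy M (\<lambda>x. F ((T ^^ k) x)) = var_entropy M F"
proof -
  have sp: "(T ^^ k) x \<in> space M" if "x \<in> space M" for x using measurable_space[OF Tk_measurable that] .
  have "measure M ((\<lambda>x. F ((T ^^ k) x)) -` {v} \<inter> space M) = measure M (F -` {v} \<inter> space M)" for v
  proof -
    have "(\<lambda>x. F ((T ^^ k) x)) -` {v} \<inter> space M = (T ^^ k) -` (F -` {v} \<inter> space M) \<inter> space M"
      using sp by auto
    then show ?thesis using measure_vimage_Tk[OF simple_functionD(2)[OF F]] by simp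
  qed
  then show ?thesis
    using F sp by (subst var_entropy_superset[of "F ` space M"]) (auto simp: simple_function_def var_entropy_def)
qed

abbreviation block_entropy :: "('w \<Rightarrow> 'b) \<Rightarrow> nat \<Rightarrow> real" where
  "block_entropy F n \<equiv> var_entropy M (itinerary T F n)"

text \<open>The last \<open>n\<close> letters of a block of length \<open>m + n\<close> have, by
  invariance, the law of a block of length \<open>n\<close>.\<close>

lemma block_entropy_subadditive:
  assumes F: "simple_function M F"
  shows "block_entropy F (m + n) \<le> block_entropy F m + block_entropy F n"
proof -
  note sf = simple_function_itinerary[OF F, of m] simple_function_Tk[OF simple_function_itinerary[OF F, of n], of m]
  have "block_entropy F (m + n) = var_entropy M (\<lambda>x. (\<lambda>(a, b). a @ b) (itinerary T F m x, itinerary T F n ((T ^^ m) x)))"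
    unfolding itinerary_add[abs_def] by simp
  also have "\<dots> \<le> var_entropy M (\<lambda>x. (itinerary T F m x, itinerary T F n ((T ^^ m) x)))"
    by (rule var_entropy_compose_le) (rule simple_function_Pair[OF sf])
  also have "\<dots> \<le> block_entropy F m + var_entropy M (\<lambda>x. itinerary T F n ((T ^^ m) x))"
    by (rule var_entropy_pair_le[OF sf])
  also have "var_entropy M (\<lambda>x. itinerary T F n ((T ^^ m) x)) = block_entropy F n"
    by (rule var_entropy_Tk[OF simple_function_itinerary[OF F]])
  finally show ?thesis .
qed

definition entropy_rate :: "('w \<Rightarrow> 'b) \<Rightarrow> real" where
  "entropy_rate F = lim (\<lambda>n. block_entropy F n / real n)"

lemma entropy_rate_LIMSEQ:
  assumes "simple_function M F"
  shows "(\<lambda>n. block_entropy F n / real n) \<longlonglongrightarrow> entropy_rate F"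
    and "0 < n \<Longrightarrow> entropy_rate F \<le> block_entropy F n / real n"
proof -
  obtain L where L: "(\<lambda>n. block_entropy F n / real n) \<longlonglongrightarrow> L" "\<And>n. 0 < n \<Longrightarrow> L \<le> block_entropy F n / real n"
    using fekete_nonneg[of "block_entropy F"] block_entropy_subadditive[OF assms] var_entropy_nonneg by blast
  then have "entropy_rate F = L" unfolding entropy_rate_def by (intro limI)
  with L show "(\<lambda>n. block_entropy F n / real n) \<longlonglongrightarrow> entropy_rate F"
    and "0 < n \<Longrightarrow> entropy_rate F \<le> block_entropy F n / real n" by auto
qed

lemma entropy_rate_nonneg: "simple_function M F \<Longrightarrow> 0 \<le> entropy_rate F"
  by (rule LIMSEQ_le_const[OF entropy_rate_LIMSEQ(1)]) (auto intro!: exI[of _ 1] divide_nonneg_nonneg var_entropy_nonneg)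

text \<open>The increment is the conditional entropy of \<open>F\<close> given \<open>m\<close> letters of \<open>L\<close>; conditioning on
  more letters only decreases it.\<close>

lemma joint_itinerary_entropy_le:
  fixes m :: nat
  assumes F: "simple_function M F" and L: "simple_function M L"
  defines "e \<equiv> var_entropy M (\<lambda>x. (F x, itinerary T L m x)) - block_entropy L m"
  shows "j + m \<le> N + 1 \<Longrightarrow>
    var_entropy M (\<lambda>x. (itinerary T F j x, itinerary T L N x)) \<le> block_entropy L N + real j * e"
proof (induction j)
  case 0
  have "var_entropy M (\<lambda>x. (itinerary T F 0 x, itinerary T L N x)) = block_entropy L N"
    using var_entropy_compose_inj[OF simple_function_itinerary[OF L], of "\<lambda>l. ([], l)" N]
    by (simp add: itinerary_def inj_on_def)
  then show ?case by simp
next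
  case (Suc j)
  define Y where "Y x = (itinerary T F j x, itinerary T L N x)" for x
  define Z where "Z x = itinerary T L m ((T ^^ j) x)" for x
  define X where "X x = F ((T ^^ j) x)" for x
  have sX: "simple_function M X" unfolding X_def[abs_def] by (rule simple_function_Tk[OF F])
  have sY: "simple_function M Y" unfolding Y_def[abs_def]
    by (rule simple_function_Pair[OF simple_function_itinerary[OF F] simple_function_itinerary[OF L]])
  have sZ: "simple_function M Z" unfolding Z_def[abs_def]
    by (rule simple_function_Tk[OF simple_function_itinerary[OF L]])
  \<comment> \<open>In the step to \<open>Suc j\<close> the bound reads
    \<open>j + m \<le> N\<close>: the window of \<open>m\<close> letters at \<open>j\<close> lies
    within the \<open>N\<close> recorded letters and adds nothing to \<open>Y\<close>.\<close>
  have ZY: "Z x = take m (drop j (snd (Y x)))" for x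
    using Suc.prems by (simp add: Z_def Y_def itinerary_drop_take)
  have "var_entropy M (\<lambda>x. (itinerary T F (Suc j) x, itinerary T L N x))
      = var_entropy M (\<lambda>x. (\<lambda>(a, b, c). (fst b @ [a], snd b)) (X x, Y x, Z x))"
    by (simp add: X_def Y_def itinerary_Suc)
  also have "\<dots> \<le> var_entropy M (\<lambda>x. (X x, Y x, Z x))"
    by (rule var_entropy_compose_le[OF simple_function_Pair[OF sX simple_function_Pair[OF sY sZ]]])
  also have "\<dots> \<le> var_entropy M (\<lambda>x. (X x, Z x)) + var_entropy M (\<lambda>x. (Y x, Z x)) - var_entropy M Z"
    using var_entropy_submodular[OF sX sY sZ] by simp
  also have "var_entropy M (\<lambda>x. (Y x, Z x)) = var_entropy M Y"
    unfolding ZY using var_entropy_compose_inj[OF sY, of "\<lambda>y. (y, take m (drop j (snd y)))"]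
    by (simp add: inj_on_def)
  also have "var_entropy M Z = block_entropy L m"
    unfolding Z_def[abs_def] by (rule var_entropy_Tk[OF simple_function_itinerary[OF L]])
  also have "var_entropy M (\<lambda>x. (X x, Z x)) = var_entropy M (\<lambda>x. (F x, itinerary T L m x))"
    unfolding X_def Z_def
    using var_entropy_Tk[OF simple_function_Pair[OF F simple_function_itinerary[OF L, of m]], of j] by simp
  also have "var_entropy M Y \<le> block_entropy L N + real j * e"
    unfolding Y_def[abs_def] using Suc by simp
  finally show ?case by (simp add: e_def algebra_simps)
qed

text \<open>Recording \<open>n + m\<close> letters of \<open>L\<close> allows a full window of
  length \<open>m\<close> at each of the \<open>n\<close> times; after division by \<open>n\<close>
  the \<open>m\<close> additional letters are negligible.\<close>

lemma entropy_rate_le_conditional: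
  assumes F: "simple_function M F" and L: "simple_function M L"
  shows "entropy_rate F \<le> entropy_rate L
    + (var_entropy M (\<lambda>x. (F x, itinerary T L m x)) - block_entropy L m)" (is "_ \<le> _ + ?e")
proof -
  have le: "block_entropy F n / real n \<le> (block_entropy L n + block_entropy L m) / real n + ?e" if "0 < n" for n
  proof -
    have "block_entropy F n \<le> var_entropy M (\<lambda>x. (itinerary T F n x, itinerary T L (n + m) x))"
      using var_entropy_compose_le[OF simple_function_Pair[OF simple_function_itinerary[OF F] simple_function_itinerary[OF L]], of fst n "n + m"]
      by simp
    also have "\<dots> \<le> block_entropy L (n + m) + real n * ?e"
      by (rule joint_itinerary_entropy_le[OF F L]) simp
    also have "block_entropy L (n + m) \<le> block_entropy L n + block_entropy L m"
      by (rule block_entropy_subadditive[OF L])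
    finally show ?thesis using that by (simp add: field_simps)
  qed
  have "(\<lambda>n. (block_entropy L n + block_entropy L m) / real n + ?e) \<longlonglongrightarrow> (entropy_rate L + 0) + ?e"
    unfolding add_divide_distrib
    by (intro tendsto_add tendsto_const entropy_rate_LIMSEQ(1)[OF L] lim_const_over_n)
  moreover have "\<exists>N. \<forall>n\<ge>N. block_entropy F n / real n \<le> (block_entropy L n + block_entropy L m) / real n + ?e"
    using le by (intro exI[of _ 1]) auto
  ultimately show ?thesis
    using LIMSEQ_le[OF entropy_rate_LIMSEQ(1)[OF F]] by fastforce
qed


section \<open>The Kolmogorov-Sinai generator theorem\<close>

text \<open>If events are approximable by finitely many letters of \<open>L\<close>, then
  \<open>F\<close> agrees, outside a set of small probability, with a function \<open>G i\<close> of
  such letters. The conditional entropy of \<open>F\<close> given \<open>G i\<close> tends to that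
  of \<open>F\<close> given \<open>F\<close>, which is zero.\<close>

lemma entropy_rate_le_generator:
  assumes F: "simple_function M F" and L: "simple_function M L"
    and gen: "\<And>A e. A \<in> sets M \<Longrightarrow> 0 < e \<Longrightarrow>
      \<exists>m S. measure M (sym_diff A {x \<in> space M. itinerary T L m x \<in> S}) < e"
  shows "entropy_rate F \<le> entropy_rate L"
proof -
  define V where "V = F ` space M"
  have V: "finite V" "V \<noteq> {}" using F not_empty by (auto simp: V_def simple_function_def)
  have FV: "F x \<in> V" if "x \<in> space M" for x using that by (simp add: V_def)
  have "\<exists>m h. (\<forall>l. h l \<in> V) \<and> prob {x \<in> space M. F x \<noteq> h (itinerary T L m x)} \<le> e" if e: "0 < e" for e
  proof -
    \<comment> \<open>The union of the error sets of all \<open>card V\<close> fibres is to have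
      probability at most \<open>e\<close>.\<close>
    define d where "d = e / card V"
    have d: "0 < d" using e V by (simp add: d_def card_gt_0_iff)
    have "\<forall>v. \<exists>mS. prob (sym_diff (F -` {v} \<inter> space M) {x \<in> space M. itinerary T L (fst mS) x \<in> snd mS}) < d"
      using gen[OF simple_functionD(2)[OF F] d] by simp
    from choice[OF this] obtain mS where
      mS': "\<forall>v. prob (sym_diff (F -` {v} \<inter> space M) {x \<in> space M. itinerary T L (fst (mS v)) x \<in> snd (mS v)}) < d" ..
    define m S where "m v = fst (mS v)" and "S v = snd (mS v)" for v
    have mS: "prob (sym_diff (F -` {v} \<inter> space M) {x \<in> space M. itinerary T L (m v) x \<in> S v}) < d" for v
      using mS' by (simp add: m_def S_def)
    define n where "n = Max (m ` V)"
    have mn: "m v \<le> n" if "v \<in> V" for v using that V by (simp add: n_def)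
    \<comment> \<open>The decoder guesses a value whose approximating set contains the word; if
      there is none, an arbitrary element of \<open>V\<close> serves as default.\<close>
    define h where "h l = (if \<exists>v\<in>V. take (m v) l \<in> S v then SOME v. v \<in> V \<and> take (m v) l \<in> S v else (SOME v. v \<in> V))" for l
    have h: "h l \<in> V \<and> ((\<exists>v\<in>V. take (m v) l \<in> S v) \<longrightarrow> take (m (h l)) l \<in> S (h l))" for l
    proof (cases "\<exists>v\<in>V. take (m v) l \<in> S v")
      case True
      then have "\<exists>v. v \<in> V \<and> take (m v) l \<in> S v" by blast
      from someI_ex[OF this] True show ?thesis by (simp add: h_def)
    next
      case False
      then show ?thesis using some_in_eq[of V] V by (simp add: h_def)
    qed
    have tk: "take (m v) (itinerary T L n x) = itinerary T L (m v) x" if "v \<in> V" for v x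
      using itinerary_drop_take[of 0 "m v" n T L x] mn[OF that] by simp
    define D where "D v = sym_diff (F -` {v} \<inter> space M) {x \<in> space M. itinerary T L (m v) x \<in> S v}" for v
    have D_sets: "D v \<in> events" for v
    proof -
      have "{x \<in> space M. itinerary T L (m v) x \<in> S v} = (\<Union>l\<in>S v \<inter> itinerary T L (m v) ` space M. itinerary T L (m v) -` {l} \<inter> space M)"
        by auto
      also have "\<dots> \<in> events"
        using simple_function_itinerary[OF L, of "m v"]
        by (intro sets.finite_UN) (auto simp: simple_function_def)
      finally show ?thesis unfolding D_def using simple_functionD(2)[OF F] by auto
    qed
    have "{x \<in> space M. F x \<noteq> h (itinerary T L n x)} \<subseteq> (\<Union>v\<in>V. D v)"
    proof
      fix x assume "x \<in> {x \<in> space M. F x \<noteq> h (itinerary T L n x)}"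
      then have x: "x \<in> space M" "F x \<noteq> h (itinerary T L n x)" by auto
      show "x \<in> (\<Union>v\<in>V. D v)"
      proof (rule ccontr)
        assume "x \<notin> (\<Union>v\<in>V. D v)"
        \<comment> \<open>Outside all error sets the only approximating set that contains the
          itinerary belongs to the true value \<open>F x\<close>, so the decoder has to return
          it.\<close>
        then have notD: "x \<notin> D v" if "v \<in> V" for v using that by blast
        have iff: "F x = v \<longleftrightarrow> itinerary T L (m v) x \<in> S v" if "v \<in> V" for v
        proof -
          have "x \<in> F -` {v} \<inter> space M \<longleftrightarrow> x \<in> {x \<in> space M. itinerary T L (m v) x \<in> S v}"
            using notD[OF that] unfolding D_def by blast
          then show ?thesis using x(1) by simp
        qed
        let ?l = "itinerary T L n x"
        have "take (m (F x)) ?l \<in> S (F x)" using iff[OF FV[OF x(1)]] tk[OF FV[OF x(1)]] by simp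
        then have "take (m (h ?l)) ?l \<in> S (h ?l)" "h ?l \<in> V" using h[of ?l] FV[OF x(1)] by blast+
        then show False using iff[of "h ?l"] tk[of "h ?l"] x(2) by simp
      qed
    qed
    then have "prob {x \<in> space M. F x \<noteq> h (itinerary T L n x)} \<le> prob (\<Union>v\<in>V. D v)"
      using V D_sets by (intro finite_measure_mono) auto
    also have "\<dots> \<le> (\<Sum>v\<in>V. prob (D v))"
      using V D_sets by (intro measure_UNION_le) auto
    also have "\<dots> \<le> (\<Sum>v\<in>V. d)" using mS by (intro sum_mono less_imp_le) (simp add: D_def)
    also have "\<dots> = e" using V by (simp add: d_def)
    finally show ?thesis using h by blast
  qed
  then have "\<forall>i::nat. \<exists>mh. (\<forall>l. snd mh l \<in> V) \<and>
      prob {x \<in> space M. F x \<noteq> snd mh (itinerary T L (fst mh) x)} \<le> 1 / real (Suc i)"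
    by simp
  from choice[OF this] obtain mh where mh: "\<forall>i. (\<forall>l. snd (mh i) l \<in> V) \<and>
      prob {x \<in> space M. F x \<noteq> snd (mh i) (itinerary T L (fst (mh i)) x)} \<le> 1 / real (Suc i)" ..
  define m h where "m i = fst (mh i)" and "h i = snd (mh i)" for i
  have hV: "h i l \<in> V" for i l using mh by (simp add: h_def)
  have close: "prob {x \<in> space M. F x \<noteq> h i (itinerary T L (m i) x)} \<le> 1 / real (Suc i)" for i
    using mh by (simp add: h_def m_def)
  define G where "G i x = h i (itinerary T L (m i) x)" for i x
  have sL: "simple_function M (itinerary T L (m i))" for i by (rule simple_function_itinerary[OF L])
  have sG: "simple_function M (G i)" for i
    unfolding G_def[abs_def] by (rule simple_function_compose1[OF sL])
  \<comment> \<open>Submodularity with \<open>Z = G i\<close>: as \<open>G i\<close> is a function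
    of the letters, conditioning on it leaves at least as much entropy as conditioning on the
    letters.\<close>
  have le: "entropy_rate F \<le> entropy_rate L + (var_entropy M (\<lambda>x. (F x, G i x)) - var_entropy M (G i))" for i
  proof -
    let ?Y = "itinerary T L (m i)"
    have "var_entropy M (\<lambda>x. (F x, ?Y x, G i x)) = var_entropy M (\<lambda>x. (F x, ?Y x))"
      using var_entropy_compose_inj[OF simple_function_Pair[OF F sL[of i]], of "\<lambda>(a, y). (a, y, h i y)"]
      by (simp add: G_def inj_on_def)
    moreover have "var_entropy M (\<lambda>x. (?Y x, G i x)) = var_entropy M ?Y"
      using var_entropy_compose_inj[OF sL[of i], of "\<lambda>y. (y, h i y)"] by (simp add: G_def inj_on_def)
    ultimately show ?thesis
      using var_entropy_submodular[OF F sL[of i] sG[of i]] entropy_rate_le_conditional[OF F L, of "m i"] by simp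
  qed
  define N where "N i = {x \<in> space M. F x \<noteq> G i x}" for i
  have N_sets: "N i \<in> events" for i
  proof -
    have "N i = (\<Union>w\<in>{w \<in> (\<lambda>x. (F x, G i x)) ` space M. fst w \<noteq> snd w}. (\<lambda>x. (F x, G i x)) -` {w} \<inter> space M)"
      by (auto simp: N_def)
    also have "\<dots> \<in> events"
      using simple_function_Pair[OF F sG, of i]
      by (intro sets.finite_UN) (auto simp: simple_function_def)
    finally show ?thesis .
  qed
  have close_sets: "\<bar>prob A - prob B\<bar> \<le> 1 / real (Suc i)"
    if "A \<in> events" "B \<in> events" "sym_diff A B \<subseteq> N i" for A B i
  proof -
    have "prob A \<le> prob (B \<union> N i)" "prob B \<le> prob (A \<union> N i)"
      using that N_sets by (auto intro!: finite_measure_mono)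
    moreover have "prob (B \<union> N i) \<le> prob B + prob (N i)" "prob (A \<union> N i) \<le> prob A + prob (N i)"
      using that N_sets by (auto intro!: measure_Un_le)
    moreover have "prob (N i) \<le> 1 / real (Suc i)" using close[of i] by (simp add: N_def G_def)
    ultimately show ?thesis by linarith
  qed
  have tends: "(\<lambda>i. prob (A i)) \<longlonglongrightarrow> prob B" if "\<And>i. A i \<in> events" "B \<in> events" "\<And>i. sym_diff (A i) B \<subseteq> N i" for A B
  proof (rule LIMSEQ_I)
    fix r :: real assume "0 < r"
    then obtain n where n: "1 / real (Suc n) < r" using nat_approx_posE by blast
    have "norm (prob (A i) - prob B) < r" if "i \<ge> n" for i
    proof -
      have "1 / real (Suc i) \<le> 1 / real (Suc n)" using that by (simp add: frac_le)
      then show ?thesis using close_sets[OF \<open>A i \<in> events\<close> \<open>B \<in> events\<close> \<open>sym_diff (A i) B \<subseteq> N i\<close>] n by simp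
    qed
    then show "\<exists>no. \<forall>n\<ge>no. norm (prob (A n) - prob B) < r" by blast
  qed
  have eG: "var_entropy M (G i) = - (\<Sum>v\<in>V. prob (G i -` {v} \<inter> space M) * ln (prob (G i -` {v} \<inter> space M)))" for i
    by (rule var_entropy_superset) (use V hV in \<open>auto simp: G_def\<close>)
  have eF: "var_entropy M F = - (\<Sum>v\<in>V. prob (F -` {v} \<inter> space M) * ln (prob (F -` {v} \<inter> space M)))"
    by (simp add: var_entropy_def V_def)
  have limG: "(\<lambda>i. var_entropy M (G i)) \<longlonglongrightarrow> var_entropy M F"
    unfolding eG eF
    by (intro tendsto_minus tendsto_sum tendsto_xlnx measure_nonneg tends simple_functionD(2)[OF sG] simple_functionD(2)[OF F])
       (auto simp: N_def)
  have eFG: "var_entropy M (\<lambda>x. (F x, G i x)) =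
      - (\<Sum>w\<in>V \<times> V. prob ((\<lambda>x. (F x, G i x)) -` {w} \<inter> space M) * ln (prob ((\<lambda>x. (F x, G i x)) -` {w} \<inter> space M)))" for i
    by (rule var_entropy_superset) (use V hV FV in \<open>auto simp: G_def\<close>)
  have eFF: "var_entropy M (\<lambda>x. (F x, F x)) =
      - (\<Sum>w\<in>V \<times> V. prob ((\<lambda>x. (F x, F x)) -` {w} \<inter> space M) * ln (prob ((\<lambda>x. (F x, F x)) -` {w} \<inter> space M)))"
    by (rule var_entropy_superset) (use V FV in auto)
  \<comment> \<open>All finitely many joint probabilities converge, because they change at most by
    the probability that \<open>F\<close> and \<open>G i\<close> differ.\<close>
  have "(\<lambda>i. var_entropy M (\<lambda>x. (F x, G i x))) \<longlonglongrightarrow> var_entropy M (\<lambda>x. (F x, F x))"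
    unfolding eFG eFF
    by (intro tendsto_minus tendsto_sum tendsto_xlnx measure_nonneg tends
        simple_functionD(2)[OF simple_function_Pair[OF F sG]] simple_functionD(2)[OF simple_function_Pair[OF F F]])
       (auto simp: N_def)
  also have "var_entropy M (\<lambda>x. (F x, F x)) = var_entropy M F"
    using var_entropy_compose_inj[OF F, of "\<lambda>a. (a, a)"] by (simp add: inj_on_def)
  finally have "(\<lambda>i. entropy_rate L + (var_entropy M (\<lambda>x. (F x, G i x)) - var_entropy M (G i)))
      \<longlonglongrightarrow> entropy_rate L + (var_entropy M F - var_entropy M F)"
    by (intro tendsto_intros limG)
  then have "entropy_rate F \<le> entropy_rate L + (var_entropy M F - var_entropy M F)"
    by (rule LIMSEQ_le_const) (use le in blast)
  then show ?thesis by simp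
qed

text \<open>For the upper bound every finite partition is read as the map sending a point to its
  cell; for the lower bound the fibres of \<open>L\<close> are themselves an admissible
  partition.\<close>

theorem metric_entropy_generator:
  assumes L: "simple_function M L"
    and gen: "\<And>A e. A \<in> sets M \<Longrightarrow> 0 < e \<Longrightarrow>
      \<exists>m S. measure M (sym_diff A {x \<in> space M. itinerary T L m x \<in> S}) < e"
  shows "metric_entropy T M = ereal (entropy_rate L)"
proof (rule antisym)
  show "metric_entropy T M \<le> ereal (entropy_rate L)"
    unfolding metric_entropy_def
  proof (rule SUP_least, clarify)
    fix P assume P: "finite_partition M P"
    define F where "F x = (THE B. B \<in> P \<and> x \<in> B)" for x
    have F: "F x = B" if "B \<in> P" "x \<in> B" for B x
      unfolding F_def using P that by (intro the_equality) (auto simp: finite_partition_def disjoint_def)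
    have sF: "simple_function M F"
    proof -
      have FP: "F x \<in> P \<and> x \<in> F x" if "x \<in> space M" for x
      proof -
        have "x \<in> \<Union>P" using P that by (simp add: finite_partition_def)
        then obtain B where "B \<in> P" "x \<in> B" by blast
        then show ?thesis using F by simp
      qed
      have "F ` space M \<subseteq> P" using FP by auto
      moreover have "F -` {B} \<inter> space M \<in> sets M" if "B \<in> F ` space M" for B
      proof -
        have "B \<in> P" using FP that by auto
        then have "B \<in> sets M" "B \<subseteq> space M" using P by (auto simp: finite_partition_def)
        moreover have "F -` {B} \<inter> space M = B"
        proof (intro set_eqI iffI)
          fix x assume "x \<in> F -` {B} \<inter> space M"
          then show "x \<in> B" using FP[of x] by auto
        next
          fix x assume "x \<in> B"
          then show "x \<in> F -` {B} \<inter> space M" using F[OF \<open>B \<in> P\<close>] \<open>B \<subseteq> space M\<close> by auto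
        qed
        ultimately show ?thesis by simp
      qed
      ultimately show ?thesis using P by (auto simp: simple_function_def finite_partition_def intro: finite_subset)
    qed
    have "partition_entropy_rate M T P = entropy_rate F"
      unfolding partition_entropy_rate_def entropy_rate_def
      by (simp add: partition_entropy_refined[OF P F T_space])
    then show "ereal (partition_entropy_rate M T P) \<le> ereal (entropy_rate L)"
      using entropy_rate_le_generator[OF sF L gen] by simp
  qed
next
  define P where "P = (\<lambda>v. L -` {v} \<inter> space M) ` (L ` space M)"
  define F where "F x = L -` {L x} \<inter> space M" for x
  have P: "finite_partition M P"
    using L by (auto simp: finite_partition_def P_def simple_function_def disjoint_def)
  have F: "F x = B" if "B \<in> P" "x \<in> B" for B x
    using that by (auto simp: P_def F_def)
  have Tk: "(T ^^ k) x \<in> space M" if "x \<in> space M" for k x using measurable_space[OF Tk_measurable that] .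
  have "var_entropy M (itinerary T F n) = block_entropy L n" for n
  proof -
    \<comment> \<open>Attained labels have distinct fibres, so replacing the labels of an itinerary
      by their fibres loses no information.\<close>
    have "inj_on (map (\<lambda>v. L -` {v} \<inter> space M)) (itinerary T L n ` space M)"
    proof (rule inj_on_mapI)
      show "inj_on (\<lambda>v. L -` {v} \<inter> space M) (\<Union> (set ` itinerary T L n ` space M))"
      proof (rule inj_onI)
        fix v w assume v: "v \<in> \<Union> (set ` itinerary T L n ` space M)"
          and eq: "L -` {v} \<inter> space M = L -` {w} \<inter> space M"
        from v obtain x where "x \<in> space M" "v = L x" using Tk by (auto simp: itinerary_def)
        then show "v = w" using eq by auto
      qed
    qed
    from var_entropy_compose_inj[OF simple_function_itinerary[OF L] this]
    show ?thesis by (simp add: itinerary_def[abs_def] F_def comp_def)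
  qed
  then have "partition_entropy_rate M T P = entropy_rate L"
    unfolding partition_entropy_rate_def entropy_rate_def
    by (simp add: partition_entropy_refined[OF P F T_space])
  then show "ereal (entropy_rate L) \<le> metric_entropy T M"
    unfolding metric_entropy_def using P by (intro SUP_upper2[of P]) auto
qed

end

section \<open>Symbolic dynamics\<close>

definition initial :: "nat \<Rightarrow> (nat \<Rightarrow> 'b) \<Rightarrow> 'b list" where
  "initial n x = map x [0..<n]"

lemma length_initial [simp]: "length (initial n x) = n"
  by (simp add: initial_def)

lemma initial_eq_iff: "initial n x = initial n y \<longleftrightarrow> (\<forall>i<n. x i = y i)"
  by (auto simp: initial_def)

lemma take_initial: "m \<le> n \<Longrightarrow> take m (initial n x) = initial m x"
  by (simp add: initial_def take_map)

lemma left_shift_funpow: "(left_shift ^^ k) x = (\<lambda>i. x (i + k))"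
  by (induction k) (auto simp: left_shift_def)

lemma itinerary_initial: "itinerary left_shift (\<lambda>x. x 0) n = initial n"
  by (auto simp: itinerary_def initial_def left_shift_funpow)

lemma open_cylinder: "open {y :: nat \<Rightarrow> nat. \<forall>i<m. y i = x i}"
proof -
  have "{y :: nat \<Rightarrow> nat. \<forall>i<m. y i = x i} = (\<Inter>i<m. (\<lambda>y. y i) -` {x i})" by auto
  also have "open \<dots>" by (intro open_INT ballI open_vimage) (auto intro: Topological_Spaces.open_discrete)
  finally show ?thesis .
qed

text \<open>Functions of finitely many letters are locally constant; in particular indicators of
  cylinders are admissible test functions for weak convergence.\<close>

lemma continuous_on_initial:
  fixes h :: "nat list \<Rightarrow> 'b::topological_space"
  shows "continuous_on S (\<lambda>x. h (initial m x))"
  unfolding continuous_on_def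
proof
  fix x assume "x \<in> S"
  have "eventually (\<lambda>y. h (initial m y) = h (initial m x)) (at x within S)"
    unfolding eventually_at_topological
  proof (intro exI conjI ballI impI)
    show "open {y :: nat \<Rightarrow> nat. \<forall>i<m. y i = x i}" by (rule open_cylinder)
  next
    fix y assume "y \<in> {y :: nat \<Rightarrow> nat. \<forall>i<m. y i = x i}"
    then have "initial m y = initial m x" by (simp add: initial_eq_iff)
    then show "h (initial m y) = h (initial m x)" by simp
  qed simp
  then show "((\<lambda>x. h (initial m x)) \<longlongrightarrow> h (initial m x)) (at x within S)"
    by (rule tendsto_eventually)
qed

lemma open_contains_cylinder:
  fixes U :: "(nat \<Rightarrow> nat) set"
  assumes "open U" "x \<in> U"
  obtains m where "{y. \<forall>i<m. y i = x i} \<subseteq> U"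
proof -
  have "openin (product_topology (\<lambda>_. euclidean) UNIV) U"
    using assms(1) by (simp add: open_fun_def)
  from product_topology_open_contains_basis[OF this assms(2)]
  obtain Y :: "nat \<Rightarrow> nat set" where Y: "x \<in> Pi\<^sub>E UNIV Y" "finite {i. Y i \<noteq> UNIV}" "Pi\<^sub>E UNIV Y \<subseteq> U"
    by auto
  obtain m where m: "\<And>i. Y i \<noteq> UNIV \<Longrightarrow> i < m"
    using finite_nat_set_iff_bounded[of "{i. Y i \<noteq> UNIV}"] Y(2) by auto
  have "{y. \<forall>i<m. y i = x i} \<subseteq> Pi\<^sub>E UNIV Y"
  proof
    fix y assume y: "y \<in> {y. \<forall>i<m. y i = x i}"
    have "y i \<in> Y i" for i
    proof (cases "Y i = UNIV")
      case False
      then have "y i = x i" using m y by simp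
      then show ?thesis using Y(1) by (auto simp: PiE_def)
    qed simp
    then show "y \<in> Pi\<^sub>E UNIV Y" by (simp add: PiE_def extensional_def)
  qed
  then show ?thesis by (rule that[OF subset_trans[OF _ Y(3)]])
qed

locale subshift_space =
  fixes p :: nat and a :: "nat \<Rightarrow> nat \<Rightarrow> nat"
  assumes p_ge_2: "2 \<le> p"
    and zero_one: "zero_one_matrix p a"
    and irred: "irreducible_aperiodic p a"
begin

abbreviation X :: "(nat \<Rightarrow> nat) set" where "X \<equiv> subshift p a"

definition BX :: "(nat \<Rightarrow> nat) measure" where "BX = restrict_space borel X"

lemma X_letter: "x \<in> X \<Longrightarrow> x i \<in> {1..p}"
  and X_edge: "x \<in> X \<Longrightarrow> a (x i) (x (Suc i)) = 1"
  by (auto simp: subshift_def)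

lemma shift_X: "x \<in> X \<Longrightarrow> left_shift x \<in> X"
  by (auto simp: subshift_def left_shift_def)

lemma shift_funpow_X: "x \<in> X \<Longrightarrow> (left_shift ^^ k) x \<in> X"
  by (auto simp: subshift_def left_shift_funpow)

lemma closed_X: "closed X"
proof -
  have "X = (\<Inter>i. (\<lambda>x. (x i, x (Suc i))) -` {(u, v). u \<in> {1..p} \<and> a u v = 1})"
    by (auto simp: subshift_def)
  moreover have "closed ((\<lambda>x. (x i, x (Suc i))) -` {(u, v). u \<in> {1..p} \<and> a u v = 1})" for i
  proof -
    have "(\<lambda>x. (x i, x (Suc i))) -` {(u, v). u \<in> {1..p} \<and> a u v = 1}
        = (\<Union>u\<in>{1..p}. (\<lambda>x. x i) -` {u} \<inter> (\<lambda>x. x (Suc i)) -` {v. a u v = 1})" by auto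
    moreover have S: "closed S" for S :: "nat set"
      unfolding closed_def by (rule Topological_Spaces.open_discrete)
    have "closed (\<Union>u\<in>{1..p}. (\<lambda>x. x i) -` {u} \<inter> (\<lambda>x. x (Suc i)) -` {v. a u v = 1})"
      by (intro closed_UN closed_Int closed_vimage S ballI finite_atLeastAtMost continuous_on_product_coordinates)
    ultimately show ?thesis by metis
  qed
  ultimately show ?thesis by auto
qed

lemma compact_X: "compact X"
proof -
  have "compact (Pi\<^sub>E UNIV (\<lambda>_::nat. {1..p}))"
    using compactin_PiE[of "\<lambda>_::nat. euclidean :: nat topology" UNIV "\<lambda>_. {1..p}"]
    unfolding euclidean_product_topology compactin_euclidean_iff by (simp add: finite_imp_compact)
  moreover have "X = Pi\<^sub>E UNIV (\<lambda>_. {1..p}) \<inter> X" by (auto simp: subshift_def)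
  ultimately show ?thesis using compact_Int_closed closed_X by metis
qed

lemma continuous_on_left_shift: "continuous_on S (left_shift :: (nat \<Rightarrow> nat) \<Rightarrow> nat \<Rightarrow> nat)"
  unfolding left_shift_def
  by (intro continuous_on_coordinatewise_then_product continuous_on_subset[OF continuous_on_product_coordinates] subset_UNIV)

lemma continuous_on_shift_funpow:
  assumes "continuous_on X \<phi>"
  shows "continuous_on X (\<lambda>x. \<phi> ((left_shift ^^ k) x))"
proof (rule continuous_on_compose2[OF assms])
  show "continuous_on X (left_shift ^^ k)"
    unfolding left_shift_funpow
    by (intro continuous_on_coordinatewise_then_product continuous_on_subset[OF continuous_on_product_coordinates] subset_UNIV)
qed (use shift_funpow_X in auto)

section \<open>Embedding of the subshift into the real line\<close>

definition base :: real where "base = real p + 2"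

text \<open>The expansion in a base larger than \<open>p + 1\<close> embeds \<open>X\<close> into the reals, where Helly's selection
  theorem provides weakly convergent subsequences.\<close>

definition code :: "(nat \<Rightarrow> nat) \<Rightarrow> real" where "code x = (\<Sum>i. real (x i) / base ^ i)"

lemma base_gt: "base > 1" "base > real p + 1"
  using p_ge_2 by (auto simp: base_def)

lemma geometric_base: "(\<lambda>i. real p / base ^ (i + n)) sums (real p / base ^ n * (base / (base - 1)))"
proof -
  have "(\<lambda>i. (1 / base) ^ i) sums (1 / (1 - 1 / base))"
    using base_gt by (intro geometric_sums) auto
  from sums_mult[OF this, of "real p / base ^ n"] show ?thesis
    using base_gt by (simp add: power_add power_one_over field_simps)
qed

lemma summable_code: "x \<in> X \<Longrightarrow> summable (\<lambda>i. real (x (i + k)) / base ^ (i + n))"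
  by (rule summable_comparison_test'[OF sums_summable[OF geometric_base], of 0])
     (use base_gt X_letter in \<open>auto intro!: divide_right_mono\<close>)

lemma code_tail:
  assumes x: "x \<in> X"
  shows "0 \<le> (\<Sum>i. real (x (i + n)) / base ^ (i + n))"
    and "(\<Sum>i. real (x (i + n)) / base ^ (i + n)) \<le> real p / base ^ n * (base / (base - 1))"
proof -
  show "0 \<le> (\<Sum>i. real (x (i + n)) / base ^ (i + n))"
    by (rule suminf_nonneg[OF summable_code[OF x]]) (use base_gt in auto)
  show "(\<Sum>i. real (x (i + n)) / base ^ (i + n)) \<le> real p / base ^ n * (base / (base - 1))"
    unfolding sums_unique[OF geometric_base]
    by (rule suminf_le[OF _ summable_code[OF x] sums_summable[OF geometric_base]])
       (use base_gt X_letter[OF x] in \<open>auto intro!: divide_right_mono\<close>)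
qed

lemma code_split:
  "x \<in> X \<Longrightarrow> code x = (\<Sum>i. real (x (i + n)) / base ^ (i + n)) + (\<Sum>i<n. real (x i) / base ^ i)"
  unfolding code_def using suminf_split_initial_segment[OF summable_code[of x 0 0], of n] by simp

lemma code_close:
  assumes "x \<in> X" "y \<in> X" "\<forall>i<n. x i = y i"
  shows "\<bar>code x - code y\<bar> \<le> real p / base ^ n * (base / (base - 1))"
proof -
  have "(\<Sum>i<n. real (x i) / base ^ i) = (\<Sum>i<n. real (y i) / base ^ i)" using assms(3) by simp
  then show ?thesis
    using code_split[OF assms(1), of n] code_split[OF assms(2), of n]
      code_tail[OF assms(1), of n] code_tail[OF assms(2), of n] by linarith
qed

text \<open>At the first difference the digits contribute at least \<open>1 / base ^ n\<close>,
  while all later digits together contribute at most \<open>p / (base - 1)\<close> times this, which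
  is less because \<open>base > p + 1\<close>.\<close>

lemma inj_on_code: "inj_on code X"
proof (rule inj_onI, rule ccontr)
  fix x y assume x: "x \<in> X" and y: "y \<in> X" and eq: "code x = code y" and "x \<noteq> y"
  then have "\<exists>i. x i \<noteq> y i" by auto
  define n where "n = (LEAST i. x i \<noteq> y i)"
  have n: "x n \<noteq> y n" unfolding n_def by (rule LeastI_ex) fact
  have less: "x i = y i" if "i < n" for i using not_less_Least that unfolding n_def by blast
  have *: "False" if xy: "x \<in> X" "y \<in> X" "code x = code y" "\<And>i. i < n \<Longrightarrow> x i = y i" "x n < y n" for x y
  proof -
    have "(\<Sum>i<n. real (x i) / base ^ i) = (\<Sum>i<n. real (y i) / base ^ i)" using xy(4) by simp
    then have "(\<Sum>i. real (x (i + Suc n)) / base ^ (i + Suc n)) + real (x n) / base ^ n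
        = (\<Sum>i. real (y (i + Suc n)) / base ^ (i + Suc n)) + real (y n) / base ^ n"
      using code_split[OF xy(1), of "Suc n"] code_split[OF xy(2), of "Suc n"] xy(3) by simp
    then have "real (y n) / base ^ n - real (x n) / base ^ n \<le> real p / base ^ Suc n * (base / (base - 1))"
      using code_tail[OF xy(1), of "Suc n"] code_tail[OF xy(2), of "Suc n"] by linarith
    moreover have "1 / base ^ n \<le> (real (y n) - real (x n)) / base ^ n"
      using xy(5) base_gt by (intro divide_right_mono) auto
    moreover have "real p / base ^ Suc n * (base / (base - 1)) = (real p / (base - 1)) / base ^ n"
      using base_gt by (simp add: field_simps)
    moreover have "(real p / (base - 1)) / base ^ n < 1 / base ^ n"
      using base_gt by (intro divide_strict_right_mono) auto
    ultimately show False by (simp add: diff_divide_distrib)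
  qed
  show False
  proof (cases "x n < y n")
    case True
    then show False using *[OF x y eq less] by simp
  next
    case False
    then show False using *[OF y x eq[symmetric]] less n by (metis linorder_neqE_nat)
  qed
qed

lemma continuous_on_code: "continuous_on X code"
proof -
  have "uniform_limit X (\<lambda>n x. \<Sum>i<n. real (x i) / base ^ i) (\<lambda>x. \<Sum>i. real (x i) / base ^ i) sequentially"
  proof (rule Weierstrass_m_test_ev)
    show "summable (\<lambda>i. real p / base ^ i)" using sums_summable[OF geometric_base[of 0]] by simp
  qed (use base_gt X_letter in \<open>auto intro!: divide_right_mono always_eventually\<close>)
  moreover have "continuous_on X (\<lambda>x. \<Sum>i<n. real (x i) / base ^ i)" for n
  proof -
    have "(\<Sum>i<n. real (x i) / base ^ i) = (\<Sum>i<n. real (initial n x ! i) / base ^ i)" for x :: "nat \<Rightarrow> nat"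
      by (simp add: initial_def)
    then show ?thesis using continuous_on_initial[of X "\<lambda>l. \<Sum>i<n. real (l ! i) / base ^ i" n] by simp
  qed
  ultimately show ?thesis unfolding code_def
    by (intro uniform_limit_theorem[where f = "\<lambda>n x. \<Sum>i<n. real (x i) / base ^ i"]) auto
qed

abbreviation decode :: "real \<Rightarrow> nat \<Rightarrow> nat" where "decode \<equiv> the_inv_into X code"

lemma decode_code: "x \<in> X \<Longrightarrow> decode (code x) = x"
  by (rule the_inv_into_f_f[OF inj_on_code])

lemma decode_X: "y \<in> code ` X \<Longrightarrow> decode y \<in> X"
  using decode_code by auto

lemma continuous_on_decode: "continuous_on (code ` X) decode"
  by (rule continuous_on_inv_into[OF continuous_on_code compact_X inj_on_code])

lemma compact_code_X: "compact (code ` X)"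
  by (rule compact_continuous_image[OF continuous_on_code compact_X])

text \<open>Uniform continuity is obtained on the compact set of codes and carried back: points with
  sufficiently many common letters have close codes.\<close>

lemma continuous_on_X_uniform:
  fixes \<phi> :: "(nat \<Rightarrow> nat) \<Rightarrow> 'b::metric_space"
  assumes "continuous_on X \<phi>" "0 < e"
  obtains m where "\<And>x y. x \<in> X \<Longrightarrow> y \<in> X \<Longrightarrow> \<forall>i<m. x i = y i \<Longrightarrow> dist (\<phi> x) (\<phi> y) < e"
proof -
  have "continuous_on (code ` X) (\<lambda>y. \<phi> (decode y))"
    by (rule continuous_on_compose2[OF assms(1) continuous_on_decode]) (use decode_X in auto)
  then have "uniformly_continuous_on (code ` X) (\<lambda>y. \<phi> (decode y))"
    by (rule compact_uniformly_continuous[OF _ compact_code_X])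
  then obtain d where d: "d > 0" and
    ud: "\<And>x y. x \<in> code ` X \<Longrightarrow> y \<in> code ` X \<Longrightarrow> dist y x < d \<Longrightarrow> dist (\<phi> (decode y)) (\<phi> (decode x)) < e"
    using assms(2) unfolding uniformly_continuous_on_def by metis
  have "(\<lambda>n. real p * (base / (base - 1)) * (1 / base) ^ n) \<longlonglongrightarrow> real p * (base / (base - 1)) * 0"
    using base_gt by (intro tendsto_mult tendsto_const LIMSEQ_power_zero) auto
  then have "eventually (\<lambda>n. real p * (base / (base - 1)) * (1 / base) ^ n < d) sequentially"
    using d by (intro order_tendstoD) auto
  then obtain n where n: "real p * (base / (base - 1)) * (1 / base) ^ n < d"
    by (meson eventually_sequentially order_refl)
  show ?thesis
  proof (rule that)
    fix x y assume xy: "x \<in> X" "y \<in> X" "\<forall>i<n. x i = y i"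
    have "dist (code x) (code y) < d"
    proof -
      have "real p / base ^ n * (base / (base - 1)) = real p * (base / (base - 1)) * (1 / base) ^ n"
        by (simp add: power_one_over)
      then show ?thesis using code_close[OF xy] n unfolding dist_real_def by linarith
    qed
    then show "dist (\<phi> x) (\<phi> y) < e" using ud[of "code y" "code x"] xy by (simp add: decode_code)
  qed
qed

lemma continuous_on_X_bounded:
  fixes \<phi> :: "(nat \<Rightarrow> nat) \<Rightarrow> real"
  assumes "continuous_on X \<phi>"
  obtains K where "0 < K" "\<And>x. x \<in> X \<Longrightarrow> \<bar>\<phi> x\<bar> \<le> K"
proof -
  have "bounded (\<phi> ` X)"
    by (intro compact_imp_bounded compact_continuous_image assms compact_X)
  then show ?thesis using that by (auto simp: bounded_pos)
qed

subsection \<open>Measurability on the subshift\<close>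

lemma space_BX [simp]: "space BX = X"
  by (simp add: BX_def space_restrict_space)

lemma continuous_measurable_BX:
  fixes \<phi> :: "(nat \<Rightarrow> nat) \<Rightarrow> 'b::topological_space"
  shows "continuous_on X \<phi> \<Longrightarrow> \<phi> \<in> borel_measurable BX"
  unfolding BX_def by (rule borel_measurable_continuous_on_restrict)

lemma left_shift_measurable: "left_shift \<in> measurable BX BX"
proof -
  have "left_shift \<in> measurable BX borel"
    by (rule continuous_measurable_BX[OF continuous_on_left_shift])
  then show ?thesis unfolding BX_def
    by (intro measurable_restrict_space2) (use shift_X in \<open>auto simp: BX_def space_restrict_space\<close>)
qed

text \<open>Arbitrary unions of cylinders of one length, so that complements and finite unions stay
  within the family.\<close>

definition cylinders :: "(nat \<Rightarrow> nat) set set" where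
  "cylinders = {{x \<in> X. initial m x \<in> S} | m S. True}"

lemma initial_in_BX: "{x \<in> X. initial m x \<in> S} \<in> sets BX"
proof -
  have "(\<lambda>x. if initial m x \<in> S then 1 else 0 :: real) \<in> borel_measurable BX"
    by (rule continuous_measurable_BX[OF continuous_on_initial])
  from measurable_sets[OF this, of "{1}"]
  have "(\<lambda>x. if initial m x \<in> S then 1 else 0 :: real) -` {1} \<inter> X \<in> sets BX" by simp
  also have "(\<lambda>x. if initial m x \<in> S then 1 else 0 :: real) -` {1} \<inter> X = {x \<in> X. initial m x \<in> S}"
    by (auto split: if_splits)
  finally show ?thesis .
qed

lemma Int_stable_cylinders: "Int_stable cylinders"
proof (rule Int_stableI)
  fix A B assume "A \<in> cylinders" "B \<in> cylinders"
  then obtain m S n T where A: "A = {x \<in> X. initial m x \<in> S}" and B: "B = {x \<in> X. initial n x \<in> T}"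
    by (auto simp: cylinders_def)
  have "A \<inter> B = {x \<in> X. initial (max m n) x \<in> {l. take m l \<in> S \<and> take n l \<in> T}}"
    by (auto simp: A B take_initial)
  then show "A \<inter> B \<in> cylinders" unfolding cylinders_def by blast
qed

text \<open>The trace of an open set on \<open>X\<close> is the union of the cylinders that it
  contains, and there are only countably many words.\<close>

lemma sets_BX: "sets BX = sigma_sets X cylinders"
proof
  show "sigma_sets X cylinders \<subseteq> sets BX"
    using sets.sigma_sets_subset[of cylinders BX] initial_in_BX by (auto simp: cylinders_def)
  have sub: "cylinders \<subseteq> Pow X" by (auto simp: cylinders_def)
  interpret C: sigma_algebra X "sigma_sets X cylinders" by (rule sigma_algebra_sigma_sets[OF sub])
  have "X \<inter> B \<in> sigma_sets X cylinders" if "B \<in> sigma_sets UNIV {S :: (nat \<Rightarrow> nat) set. open S}" for B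
    using that
  proof induction
    case (Basic U)
    have "X \<inter> U = (\<Union>(m, w)\<in>{(m, w). {x \<in> X. initial m x \<in> {w}} \<subseteq> U}. {x \<in> X. initial m x \<in> {w}})"
    proof (intro set_eqI iffI)
      fix x assume x: "x \<in> X \<inter> U"
      then obtain m where "{y. \<forall>i<m. y i = x i} \<subseteq> U" using open_contains_cylinder Basic by blast
      then have "{y \<in> X. initial m y \<in> {initial m x}} \<subseteq> U" by (auto simp: initial_eq_iff)
      with x show "x \<in> (\<Union>(m, w)\<in>{(m, w). {x \<in> X. initial m x \<in> {w}} \<subseteq> U}. {x \<in> X. initial m x \<in> {w}})"
        by blast
    qed auto
    also have "\<dots> \<in> sigma_sets X cylinders"
    proof (rule C.countable_UN'')
      show "countable {(m, w). {x \<in> X. initial m x \<in> {w}} \<subseteq> U}" by (rule countableI_type)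
    next
      fix mw assume "mw \<in> {(m, w). {x \<in> X. initial m x \<in> {w}} \<subseteq> U}"
      have "{x \<in> X. initial m x \<in> {w}} \<in> cylinders" for m w unfolding cylinders_def by blast
      then show "(case mw of (m, w) \<Rightarrow> {x \<in> X. initial m x \<in> {w}}) \<in> sigma_sets X cylinders"
        by (auto split: prod.split)
    qed
    finally show ?case .
  next
    case Empty
    then show ?case by (simp add: sigma_sets.Empty)
  next
    case (Compl B)
    have "X \<inter> (UNIV - B) = X - (X \<inter> B)" by auto
    with Compl show ?case by (metis sigma_sets.Compl)
  next
    case (Union B)
    have "X \<inter> (\<Union>i. B i) = (\<Union>i. X \<inter> B i)" by auto
    with Union show ?case by (metis sigma_sets.Union)
  qed
  then show "sets BX \<subseteq> sigma_sets X cylinders"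
    by (auto simp: BX_def sets_restrict_space borel_def)
qed

text \<open>The sets that can be approximated form a sigma-algebra: complements keep the error, and
  a countable union is first cut to a finite one by continuity of the measure.\<close>

lemma cylinder_approx:
  assumes "prob_space \<mu>" "sets \<mu> = sets BX" and A: "A \<in> sets \<mu>" and e: "0 < e"
  shows "\<exists>m S. measure \<mu> (sym_diff A {x \<in> X. initial m x \<in> S}) < e"
proof -
  interpret prob_space \<mu> by fact
  have sub: "cylinders \<subseteq> Pow X" by (auto simp: cylinders_def)
  have cyl: "{x \<in> X. initial m x \<in> S} \<in> sets \<mu>" for m S using initial_in_BX assms(2) by simp
  have "\<forall>e>0. \<exists>m S. prob (sym_diff A {x \<in> X. initial m x \<in> S}) < e"
    if "A \<in> sigma_sets X cylinders" for A
    using that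
  proof induction
    case (Basic A)
    then obtain m S where "A = {x \<in> X. initial m x \<in> S}" by (auto simp: cylinders_def)
    then have "prob (sym_diff A {x \<in> X. initial m x \<in> S}) = 0" by simp
    then show ?case by (intro allI impI exI[of _ m] exI[of _ S]) simp
  next
    case Empty
    show ?case by (intro allI impI exI[of _ 0] exI[of _ "{}"]) simp
  next
    case (Compl A)
    show ?case
    proof (intro allI impI)
      fix e :: real assume "0 < e"
      then obtain m S where mS: "prob (sym_diff A {x \<in> X. initial m x \<in> S}) < e" using Compl by blast
      have "A \<subseteq> X" using sigma_sets_into_sp[OF sub Compl.hyps] .
      then have "sym_diff (X - A) {x \<in> X. initial m x \<in> - S} = sym_diff A {x \<in> X. initial m x \<in> S}" by auto
      with mS have "prob (sym_diff (X - A) {x \<in> X. initial m x \<in> - S}) < e" by (simp only:)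
      then show "\<exists>m S. prob (sym_diff (X - A) {x \<in> X. initial m x \<in> S}) < e" by (intro exI)
    qed
  next
    case (Union A)
    have Am: "A i \<in> events" for i using Union.hyps assms(2) by (simp add: sets_BX)
    show ?case
    proof (intro allI impI)
      fix e :: real assume e: "0 < e"
      have "(\<lambda>n. prob (\<Union>i<n. A i)) \<longlonglongrightarrow> prob (\<Union>n. \<Union>i<n. A i)"
        using Am by (intro finite_Lim_measure_incseq) (auto intro!: incseq_SucI simp: lessThan_Suc)
      also have "(\<Union>n. \<Union>i<n. A i) = (\<Union>i. A i)" by auto
      finally have "eventually (\<lambda>n. prob (\<Union>i. A i) - e / 2 < prob (\<Union>i<n. A i)) sequentially"
        using e by (intro order_tendstoD) auto
      then obtain n where n: "prob (\<Union>i. A i) - e / 2 < prob (\<Union>i<n. A i)"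
        by (meson eventually_sequentially order_refl)
      \<comment> \<open>The \<open>n\<close> errors add up to less than \<open>e / 2\<close>; adding
        1 in the denominator also admits \<open>n = 0\<close>.\<close>
      define d where "d = e / (2 * (real n + 1))"
      have d: "0 < d" using e by (simp add: d_def)
      have "\<forall>i. \<exists>mS. prob (sym_diff (A i) {x \<in> X. initial (fst mS) x \<in> snd mS}) < d"
        using Union.IH d by simp
      from choice[OF this] obtain mS where mS: "\<forall>i. prob (sym_diff (A i) {x \<in> X. initial (fst (mS i)) x \<in> snd (mS i)}) < d" ..
      define B where "B i = {x \<in> X. initial (fst (mS i)) x \<in> snd (mS i)}" for i
      define m where "m = Max (insert 0 ((\<lambda>i. fst (mS i)) ` {..<n}))"
      have mi: "fst (mS i) \<le> m" if "i < n" for i using that by (simp add: m_def)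
      define S where "S = {l. \<exists>i<n. take (fst (mS i)) l \<in> snd (mS i)}"
      have BS: "{x \<in> X. initial m x \<in> S} = (\<Union>i<n. B i)"
        using mi by (auto simp: S_def B_def take_initial)
      have Bm: "B i \<in> events" for i by (simp add: B_def cyl)
      have "sym_diff (\<Union>i. A i) (\<Union>i<n. B i) \<subseteq> ((\<Union>i. A i) - (\<Union>i<n. A i)) \<union> (\<Union>i<n. sym_diff (A i) (B i))"
        by auto
      then have "prob (sym_diff (\<Union>i. A i) (\<Union>i<n. B i))
          \<le> prob (((\<Union>i. A i) - (\<Union>i<n. A i)) \<union> (\<Union>i<n. sym_diff (A i) (B i)))"
        using Am Bm by (intro finite_measure_mono) auto
      also have "\<dots> \<le> prob ((\<Union>i. A i) - (\<Union>i<n. A i)) + prob (\<Union>i<n. sym_diff (A i) (B i))"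
        using Am Bm by (intro measure_Un_le) auto
      also have "prob ((\<Union>i. A i) - (\<Union>i<n. A i)) = prob (\<Union>i. A i) - prob (\<Union>i<n. A i)"
        using Am by (intro finite_measure_Diff) auto
      also have "prob (\<Union>i<n. sym_diff (A i) (B i)) \<le> (\<Sum>i<n. prob (sym_diff (A i) (B i)))"
        using Am Bm by (intro measure_UNION_le) auto
      also have "\<dots> \<le> (\<Sum>i<n. d)"
        using mS by (intro sum_mono) (simp add: B_def less_imp_le)
      also have "(\<Sum>i<n. d) < e / 2" using e by (simp add: d_def field_simps)
      finally have "prob (sym_diff (\<Union>i. A i) {x \<in> X. initial m x \<in> S}) < e"
        using n unfolding BS by linarith
      then show "\<exists>m S. prob (sym_diff (\<Union>i. A i) {x \<in> X. initial m x \<in> S}) < e" by blast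
    qed
  qed
  then show ?thesis using A e assms(2) by (simp add: sets_BX)
qed

end

context subshift_space
begin

subsection \<open>Weak compactness\<close>

lemma code_bounds: "x \<in> X \<Longrightarrow> 0 \<le> code x" "x \<in> X \<Longrightarrow> code x \<le> real p * (base / (base - 1))"
  using code_tail[of x 0] by (simp_all add: code_def)

lemma integrable_continuous_X:
  fixes \<phi> :: "(nat \<Rightarrow> nat) \<Rightarrow> real"
  assumes "prob_space \<mu>" "sets \<mu> = sets BX" "continuous_on X \<phi>"
  shows "integrable \<mu> \<phi>"
proof -
  interpret prob_space \<mu> by fact
  obtain K where "\<And>x. x \<in> X \<Longrightarrow> \<bar>\<phi> x\<bar> \<le> K" using continuous_on_X_bounded[OF assms(3)] by blast
  moreover have "space \<mu> = X" using sets_eq_imp_space_eq[OF assms(2)] by simp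
  moreover have "\<phi> \<in> borel_measurable \<mu>"
    using continuous_measurable_BX[OF assms(3)] measurable_cong_sets[OF assms(2) refl] by blast
  ultimately show ?thesis by (intro integrable_const_bound[of _ K]) auto
qed

text \<open>Helly's theorem is applied to the laws of \<open>code\<close>; the limit is shown to
  live on the compact set of codes and is carried back by \<open>decode\<close>.\<close>

lemma weak_limit:
  fixes \<mu> :: "nat \<Rightarrow> (nat \<Rightarrow> nat) measure"
  assumes prob: "\<And>k. prob_space (\<mu> k)" and sets: "\<And>k. sets (\<mu> k) = sets BX"
  obtains r \<nu> where "strict_mono (r :: nat \<Rightarrow> nat)" "prob_space \<nu>" "sets \<nu> = sets BX"
    "\<And>\<phi> :: (nat \<Rightarrow> nat) \<Rightarrow> real. continuous_on X \<phi> \<Longrightarrow>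
      (\<lambda>k. \<integral>x. \<phi> x \<partial>\<mu> (r k)) \<longlonglongrightarrow> (\<integral>x. \<phi> x \<partial>\<nu>)"
proof -
  have space: "space (\<mu> k) = X" for k using sets_eq_imp_space_eq[OF sets[of k]] by simp
  have meas: "\<phi> \<in> borel_measurable (\<mu> k)" if "continuous_on X \<phi>" for k and \<phi> :: "(nat \<Rightarrow> nat) \<Rightarrow> real"
    using continuous_measurable_BX[OF that] measurable_cong_sets[OF sets refl] by blast
  define D where "D k = distr (\<mu> k) borel code" for k
  have D: "real_distribution (D k)" for k
    unfolding D_def by (rule prob_space.real_distribution_distr[OF prob meas[OF continuous_on_code]])
  define c where "c = real p * (base / (base - 1))"
  \<comment> \<open>All codes lie in one compact interval. The left end \<open>-1\<close> merely
    keeps \<open>0\<close> inside the half-open interval.\<close>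
  have "tight D"
    unfolding tight_def
  proof (intro conjI allI impI D)
    fix e :: real assume "0 < e"
    have "0 \<le> c" using base_gt by (simp add: c_def)
    moreover have "1 - e < measure (D k) {-1<..c}" for k
    proof -
    have "measure (D k) {-1<..c} = measure (\<mu> k) (code -` {-1<..c} \<inter> X)"
      unfolding D_def using meas[OF continuous_on_code, of k] by (simp add: measure_distr space)
    also have "code -` {-1<..c} \<inter> X = space (\<mu> k)"
      unfolding space using code_bounds by (force simp: c_def)
    finally show "1 - e < measure (D k) {-1<..c}"
      using prob_space.prob_space[OF prob[of k]] \<open>0 < e\<close> by simp
    qed
    ultimately have "- 1 < c \<and> (\<forall>n. 1 - e < measure (D n) {-1<..c})" by simp
    then show "\<exists>a b. a < b \<and> (\<forall>n. 1 - e < measure (D n) {a<..b})" by blast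
  qed
  from tight_imp_convergent_subsubsequence[OF this strict_mono_id]
  obtain r M where r: "strict_mono r" and M: "real_distribution M" and wc: "weak_conv_m (D \<circ> id \<circ> r) M"
    by auto
  interpret M: real_distribution M by (rule M)
  have conv: "(\<lambda>k. integral\<^sup>L (D (r k)) F) \<longlonglongrightarrow> integral\<^sup>L M F"
    if "continuous_on UNIV F" "\<And>x. norm (F x) \<le> B" for F :: "real \<Rightarrow> real" and B
    using weak_conv_imp_integral_bdd_continuous_conv[OF _ M wc, of F B] D that
    by (simp add: continuous_on_eq_continuous_at)
  have intD: "integral\<^sup>L (D k) F = (\<integral>x. F (code x) \<partial>\<mu> k)" if "continuous_on UNIV F" for F :: "real \<Rightarrow> real" and k
    unfolding D_def
    by (rule integral_distr[OF meas[OF continuous_on_code]]) (rule borel_measurable_continuous_onI[OF that])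
  define K where "K = code ` X"
  have K: "compact K" "closed K" unfolding K_def using compact_code_X compact_imp_closed by auto
  obtain x0 where "x0 \<in> X" using prob_space.not_empty[OF prob[of 0]] space by auto
  then have K0: "K \<noteq> {}" by (auto simp: K_def)
  have AE_K: "AE y in M. y \<in> K"
  proof -
    \<comment> \<open>A bounded continuous function that vanishes exactly on \<open>K\<close>. Its
      integrals against all \<open>D k\<close> are zero, hence so is its integral against
      \<open>M\<close>, which forces \<open>M\<close> onto \<open>K\<close>.\<close>
    define F where "F y = min 1 (infdist y K)" for y
    have F: "continuous_on UNIV F" "\<And>y. norm (F y) \<le> 1"
      unfolding F_def by (auto intro!: continuous_intros continuous_on_infdist simp: infdist_nonneg)
    have "integral\<^sup>L (D k) F = 0" for k
    proof -
      have "(\<integral>x. F (code x) \<partial>\<mu> k) = (\<integral>x. 0 \<partial>\<mu> k)"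
        by (rule Bochner_Integration.integral_cong) (auto simp: F_def K_def space)
      then show ?thesis using intD[OF F(1)] by simp
    qed
    then have "integral\<^sup>L M F = 0" using conv[OF F] LIMSEQ_unique[OF _ tendsto_const[of 0]] by simp
    moreover have "integrable M F"
      using F(2) borel_measurable_continuous_onI[OF F(1)] by (intro M.integrable_const_bound[of _ 1]) auto
    ultimately have "AE y in M. F y = 0"
      by (subst (asm) integral_nonneg_eq_0_iff_AE) (auto simp: F_def infdist_nonneg)
    then show ?thesis
    proof (rule AE_mp, intro AE_I2 impI)
      fix y assume "F y = 0"
      then have "infdist y K = 0" by (simp add: F_def min_def split: if_splits)
      then show "y \<in> K" using in_closed_iff_infdist_zero[OF K(2) K0] by simp
    qed
  qed
  have Kb: "K \<in> M.events" using K(2) by (simp add: borel_closed)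
  have MK: "emeasure M K = 1" using M.emeasure_eq_1_AE[OF Kb AE_K] .
  define N where "N = restrict_space M K"
  have N: "prob_space N" unfolding N_def by (rule prob_space_restrict_space[OF Kb MK])
  have setsN: "sets N = sets (restrict_space borel K)" unfolding N_def by (rule sets_restrict_space_cong) simp
  have spaceN: "space N = K" unfolding N_def using Kb by simp
  have dec: "decode \<in> measurable N BX"
  proof -
    have "decode \<in> borel_measurable (restrict_space borel K)"
      unfolding K_def by (rule borel_measurable_continuous_on_restrict[OF continuous_on_decode])
    then have "decode \<in> borel_measurable N" using measurable_cong_sets[OF setsN refl] by blast
    then show ?thesis unfolding BX_def
      by (intro measurable_restrict_space2) (use decode_X in \<open>auto simp: spaceN K_def\<close>)
  qed
  define \<nu> where "\<nu> = distr N BX decode"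
  have lim: "(\<lambda>k. \<integral>x. \<phi> x \<partial>\<mu> (r k)) \<longlonglongrightarrow> (\<integral>x. \<phi> x \<partial>\<nu>)"
    if phi: "continuous_on X \<phi>" for \<phi> :: "(nat \<Rightarrow> nat) \<Rightarrow> real"
  proof -
    obtain B where B: "0 < B" "\<And>x. x \<in> X \<Longrightarrow> \<bar>\<phi> x\<bar> \<le> B" using continuous_on_X_bounded[OF phi] by blast
    have "continuous_on K (\<lambda>y. \<phi> (decode y))" unfolding K_def
      by (rule continuous_on_compose2[OF phi continuous_on_decode]) (use decode_X in auto)
    \<comment> \<open>Weak convergence on the line tests only functions on the whole line; Tietze's
      extension keeps the bound \<open>B\<close>.\<close>
    then obtain G :: "real \<Rightarrow> real" where G: "continuous_on UNIV G" "\<And>y. y \<in> K \<Longrightarrow> G y = \<phi> (decode y)"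
      "\<And>y. norm (G y) \<le> B"
      using Tietze[of K "\<lambda>y. \<phi> (decode y)" UNIV B] K(2) B decode_X by (auto simp: K_def)
    have 1: "integral\<^sup>L (D k) G = (\<integral>x. \<phi> x \<partial>\<mu> k)" for k
      unfolding intD[OF G(1)]
      by (rule Bochner_Integration.integral_cong) (auto simp: space G(2) K_def decode_code)
    have "(\<integral>x. \<phi> x \<partial>\<nu>) = (\<integral>y. \<phi> (decode y) \<partial>N)"
      unfolding \<nu>_def by (rule integral_distr[OF dec continuous_measurable_BX[OF phi]])
    also have "\<dots> = (\<integral>y. G y \<partial>N)"
      by (rule Bochner_Integration.integral_cong) (auto simp: spaceN G(2))
    also have "\<dots> = (\<integral>y. indicator K y *\<^sub>R G y \<partial>M)"
      unfolding N_def using Kb by (subst integral_restrict_space) auto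
    also have "\<dots> = integral\<^sup>L M G"
    proof (rule integral_cong_AE)
      show "AE y in M. indicator K y *\<^sub>R G y = G y" using AE_K by eventually_elim simp
      show "G \<in> borel_measurable M" using borel_measurable_continuous_onI[OF G(1)] by simp
      then show "(\<lambda>y. indicator K y *\<^sub>R G y) \<in> borel_measurable M" using Kb by measurable
    qed
    finally show ?thesis using conv[OF G(1,3)] unfolding 1 by simp
  qed
  have "prob_space \<nu>" unfolding \<nu>_def by (rule prob_space.prob_space_distr[OF N dec])
  moreover have "sets \<nu> = sets BX" by (simp add: \<nu>_def)
  ultimately show ?thesis using r lim that by blast
qed

abbreviation invariants :: "(nat \<Rightarrow> nat) measure set" where
  "invariants \<equiv> invariant_measures X left_shift"

lemma invariantsD:
  assumes "\<mu> \<in> invariants"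
  shows "prob_space \<mu>" "sets \<mu> = sets BX" "space \<mu> = X" "measure_preserving_map \<mu> left_shift"
proof -
  show *: "prob_space \<mu>" "sets \<mu> = sets BX" using assms by (auto simp: invariant_measures_def BX_def)
  show "space \<mu> = X" using sets_eq_imp_space_eq[OF *(2)] by simp
  show "measure_preserving_map \<mu> left_shift"
    using assms * by (auto simp: invariant_measures_def measure_preserving_map_def measure_preserving_map_axioms_def)
qed

lemma continuous_on_indicator_initial:
  "continuous_on X (\<lambda>x. indicator {x \<in> X. initial m x \<in> S} x :: real)"
proof -
  have "continuous_on X (\<lambda>x. if initial m x \<in> S then 1 else 0 :: real)" by (rule continuous_on_initial)
  then show ?thesis by (rule continuous_on_cong[THEN iffD1, rotated -1]) (auto simp: indicator_def)
qed

lemma measure_cylinder_integral: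
  assumes "prob_space \<mu>" "sets \<mu> = sets BX"
  shows "measure \<mu> {x \<in> X. initial m x \<in> S} = (\<integral>x. indicator {x \<in> X. initial m x \<in> S} x \<partial>\<mu>)"
proof -
  interpret prob_space \<mu> by fact
  have "{x \<in> X. initial m x \<in> S} \<in> events" using initial_in_BX assms(2) by simp
  then show ?thesis by simp
qed

text \<open>Indicators of cylinders are continuous, and cylinders form an intersection-stable
  generator of the Borel sets.\<close>

lemma invariantsI:
  assumes prob: "prob_space \<mu>" and sets: "sets \<mu> = sets BX"
    and inv: "\<And>\<phi> :: (nat \<Rightarrow> nat) \<Rightarrow> real. continuous_on X \<phi> \<Longrightarrow>
      (\<integral>x. \<phi> (left_shift x) \<partial>\<mu>) = (\<integral>x. \<phi> x \<partial>\<mu>)"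
  shows "\<mu> \<in> invariants"
proof -
  interpret prob_space \<mu> by fact
  have meas: "left_shift \<in> measurable \<mu> \<mu>"
    using left_shift_measurable measurable_cong_sets[OF sets sets] by blast
  interpret D: prob_space "distr \<mu> \<mu> left_shift" by (rule prob_space_distr[OF meas])
  have space: "space \<mu> = X" using sets_eq_imp_space_eq[OF sets] by simp
  have "distr \<mu> \<mu> left_shift = \<mu>"
  proof (rule measure_eqI_generator_eq[OF Int_stable_cylinders])
    show "cylinders \<subseteq> Pow X" by (auto simp: cylinders_def)
    show "sets (distr \<mu> \<mu> left_shift) = sigma_sets X cylinders" "sets \<mu> = sigma_sets X cylinders"
      using sets sets_BX by auto
    have "X \<in> cylinders" by (auto simp: cylinders_def intro!: exI[of _ 0] exI[of _ UNIV])
    then show "range (\<lambda>_::nat. X) \<subseteq> cylinders" "(\<Union>i::nat. X) = X" by auto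
    show "\<And>i. emeasure (distr \<mu> \<mu> left_shift) X \<noteq> \<infinity>" by (simp add: D.emeasure_eq_measure)
    fix A assume "A \<in> cylinders"
    then obtain m S where A: "A = {x \<in> X. initial m x \<in> S}" by (auto simp: cylinders_def)
    have Am: "A \<in> events" using initial_in_BX sets by (simp add: A)
    have "measure (distr \<mu> \<mu> left_shift) A = (\<integral>x. indicator A x \<partial>distr \<mu> \<mu> left_shift)"
      using Am by simp
    also have "\<dots> = (\<integral>x. indicator A (left_shift x) \<partial>\<mu>)"
      using Am by (subst integral_distr[OF meas]) auto
    also have "\<dots> = (\<integral>x. indicator A x \<partial>\<mu>)"
      unfolding A by (rule inv[OF continuous_on_indicator_initial])
    also have "\<dots> = measure \<mu> A" using Am by simp
    finally show "emeasure (distr \<mu> \<mu> left_shift) A = emeasure \<mu> A"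
      by (simp add: D.emeasure_eq_measure emeasure_eq_measure)
  qed
  then show ?thesis using prob sets meas by (auto simp: invariant_measures_def BX_def)
qed

lemma integral_shift_funpow:
  fixes \<phi> :: "(nat \<Rightarrow> nat) \<Rightarrow> real"
  assumes "\<mu> \<in> invariants" "continuous_on X \<phi>"
  shows "(\<integral>x. \<phi> ((left_shift ^^ k) x) \<partial>\<mu>) = (\<integral>x. \<phi> x \<partial>\<mu>)"
proof -
  interpret measure_preserving_map \<mu> left_shift by (rule invariantsD(4)[OF assms(1)])
  have "\<phi> \<in> borel_measurable \<mu>"
    using continuous_measurable_BX[OF assms(2)] measurable_cong_sets[OF invariantsD(2)[OF assms(1)] refl] by blast
  then have "(\<integral>x. \<phi> x \<partial>distr \<mu> \<mu> (left_shift ^^ k)) = (\<integral>x. \<phi> ((left_shift ^^ k) x) \<partial>\<mu>)"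
    by (intro integral_distr) auto
  then show ?thesis by (simp add: distr_Tk)
qed

lemma continuous_on_ergodic_sum:
  fixes \<phi> :: "(nat \<Rightarrow> nat) \<Rightarrow> real"
  shows "continuous_on X \<phi> \<Longrightarrow> continuous_on X (ergodic_sum left_shift \<phi> n)"
  unfolding ergodic_sum_def by (intro continuous_on_sum continuous_on_shift_funpow)

lemma integral_ergodic_sum:
  fixes \<phi> :: "(nat \<Rightarrow> nat) \<Rightarrow> real"
  assumes "\<mu> \<in> invariants" "continuous_on X \<phi>"
  shows "(\<integral>x. ergodic_sum left_shift \<phi> n x \<partial>\<mu>) = real n * (\<integral>x. \<phi> x \<partial>\<mu>)"
  unfolding ergodic_sum_def
  using integrable_continuous_X[OF invariantsD(1,2)[OF assms(1)] continuous_on_shift_funpow[OF assms(2)]]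
    integral_shift_funpow[OF assms]
  by (subst Bochner_Integration.integral_sum) auto

subsection \<open>Entropy of shift invariant measures\<close>

abbreviation words :: "nat \<Rightarrow> nat list set" where
  "words n \<equiv> {l. set l \<subseteq> {1..p} \<and> length l = n}"

lemma finite_words: "finite (words n)"
  by (rule finite_lists_length_eq) simp

lemma initial_words: "x \<in> X \<Longrightarrow> initial n x \<in> words n"
  using X_letter by (auto simp: initial_def)

lemma simple_function_initial:
  assumes "sets \<mu> = sets BX"
  shows "simple_function \<mu> (\<lambda>x. initial m ((left_shift ^^ j) x))"
proof -
  have space: "space \<mu> = X" using sets_eq_imp_space_eq[OF assms] by simp
  have "(\<lambda>x. initial m ((left_shift ^^ j) x)) ` X \<subseteq> words m"
    using initial_words[OF shift_funpow_X] by auto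
  moreover have "(\<lambda>x. initial m ((left_shift ^^ j) x)) -` {v} \<inter> X \<in> sets \<mu>" for v
  proof -
    have "initial m ((left_shift ^^ j) x) = drop j (initial (j + m) x)" for x :: "nat \<Rightarrow> nat"
      by (rule nth_equalityI) (simp_all add: initial_def left_shift_funpow add.commute)
    then have "(\<lambda>x. initial m ((left_shift ^^ j) x)) -` {v} \<inter> X = {x \<in> X. initial (j + m) x \<in> {l. drop j l = v}}"
      by auto
    then show ?thesis using initial_in_BX[of "j + m" "{l. drop j l = v}"] assms by simp
  qed
  ultimately show ?thesis unfolding simple_function_def space
    using finite_words finite_subset by blast
qed

lemma simple_function_initial0: "sets \<mu> = sets BX \<Longrightarrow> simple_function \<mu> (initial m)"
  using simple_function_initial[of \<mu> m 0] by simp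

text \<open>The first letter is a generator: its itineraries are the initial words, and cylinders
  approximate every Borel set in measure.\<close>

lemma metric_entropy_blocks:
  assumes "\<mu> \<in> invariants"
  obtains h where "metric_entropy left_shift \<mu> = ereal h" "0 \<le> h"
    "(\<lambda>n. var_entropy \<mu> (initial n) / real n) \<longlonglongrightarrow> h"
    "\<And>n. 0 < n \<Longrightarrow> h \<le> var_entropy \<mu> (initial n) / real n"
proof -
  note inv = invariantsD[OF assms]
  interpret measure_preserving_map \<mu> left_shift by (rule inv(4))
  have L: "simple_function \<mu> (\<lambda>x. x 0)"
  proof -
    have "simple_function \<mu> (\<lambda>x. hd (initial 1 x))"
      by (rule simple_function_compose1[OF simple_function_initial0[OF inv(2)]])
    then show ?thesis by (simp add: initial_def)
  qed
  show ?thesis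
  proof (rule that)
    show "metric_entropy left_shift \<mu> = ereal (entropy_rate (\<lambda>x. x 0))"
    proof (rule metric_entropy_generator[OF L])
      fix A and e :: real assume "A \<in> sets \<mu>" "0 < e"
      from cylinder_approx[OF inv(1,2) this]
      show "\<exists>m S. prob (sym_diff A {x \<in> space \<mu>. itinerary left_shift (\<lambda>x. x 0) m x \<in> S}) < e"
        by (simp add: inv(3) itinerary_initial)
    qed
  qed (use entropy_rate_nonneg[OF L] entropy_rate_LIMSEQ[OF L] in \<open>auto simp: itinerary_initial\<close>)
qed


text \<open>Each coordinate \<open>m - 1 \<le> i < n\<close> lies in exactly \<open>m\<close> of the windows \<open>[j, j + m)\<close> with
  \<open>j < n\<close>, and conditioning on a whole prefix gives less entropy than conditioning on the part of
  it inside the window.\<close>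

lemma window_entropy:
  assumes "prob_space \<nu>" and sets: "sets \<nu> = sets BX"
  shows "real m * var_entropy \<nu> (initial n)
    \<le> (\<Sum>j<n. var_entropy \<nu> (\<lambda>x. initial m ((left_shift ^^ j) x))) + (real m)\<^sup>2 * ln (real p)"
proof -
  interpret prob_space \<nu> by fact
  have space: "space \<nu> = X" using sets_eq_imp_space_eq[OF sets] by simp
  define H where "H i = var_entropy \<nu> (initial i)" for i
  define W where "W j k x = initial k ((left_shift ^^ j) x)" for j k and x :: "nat \<Rightarrow> nat"
  have sW: "simple_function \<nu> (W j k)" for j k
    unfolding W_def[abs_def] by (rule simple_function_initial[OF sets])
  have W0: "W 0 k = initial k" for k by (simp add: W_def[abs_def])
  have W_Suc: "W j (Suc k) x = W j k x @ [x (j + k)]" for j k x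
    by (simp add: W_def initial_def left_shift_funpow add.commute)
  have W_drop: "W j k x = drop j (initial (j + k) x)" for j k x
    unfolding W_def by (rule nth_equalityI) (simp_all add: initial_def left_shift_funpow add.commute)
  have sx: "simple_function \<nu> (\<lambda>x. x i)" for i
    using simple_function_compose1[OF sW[of i 1], of hd] by (simp add: W_def initial_def left_shift_funpow)
  \<comment> \<open>The letter at \<open>j + k\<close> is conditioned once on the whole prefix and
    once on the window that starts at \<open>j\<close>; the window is a function of the
    prefix.\<close>
  have step: "H (j + Suc k) - H (j + k) \<le> var_entropy \<nu> (W j (Suc k)) - var_entropy \<nu> (W j k)" for j k
  proof -
    note sub = var_entropy_submodular[OF sx[of "j + k"] sW[of 0 "j + k"] sW[of j k]]
    have "initial (j + Suc k) = (\<lambda>x. (\<lambda>(c, w, v). w @ [c]) (x (j + k), W 0 (j + k) x, W j k x))"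
      using W_Suc[of 0 "j + k"] by (auto simp: W0[symmetric])
    then have "H (j + Suc k) = var_entropy \<nu> (\<lambda>x. (\<lambda>(c, w, v). w @ [c]) (x (j + k), W 0 (j + k) x, W j k x))"
      by (simp only: H_def)
    also have "\<dots> \<le> var_entropy \<nu> (\<lambda>x. (x (j + k), W 0 (j + k) x, W j k x))"
      by (rule var_entropy_compose_le[OF simple_function_Pair[OF sx simple_function_Pair[OF sW sW]]])
    finally have 1: "H (j + Suc k) \<le> var_entropy \<nu> (\<lambda>x. (x (j + k), W 0 (j + k) x, W j k x))" .
    have "var_entropy \<nu> (\<lambda>x. (W 0 (j + k) x, W j k x)) = var_entropy \<nu> (W 0 (j + k))"
      unfolding W_drop W0 using var_entropy_compose_inj[OF sW[of 0 "j + k"], of "\<lambda>w. (w, drop j w)"]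
      by (simp add: inj_on_def W0)
    then have 2: "var_entropy \<nu> (\<lambda>x. (W 0 (j + k) x, W j k x)) = H (j + k)" by (simp add: H_def W0)
    have 3: "var_entropy \<nu> (\<lambda>x. (x (j + k), W j k x)) = var_entropy \<nu> (W j (Suc k))"
    proof -
      have "inj_on (\<lambda>(c, w). w @ [c]) S" for S :: "(nat \<times> nat list) set" by (auto simp: inj_on_def)
      from var_entropy_compose_inj[OF simple_function_Pair[OF sx[of "j + k"] sW[of j k]] this]
      show ?thesis by (simp add: W_Suc[abs_def])
    qed
    show ?thesis using sub 1 unfolding 2 3 by simp
  qed
  have win: "H (j + k) - H j \<le> var_entropy \<nu> (W j k)" for j k
  proof (induction k)
    case 0
    then show ?case by (simp add: var_entropy_nonneg)
  next
    case (Suc k)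
    then show ?case using step[of j k] by simp
  qed
  have mono: "H i \<le> H (i + k)" for i k
    unfolding H_def using var_entropy_compose_le[OF sW[of 0 "i + k"], of "take i"]
    by (simp add: W0 take_initial)
  \<comment> \<open>A double sum of increments, telescoped in the other direction: all but
    \<open>m\<close> terms at either end cancel.\<close>
  have tele: "(\<Sum>j<n. H (j + m) - H j) = (\<Sum>i<m. H (n + i) - H i)" for m
  proof (induction m)
    case (Suc m)
    have "(\<Sum>j<n. H (j + Suc m) - H j) = (\<Sum>j<n. H (j + m) - H j) + (\<Sum>j<n. H (Suc j + m) - H (j + m))"
      unfolding sum.distrib[symmetric] by simp
    also have "(\<Sum>j<n. H (Suc j + m) - H (j + m)) = H (n + m) - H (0 + m)"
      by (rule sum_lessThan_telescope)
    finally show ?case using Suc by simp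
  qed simp
  have Hm: "H i \<le> real m * ln (real p)" if "i < m" for i
  proof -
    have "H m \<le> ln (real (card (words m)))"
      unfolding H_def using initial_words
      by (intro var_entropy_le_ln_card simple_function_initial0[OF sets] finite_words) (auto simp: space)
    also have "card (words m) = p ^ m" by (subst card_lists_length_eq) auto
    also have "ln (real (p ^ m)) = real m * ln (real p)" using p_ge_2 by (simp add: ln_realpow)
    finally have "H m \<le> real m * ln (real p)" .
    moreover have "H i \<le> H m" using mono[of i "m - i"] that by simp
    ultimately show ?thesis by simp
  qed
  have "real m * H n = (\<Sum>i<m. H n)" by simp
  \<comment> \<open>Monotonicity replaces \<open>H n\<close> by \<open>H (n + i)\<close>; each
    subtracted \<open>H i\<close> is the entropy of fewer than \<open>m\<close> letters and is paid
    for by \<open>m * ln p\<close>.\<close>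
  also have "\<dots> \<le> (\<Sum>i<m. (H (n + i) - H i) + real m * ln (real p))"
    using mono[of n] Hm by (intro sum_mono) (smt (verit) lessThan_iff)
  also have "\<dots> = (\<Sum>i<m. H (n + i) - H i) + (real m)\<^sup>2 * ln (real p)"
    by (simp add: sum.distrib power2_eq_square)
  also have "(\<Sum>i<m. H (n + i) - H i) \<le> (\<Sum>j<n. var_entropy \<nu> (W j m))"
    unfolding tele[symmetric] by (intro sum_mono win)
  finally show ?thesis unfolding H_def W_def[abs_def] by simp
qed

subsection \<open>Finitely supported measures\<close>

text \<open>The sum of the point masses \<open>w i\<close> at \<open>u i\<close>. Indexing by
  \<open>I\<close> lets the same point occur repeatedly, as happens for the points of orbit
  segments.\<close>

definition discrete :: "'i set \<Rightarrow> ('i \<Rightarrow> real) \<Rightarrow> ('i \<Rightarrow> nat \<Rightarrow> nat) \<Rightarrow> (nat \<Rightarrow> nat) measure" where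
  "discrete I w u = distr (point_measure I w) BX u"

context
  fixes I :: "'i set" and w :: "'i \<Rightarrow> real" and u :: "'i \<Rightarrow> nat \<Rightarrow> nat"
  assumes I: "finite I" and w: "\<And>i. i \<in> I \<Longrightarrow> 0 \<le> w i" "sum w I = 1" and u: "\<And>i. i \<in> I \<Longrightarrow> u i \<in> X"
begin

lemma discrete_u: "u \<in> measurable (point_measure I w) BX"
  using u by (simp add: measurable_point_measure_eq1 Pi_iff)

lemma sets_discrete: "sets (discrete I w u) = sets BX"
  by (simp add: discrete_def)

lemma prob_space_discrete: "prob_space (discrete I w u)"
  unfolding discrete_def
  by (rule prob_space.prob_space_distr[OF prob_space_point_measure[OF I] discrete_u])
     (use w in \<open>auto simp: sum_ennreal\<close>)

lemma integral_discrete: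
  fixes h :: "(nat \<Rightarrow> nat) \<Rightarrow> real"
  assumes "h \<in> borel_measurable BX"
  shows "(\<integral>x. h x \<partial>discrete I w u) = (\<Sum>i\<in>I. w i * h (u i))"
  unfolding discrete_def integral_distr[OF discrete_u assms]
  using I w by (subst lebesgue_integral_point_measure_finite) auto

lemma measure_discrete:
  assumes A: "A \<in> sets BX"
  shows "measure (discrete I w u) A = (\<Sum>i\<in>I. w i * indicator A (u i))"
proof -
  interpret prob_space "discrete I w u" by (rule prob_space_discrete)
  have "measure (discrete I w u) A = (\<integral>x. indicator A x \<partial>discrete I w u)"
    using A by (simp add: sets_discrete)
  then show ?thesis using integral_discrete[of "indicator A"] A by simp
qed

end

text \<open>Misiurewicz's argument: by \<open>window_entropy\<close> the entropy of the weights \<open>q k\<close> is controlled by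
  the block entropies of the averaged measures at every fixed length \<open>m\<close>, and these are continuous
  under weak convergence.\<close>

theorem empirical_limit:
  fixes n :: "nat \<Rightarrow> nat" and R :: "nat \<Rightarrow> (nat \<Rightarrow> nat) set" and q :: "nat \<Rightarrow> (nat \<Rightarrow> nat) \<Rightarrow> real"
  assumes n: "\<And>k. k < n k"
    and R: "\<And>k. finite (R k)" "\<And>k. R k \<subseteq> X" "\<And>k. inj_on (initial (n k)) (R k)"
    and q: "\<And>k x. x \<in> R k \<Longrightarrow> 0 \<le> q k x" "\<And>k. sum (q k) (R k) = 1"
  obtains r \<mu> h where "strict_mono (r :: nat \<Rightarrow> nat)" "\<mu> \<in> invariants"
    "\<And>\<phi>. continuous_on X \<phi> \<Longrightarrow> (\<lambda>k. (\<Sum>x\<in>R (r k). q (r k) x * ergodic_sum left_shift \<phi> (n (r k)) x) / real (n (r k)))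
        \<longlonglongrightarrow> (\<integral>x. \<phi> x \<partial>\<mu>)"
    "metric_entropy left_shift \<mu> = ereal h"
    "\<And>L l. L \<longlonglongrightarrow> l \<Longrightarrow>
       (\<And>k. L k \<le> - (\<Sum>x\<in>R (r k). q (r k) x * ln (q (r k) x)) / real (n (r k))) \<Longrightarrow> l \<le> h"
proof -
  have n0: "0 < n k" for k using n[of k] by simp
  \<comment> \<open>\<open>\<nu> k\<close> carries the weights at the chosen points,
    \<open>\<mu>' k\<close> is the average of its images under the first \<open>n k\<close> iterates
    of the shift; the index \<open>(j, x)\<close> stands for the \<open>j\<close>-th iterate of
    \<open>x\<close>.\<close>
  define \<nu> where "\<nu> k = discrete (R k) (q k) id" for k
  define J where "J k = {..<n k} \<times> R k" for k
  define wJ where "wJ k i = q k (snd i) / real (n k)" for k and i :: "nat \<times> (nat \<Rightarrow> nat)"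
  define uJ where "uJ i = (left_shift ^^ fst i) (snd i)" for i :: "nat \<times> (nat \<Rightarrow> nat)"
  define \<mu>' where "\<mu>' k = discrete (J k) (wJ k) uJ" for k
  have RX: "id x \<in> X" if "x \<in> R k" for x k using R(2) that by auto
  have nu: "sets (\<nu> k) = sets BX" "prob_space (\<nu> k)"
    "\<And>A. A \<in> sets BX \<Longrightarrow> measure (\<nu> k) A = (\<Sum>x\<in>R k. q k x * indicator A x)" for k
    unfolding \<nu>_def using sets_discrete[of "R k" "q k" id] prob_space_discrete[of "R k" "q k" id]
      measure_discrete[of "R k" "q k" id] R(1) q RX by simp_all
  have J: "finite (J k)" "\<And>i. i \<in> J k \<Longrightarrow> 0 \<le> wJ k i" "\<And>i. i \<in> J k \<Longrightarrow> uJ i \<in> X" for k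
    using R(1) q(1) subsetD[OF R(2)[of k]] by (auto simp: J_def wJ_def uJ_def intro!: shift_funpow_X)
  have sumJ: "(\<Sum>i\<in>J k. wJ k i * f (uJ i)) = (\<Sum>j<n k. \<Sum>x\<in>R k. q k x * f ((left_shift ^^ j) x)) / real (n k)"
    for k and f :: "(nat \<Rightarrow> nat) \<Rightarrow> real"
    unfolding J_def sum_divide_distrib by (subst sum.cartesian_product) (auto intro!: sum.cong simp: wJ_def uJ_def)
  have J1: "sum (wJ k) (J k) = 1" for k
    using sumJ[of k "\<lambda>_. 1"] q(2)[of k] n0[of k] by simp
  have mu': "sets (\<mu>' k) = sets BX" "prob_space (\<mu>' k)"
    "\<And>A. A \<in> sets BX \<Longrightarrow> measure (\<mu>' k) A = (\<Sum>i\<in>J k. wJ k i * indicator A (uJ i))" for k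
    unfolding \<mu>'_def using sets_discrete[of "J k" "wJ k" uJ] prob_space_discrete[of "J k" "wJ k" uJ]
      measure_discrete[of "J k" "wJ k" uJ] J J1 by simp_all
  have int: "(\<integral>x. \<phi> x \<partial>\<mu>' k) = (\<Sum>j<n k. \<Sum>x\<in>R k. q k x * \<phi> ((left_shift ^^ j) x)) / real (n k)"
    if "\<phi> \<in> borel_measurable BX" for \<phi> :: "(nat \<Rightarrow> nat) \<Rightarrow> real" and k
    unfolding \<mu>'_def sumJ[symmetric]
    by (rule integral_discrete) (use J J1 that in auto)
  have int_sum: "(\<Sum>j<n k. \<Sum>x\<in>R k. q k x * \<phi> ((left_shift ^^ j) x)) = (\<Sum>x\<in>R k. q k x * ergodic_sum left_shift \<phi> (n k) x)"
    for \<phi> :: "(nat \<Rightarrow> nat) \<Rightarrow> real" and k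
    by (subst sum.swap) (simp add: ergodic_sum_def sum_distrib_left)
  obtain r \<mu> where r: "strict_mono (r :: nat \<Rightarrow> nat)" and mu: "prob_space \<mu>" "sets \<mu> = sets BX"
    and lim: "\<And>\<phi> :: (nat \<Rightarrow> nat) \<Rightarrow> real. continuous_on X \<phi> \<Longrightarrow> (\<lambda>k. \<integral>x. \<phi> x \<partial>\<mu>' (r k)) \<longlonglongrightarrow> (\<integral>x. \<phi> x \<partial>\<mu>)"
    using weak_limit[of \<mu>', OF mu'(2) mu'(1)] by blast
  have nr: "filterlim (\<lambda>k. real (n (r k))) at_top sequentially"
  proof -
    have "real k \<le> real (n (r k))" for k
      using n[of "r k"] seq_suble[OF r, of k] by simp
    then show ?thesis
      by (intro filterlim_at_top_mono[OF filterlim_real_sequentially]) auto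
  qed
  have lim_n: "(\<lambda>k. c / real (n (r k))) \<longlonglongrightarrow> 0" for c :: real
    by (rule real_tendsto_divide_at_top[OF tendsto_const nr])
  \<comment> \<open>Shifting an orbit segment alters only its two ends, so the integrals of a test
    function before and after the shift differ by at most \<open>2 * K / n k\<close>.\<close>
  have "\<mu> \<in> invariants"
  proof (rule invariantsI[OF mu])
    fix \<phi> :: "(nat \<Rightarrow> nat) \<Rightarrow> real" assume phi: "continuous_on X \<phi>"
    obtain K where K: "0 < K" "\<And>x. x \<in> X \<Longrightarrow> \<bar>\<phi> x\<bar> \<le> K" using continuous_on_X_bounded[OF phi] by blast
    have phi': "continuous_on X (\<lambda>x. \<phi> (left_shift x))" using continuous_on_shift_funpow[OF phi, of 1] by simp
    have "\<bar>(\<integral>x. \<phi> (left_shift x) \<partial>\<mu>' k) - (\<integral>x. \<phi> x \<partial>\<mu>' k)\<bar> \<le> 2 * K / real (n k)" for k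
    proof -
      have "(\<integral>x. \<phi> (left_shift x) \<partial>\<mu>' k) - (\<integral>x. \<phi> x \<partial>\<mu>' k)
          = (\<Sum>x\<in>R k. \<Sum>j<n k. q k x * (\<phi> ((left_shift ^^ Suc j) x) - \<phi> ((left_shift ^^ j) x))) / real (n k)"
        unfolding int[OF continuous_measurable_BX[OF phi]] int[OF continuous_measurable_BX[OF phi']]
        by (subst (1 2) sum.swap) (simp add: diff_divide_distrib[symmetric] sum_subtractf[symmetric] right_diff_distrib)
      also have "\<dots> = (\<Sum>x\<in>R k. q k x * (\<phi> ((left_shift ^^ n k) x) - \<phi> x)) / real (n k)"
        unfolding sum_distrib_left[symmetric] sum_lessThan_telescope[where f = "\<lambda>j. \<phi> ((left_shift ^^ j) _)"] by simp
      finally have eq: "\<bar>(\<integral>x. \<phi> (left_shift x) \<partial>\<mu>' k) - (\<integral>x. \<phi> x \<partial>\<mu>' k)\<bar>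
          = \<bar>\<Sum>x\<in>R k. q k x * (\<phi> ((left_shift ^^ n k) x) - \<phi> x)\<bar> / real (n k)" by simp
      have "\<bar>\<Sum>x\<in>R k. q k x * (\<phi> ((left_shift ^^ n k) x) - \<phi> x)\<bar> \<le> (\<Sum>x\<in>R k. q k x * (2 * K))"
      proof (rule order_trans[OF sum_abs sum_mono])
        fix x assume x: "x \<in> R k"
        then have "x \<in> X" using R(2) by blast
        then have "\<bar>\<phi> ((left_shift ^^ n k) x) - \<phi> x\<bar> \<le> 2 * K"
          using K(2)[of x] K(2)[OF shift_funpow_X, of x "n k"] by linarith
        then show "\<bar>q k x * (\<phi> ((left_shift ^^ n k) x) - \<phi> x)\<bar> \<le> q k x * (2 * K)"
          using q(1)[OF x] by (simp add: abs_mult mult_left_mono)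
      qed
      also have "\<dots> = 2 * K" unfolding sum_distrib_right[symmetric] q(2) by simp
      finally show ?thesis unfolding eq by (rule divide_right_mono) simp
    qed
    then have "(\<lambda>k. (\<integral>x. \<phi> (left_shift x) \<partial>\<mu>' (r k)) - (\<integral>x. \<phi> x \<partial>\<mu>' (r k))) \<longlonglongrightarrow> 0"
      by (intro Lim_null_comparison[OF _ lim_n[of "2 * K"]]) auto
    moreover have "(\<lambda>k. (\<integral>x. \<phi> (left_shift x) \<partial>\<mu>' (r k)) - (\<integral>x. \<phi> x \<partial>\<mu>' (r k)))
        \<longlonglongrightarrow> (\<integral>x. \<phi> (left_shift x) \<partial>\<mu>) - (\<integral>x. \<phi> x \<partial>\<mu>)"
      by (intro tendsto_diff lim phi phi')
    ultimately show "(\<integral>x. \<phi> (left_shift x) \<partial>\<mu>) = (\<integral>x. \<phi> x \<partial>\<mu>)"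
      using LIMSEQ_unique by fastforce
  qed
  note inv = this
  obtain h where h: "metric_entropy left_shift \<mu> = ereal h"
    "(\<lambda>n. var_entropy \<mu> (initial n) / real n) \<longlonglongrightarrow> h"
    using metric_entropy_blocks[OF inv] by metis
  \<comment> \<open>The points of \<open>R k\<close> have distinct words of length
    \<open>n k\<close>, so each word carries at most one atom and the block entropy is the entropy
    of the weights.\<close>
  have Hnu: "var_entropy (\<nu> k) (initial (n k)) = - (\<Sum>x\<in>R k. q k x * ln (q k x))" for k
  proof -
    have space: "space (\<nu> k) = X" using sets_eq_imp_space_eq[OF nu(1)] by simp
    have m: "measure (\<nu> k) (initial (n k) -` {v} \<inter> space (\<nu> k)) = (\<Sum>x\<in>R k. q k x * of_bool (initial (n k) x = v))" for v
    proof -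
      have eq: "initial (n k) -` {v} \<inter> space (\<nu> k) = {x \<in> X. initial (n k) x \<in> {v}}" by (auto simp: space)
      show ?thesis
        unfolding eq nu(3)[OF initial_in_BX]
        using subsetD[OF R(2)[of k]] by (auto intro!: sum.cong simp: indicator_def)
    qed
    have mR: "measure (\<nu> k) (initial (n k) -` {initial (n k) y} \<inter> space (\<nu> k)) = q k y" if y: "y \<in> R k" for y
    proof -
      have "(\<Sum>x\<in>R k. q k x * of_bool (initial (n k) x = initial (n k) y)) = (\<Sum>x\<in>R k. if x = y then q k x else 0)"
        using R(3)[of k] y by (intro sum.cong refl) (auto simp: inj_on_def)
      then show ?thesis unfolding m using R(1) y by simp
    qed
    have "var_entropy (\<nu> k) (initial (n k)) = - (\<Sum>v\<in>words (n k). measure (\<nu> k) (initial (n k) -` {v} \<inter> space (\<nu> k)) *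
        ln (measure (\<nu> k) (initial (n k) -` {v} \<inter> space (\<nu> k))))"
      by (rule var_entropy_superset[OF finite_words]) (use initial_words in \<open>auto simp: space\<close>)
    also have "\<dots> = - (\<Sum>v\<in>initial (n k) ` R k. measure (\<nu> k) (initial (n k) -` {v} \<inter> space (\<nu> k)) *
        ln (measure (\<nu> k) (initial (n k) -` {v} \<inter> space (\<nu> k))))"
    proof (intro arg_cong[where f = uminus] sum.mono_neutral_right finite_words)
      show "initial (n k) ` R k \<subseteq> words (n k)" using R(2) initial_words by blast
      show "\<forall>v\<in>words (n k) - initial (n k) ` R k. measure (\<nu> k) (initial (n k) -` {v} \<inter> space (\<nu> k)) *
        ln (measure (\<nu> k) (initial (n k) -` {v} \<inter> space (\<nu> k))) = 0"
      proof
        fix v assume v: "v \<in> words (n k) - initial (n k) ` R k"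
        have "measure (\<nu> k) (initial (n k) -` {v} \<inter> space (\<nu> k)) = 0"
          unfolding m using v by (intro sum.neutral) auto
        then show "measure (\<nu> k) (initial (n k) -` {v} \<inter> space (\<nu> k)) *
          ln (measure (\<nu> k) (initial (n k) -` {v} \<inter> space (\<nu> k))) = 0" by simp
      qed
    qed
    also have "\<dots> = - (\<Sum>x\<in>R k. q k x * ln (q k x))"
      by (subst sum.reindex[OF R(3)]) (simp add: mR)
    finally show ?thesis .
  qed
  \<comment> \<open>The window inequality divided by \<open>n k\<close>, followed by concavity: the
    mean entropy of the windows is at most the entropy of the averaged measure.\<close>
  have block: "real m * (- (\<Sum>x\<in>R k. q k x * ln (q k x)) / real (n k))
      \<le> var_entropy (\<mu>' k) (initial m) + (real m)\<^sup>2 * ln (real p) / real (n k)" for m k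
  proof -
    have space: "space (\<nu> k) = X" "space (\<mu>' k) = X"
      using sets_eq_imp_space_eq[OF nu(1)] sets_eq_imp_space_eq[OF mu'(1)] by simp_all
    have "real m * (- (\<Sum>x\<in>R k. q k x * ln (q k x)) / real (n k)) = real m * var_entropy (\<nu> k) (initial (n k)) / real (n k)"
      by (simp add: Hnu)
    also have "\<dots> \<le> ((\<Sum>j<n k. var_entropy (\<nu> k) (\<lambda>x. initial m ((left_shift ^^ j) x))) + (real m)\<^sup>2 * ln (real p)) / real (n k)"
      by (rule divide_right_mono[OF window_entropy[OF nu(2) nu(1)]]) simp
    also have "\<dots> = (\<Sum>j<n k. 1 / real (n k) * var_entropy (\<nu> k) (\<lambda>x. initial m ((left_shift ^^ j) x))) + (real m)\<^sup>2 * ln (real p) / real (n k)"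
      by (simp add: add_divide_distrib sum_divide_distrib)
    also have "(\<Sum>j<n k. 1 / real (n k) * var_entropy (\<nu> k) (\<lambda>x. initial m ((left_shift ^^ j) x))) \<le> var_entropy (\<mu>' k) (initial m)"
    proof (rule var_entropy_concave[where V = "words m"])
      show "(\<Sum>j<n k. 1 / real (n k)) = 1" using n0[of k] by simp
      show "finite (words m)" by (rule finite_words)
      show "initial m ` space (\<mu>' k) \<subseteq> words m" using initial_words space by auto
      show "(\<lambda>x. initial m ((left_shift ^^ j) x)) ` space (\<nu> k) \<subseteq> words m" for j
        using initial_words shift_funpow_X space by auto
      fix v
      have mv: "initial m -` {v} \<inter> space (\<mu>' k) = {x \<in> X. initial m x \<in> {v}}" by (auto simp: space)
      have "measure (\<mu>' k) (initial m -` {v} \<inter> space (\<mu>' k))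
          = (\<Sum>j<n k. \<Sum>x\<in>R k. q k x * indicator {x \<in> X. initial m x \<in> {v}} ((left_shift ^^ j) x)) / real (n k)"
        unfolding mv mu'(3)[OF initial_in_BX] by (rule sumJ)
      also have "\<dots> = (\<Sum>j<n k. 1 / real (n k) * measure (\<nu> k) ((\<lambda>x. initial m ((left_shift ^^ j) x)) -` {v} \<inter> space (\<nu> k)))"
      proof -
        have "measure (\<nu> k) ((\<lambda>x. initial m ((left_shift ^^ j) x)) -` {v} \<inter> space (\<nu> k))
            = (\<Sum>x\<in>R k. q k x * indicator {x \<in> X. initial m x \<in> {v}} ((left_shift ^^ j) x))" for j
        proof -
          have "(\<lambda>x. initial m ((left_shift ^^ j) x)) -` {v} \<inter> space (\<nu> k) \<in> sets BX"
            using simple_functionD(2)[OF simple_function_initial[OF nu(1)]] nu(1) by simp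
          then show ?thesis unfolding nu(3)
            using R(2)[of k] shift_funpow_X space by (auto intro!: sum.cong simp: indicator_def nu(3))
        qed
        then show ?thesis by (simp add: sum_divide_distrib)
      qed
      finally show "measure (\<mu>' k) (initial m -` {v} \<inter> space (\<mu>' k))
          = (\<Sum>j<n k. 1 / real (n k) * measure (\<nu> k) ((\<lambda>x. initial m ((left_shift ^^ j) x)) -` {v} \<inter> space (\<nu> k)))" .
    qed auto
    finally show ?thesis by simp
  qed
  \<comment> \<open>For fixed \<open>m\<close> only finitely many cylinders occur, and their
    indicators are continuous.\<close>
  have limH: "(\<lambda>k. var_entropy (\<mu>' (r k)) (initial m)) \<longlonglongrightarrow> var_entropy \<mu> (initial m)" for m
  proof -
    have V: "var_entropy N (initial m) = - (\<Sum>v\<in>words m. measure N {x \<in> X. initial m x \<in> {v}} * ln (measure N {x \<in> X. initial m x \<in> {v}}))"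
      if "sets N = sets BX" for N
    proof -
      have space: "space N = X" using sets_eq_imp_space_eq[OF that] by simp
      have "initial m -` {v} \<inter> space N = {x \<in> X. initial m x \<in> {v}}" for v by (auto simp: space)
      moreover have "initial m ` space N \<subseteq> words m" unfolding space using initial_words by blast
      ultimately show ?thesis
        using var_entropy_superset[OF finite_words[of m], where F = "initial m" and M = N] by simp
    qed
    show ?thesis unfolding V[OF mu'(1)] V[OF mu(2)]
    proof (intro tendsto_minus tendsto_sum tendsto_xlnx measure_nonneg)
      fix v
      show "(\<lambda>k. measure (\<mu>' (r k)) {x \<in> X. initial m x \<in> {v}}) \<longlonglongrightarrow> measure \<mu> {x \<in> X. initial m x \<in> {v}}"
        unfolding measure_cylinder_integral[OF mu'(2) mu'(1)] measure_cylinder_integral[OF mu]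
        by (rule lim[OF continuous_on_indicator_initial])
    qed
  qed
  show ?thesis
  proof (rule that[OF r inv _ h(1)])
    fix \<phi> :: "(nat \<Rightarrow> nat) \<Rightarrow> real" assume "continuous_on X \<phi>"
    from lim[OF this] show "(\<lambda>k. (\<Sum>x\<in>R (r k). q (r k) x * ergodic_sum left_shift \<phi> (n (r k)) x) / real (n (r k)))
        \<longlonglongrightarrow> (\<integral>x. \<phi> x \<partial>\<mu>)"
      unfolding int[OF continuous_measurable_BX[OF \<open>continuous_on X \<phi>\<close>]] int_sum .
  next
    fix L l assume L: "L \<longlonglongrightarrow> (l :: real)" "\<And>k. L k \<le> - (\<Sum>x\<in>R (r k). q (r k) x * ln (q (r k) x)) / real (n (r k))"
    have "l \<le> var_entropy \<mu> (initial m) / real m" if m: "0 < m" for m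
    proof -
      have "real m * l \<le> var_entropy \<mu> (initial m) + 0"
      proof (rule LIMSEQ_le)
        show "(\<lambda>k. real m * L k) \<longlonglongrightarrow> real m * l" by (intro tendsto_intros L)
        show "(\<lambda>k. var_entropy (\<mu>' (r k)) (initial m) + (real m)\<^sup>2 * ln (real p) / real (n (r k))) \<longlonglongrightarrow> var_entropy \<mu> (initial m) + 0"
          by (intro tendsto_add limH lim_n)
        have "real m * L k \<le> var_entropy (\<mu>' (r k)) (initial m) + (real m)\<^sup>2 * ln (real p) / real (n (r k))" for k
          using mult_left_mono[OF L(2), of "real m" k] block[of m "r k"] by simp
        then show "\<exists>N. \<forall>k\<ge>N. real m * L k \<le> var_entropy (\<mu>' (r k)) (initial m) + (real m)\<^sup>2 * ln (real p) / real (n (r k))"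
          by blast
      qed
      then show ?thesis using m by (simp add: field_simps)
    qed
    then show "l \<le> h"
      by (intro LIMSEQ_le_const[OF h(2)]) (auto intro!: exI[of _ 1])
  qed
qed

end

section \<open>Geometry of conformal recurrent iterated function systems\<close>

lemma (in subshift_space) continuous_on_XI:
  fixes \<phi> :: "(nat \<Rightarrow> nat) \<Rightarrow> 'b::metric_space"
  assumes "\<And>e. 0 < e \<Longrightarrow> \<exists>m. \<forall>x\<in>X. \<forall>y\<in>X. (\<forall>i<m. x i = y i) \<longrightarrow> dist (\<phi> x) (\<phi> y) < e"
  shows "continuous_on X \<phi>"
  unfolding continuous_on_def
proof (intro ballI tendstoI)
  fix x and e :: real assume x: "x \<in> X" and e: "0 < e"
  obtain m where m: "\<forall>x\<in>X. \<forall>y\<in>X. (\<forall>i<m. x i = y i) \<longrightarrow> dist (\<phi> x) (\<phi> y) < e" using assms[OF e] ..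
  show "eventually (\<lambda>y. dist (\<phi> y) (\<phi> x) < e) (at x within X)"
    unfolding eventually_at_topological
  proof (intro exI conjI ballI impI)
    show "open {y :: nat \<Rightarrow> nat. \<forall>i<m. y i = x i}" by (rule open_cylinder)
  qed (use m x in auto)
qed

text \<open>The data with constants uniform over all edges. The Hoelder condition on the derivatives
  is only local, so everything is confined to one closed ball that all maps send into itself and
  that contains the attractor sets and the reference balls
  \<open>cball (ctr i) \<rho>\<close>.\<close>

locale conformal_ifs = subshift_space p a
  for p :: nat and a :: "nat \<Rightarrow> nat \<Rightarrow> nat" +
  fixes \<omega> :: "nat \<Rightarrow> nat \<Rightarrow> 'e::euclidean_space \<Rightarrow> 'e" and s :: "nat \<Rightarrow> nat \<Rightarrow> 'e \<Rightarrow> real"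
    and \<gamma> c Rad smin Hc \<rho> :: real and E U :: "nat \<Rightarrow> 'e set" and ctr :: "nat \<Rightarrow> 'e"
  assumes gamma: "0 < \<gamma>"
    and c: "0 < c" "c < 1"
    and contraction: "\<lbrakk>i \<in> {1..p}; j \<in> {1..p}; a i j = 1\<rbrakk> \<Longrightarrow> dist (\<omega> i j z) (\<omega> i j w) \<le> c * dist z w"
    and Rad: "0 < Rad"
    and maps_B: "\<lbrakk>i \<in> {1..p}; j \<in> {1..p}; a i j = 1; z \<in> cball 0 Rad\<rbrakk> \<Longrightarrow> \<omega> i j z \<in> cball 0 Rad"
    and attractor: "recurrent_attractor p a \<omega> E"
    and E_B: "i \<in> {1..p} \<Longrightarrow> E i \<subseteq> cball 0 Rad"
    and similarity: "\<lbrakk>i \<in> {1..p}; j \<in> {1..p}; a i j = 1\<rbrakk>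
      \<Longrightarrow> \<exists>D. (\<omega> i j has_derivative D) (at z) \<and> (\<forall>v. norm (D v) = s i j z * norm v)"
    and bij: "\<lbrakk>i \<in> {1..p}; j \<in> {1..p}; a i j = 1\<rbrakk> \<Longrightarrow> bij (\<omega> i j)"
    and inv_differentiable: "\<lbrakk>i \<in> {1..p}; j \<in> {1..p}; a i j = 1\<rbrakk> \<Longrightarrow> inv (\<omega> i j) differentiable (at z)"
    and smin: "0 < smin" "\<lbrakk>i \<in> {1..p}; j \<in> {1..p}; a i j = 1; z \<in> cball 0 Rad\<rbrakk> \<Longrightarrow> smin \<le> s i j z"
    and s_le: "\<lbrakk>i \<in> {1..p}; j \<in> {1..p}; a i j = 1\<rbrakk> \<Longrightarrow> s i j z \<le> c"
    and Hc: "0 \<le> Hc" "\<lbrakk>i \<in> {1..p}; j \<in> {1..p}; a i j = 1; z \<in> cball 0 Rad; w \<in> cball 0 Rad\<rbrakk>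
      \<Longrightarrow> \<bar>ln (s i j z) - ln (s i j w)\<bar> \<le> Hc * dist z w powr \<gamma>"
    and \<rho>: "0 < \<rho>" "i \<in> {1..p} \<Longrightarrow> cball (ctr i) \<rho> \<subseteq> U i \<inter> cball 0 Rad"
    and osc: "\<lbrakk>i \<in> {1..p}; j \<in> {1..p}; a i j = 1\<rbrakk> \<Longrightarrow> \<omega> i j ` U j \<subseteq> U i"
      "\<lbrakk>i \<in> {1..p}; j \<in> {1..p}; k \<in> {1..p}; a i j = 1; a i k = 1; j \<noteq> k\<rbrakk>
        \<Longrightarrow> \<omega> i j ` U j \<inter> \<omega> i k ` U k = {}"
begin

section \<open>Bounded distortion of compositions\<close>

abbreviation B :: "'e set" where "B \<equiv> cball 0 Rad"

lemma dist_B: "z \<in> B \<Longrightarrow> w \<in> B \<Longrightarrow> dist z w \<le> 2 * Rad"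
  using dist_triangle2[of z w 0] by (simp add: dist_commute)

lemma edge: "x \<in> X \<Longrightarrow> x n \<in> {1..p} \<and> x (Suc n) \<in> {1..p} \<and> a (x n) (x (Suc n)) = 1"
  using X_letter X_edge by blast

text \<open>\<open>scale x n z\<close> is the factor by which the derivative of \<open>word_map \<omega> x n\<close> at \<open>z\<close> stretches.\<close>

primrec scale :: "(nat \<Rightarrow> nat) \<Rightarrow> nat \<Rightarrow> 'e \<Rightarrow> real" where
  "scale x 0 z = 1"
| "scale x (Suc n) z = scale x n (\<omega> (x n) (x (Suc n)) z) * s (x n) (x (Suc n)) z"

text \<open>A composition of \<open>n\<close> maps reads \<open>n + 1\<close> letters, since every
  map belongs to an edge.\<close>

lemma word_map_cong: "\<forall>i\<le>n. x i = y i \<Longrightarrow> word_map \<omega> x n = word_map \<omega> y n"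
  by (induction n) auto

lemma scale_cong: "\<forall>i\<le>n. x i = y i \<Longrightarrow> scale x n z = scale y n z"
  by (induction n arbitrary: z) auto

lemma word_map_add: "word_map \<omega> x (m + n) = word_map \<omega> x m \<circ> word_map \<omega> ((left_shift ^^ m) x) n"
  by (induction n) (auto simp: left_shift_funpow add.commute comp_assoc[symmetric])

lemma word_map_contraction:
  "x \<in> X \<Longrightarrow> dist (word_map \<omega> x n z) (word_map \<omega> x n w) \<le> c ^ n * dist z w"
proof (induction n arbitrary: z w)
  case (Suc n)
  let ?f = "\<omega> (x n) (x (Suc n))"
  have "dist (word_map \<omega> x (Suc n) z) (word_map \<omega> x (Suc n) w) \<le> c ^ n * dist (?f z) (?f w)"
    using Suc by simp
  also have "\<dots> \<le> c ^ n * (c * dist z w)"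
    using contraction edge[OF Suc.prems, of n] c by (intro mult_left_mono) auto
  finally show ?case by (simp add: mult_ac)
qed simp

lemma s_pos: "\<lbrakk>x \<in> X; z \<in> B\<rbrakk> \<Longrightarrow> 0 < s (x n) (x (Suc n)) z"
  using smin edge[of x n] by (meson less_le_trans)

lemma scale_pos: "\<lbrakk>x \<in> X; z \<in> B\<rbrakk> \<Longrightarrow> 0 < scale x n z"
proof (induction n arbitrary: z)
  case (Suc n)
  then show ?case using maps_B[of "x n" "x (Suc n)" z] edge[OF Suc.prems(1), of n] s_pos by simp
qed simp

lemma scale_le: "\<lbrakk>x \<in> X; z \<in> B\<rbrakk> \<Longrightarrow> scale x n z \<le> c ^ n"
proof (induction n arbitrary: z)
  case (Suc n)
  note e = edge[OF Suc.prems(1), of n]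
  have z': "\<omega> (x n) (x (Suc n)) z \<in> B" using maps_B Suc.prems e by blast
  have "scale x n (\<omega> (x n) (x (Suc n)) z) * s (x n) (x (Suc n)) z \<le> c ^ n * c"
    using Suc.IH[OF Suc.prems(1) z'] s_le e s_pos[OF Suc.prems] c by (intro mult_mono) (auto simp: less_imp_le)
  then show ?case by (simp add: mult.commute)
qed simp

text \<open>The sum of the geometric series of the terms \<open>Hc * (c powr \<gamma>) ^ i\<close>,
  equivalently the fixed point of \<open>K \<mapsto> K * c powr \<gamma> + Hc\<close>.\<close>

definition K0 :: real where "K0 = Hc / (1 - c powr \<gamma>)"

text \<open>The distortion constant: the Hoelder bound for the logarithm of the stretch, taken at
  the diameter \<open>2 * Rad\<close> of the ball.\<close>

definition dist0 :: real where "dist0 = exp (K0 * (2 * Rad) powr \<gamma>)"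

lemma c_powr: "c powr \<gamma> < 1"
  using c gamma powr_less_mono2[of \<gamma> c 1] by simp

lemma K0: "0 \<le> K0" "K0 * c powr \<gamma> + Hc = K0"
  using c_powr Hc by (auto simp: K0_def field_simps)

lemma dist0_ge: "1 \<le> dist0"
  using K0 by (simp add: dist0_def)

text \<open>The innermost map contracts the distance by \<open>c\<close> before the remaining maps
  see it, so the errors form a geometric series whose ratio \<open>c powr \<gamma>\<close> does not
  depend on the word.\<close>

lemma ln_scale_holder:
  "\<lbrakk>x \<in> X; z \<in> B; w \<in> B\<rbrakk> \<Longrightarrow> \<bar>ln (scale x n z) - ln (scale x n w)\<bar> \<le> K0 * dist z w powr \<gamma>"
proof (induction n arbitrary: z w)
  case 0
  then show ?case using K0 by simp
next
  case (Suc n)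
  let ?f = "\<omega> (x n) (x (Suc n))" and ?s = "s (x n) (x (Suc n))"
  note e = edge[OF Suc.prems(1), of n]
  have f: "?f z \<in> B" "?f w \<in> B" using maps_B Suc.prems e by blast+
  have sp: "0 < ?s z" "0 < ?s w" "0 < scale x n (?f z)" "0 < scale x n (?f w)"
    using s_pos scale_pos Suc.prems f by auto
  have "\<bar>ln (scale x (Suc n) z) - ln (scale x (Suc n) w)\<bar>
      \<le> \<bar>ln (scale x n (?f z)) - ln (scale x n (?f w))\<bar> + \<bar>ln (?s z) - ln (?s w)\<bar>"
    using sp by (simp add: ln_mult)
  also have "\<dots> \<le> K0 * dist (?f z) (?f w) powr \<gamma> + Hc * dist z w powr \<gamma>"
    using Suc.IH[OF Suc.prems(1) f] Hc(2)[of "x n" "x (Suc n)" z w] Suc.prems e by (intro add_mono) auto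
  also have "K0 * dist (?f z) (?f w) powr \<gamma> \<le> K0 * (c * dist z w) powr \<gamma>"
    using contraction e gamma K0(1) by (intro mult_left_mono powr_mono2) auto
  also have "(c * dist z w) powr \<gamma> = c powr \<gamma> * dist z w powr \<gamma>"
    using c by (simp add: powr_mult)
  finally have "\<bar>ln (scale x (Suc n) z) - ln (scale x (Suc n) w)\<bar>
      \<le> (K0 * c powr \<gamma> + Hc) * dist z w powr \<gamma>"
    by (simp add: algebra_simps)
  then show ?case unfolding K0(2) .
qed

lemma scale_distortion:
  assumes "x \<in> X" "z \<in> B" "w \<in> B"
  shows "scale x n z \<le> dist0 * scale x n w"
proof -
  have "\<bar>ln (scale x n z) - ln (scale x n w)\<bar> \<le> K0 * dist z w powr \<gamma>" by (rule ln_scale_holder[OF assms])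
  also have "\<dots> \<le> K0 * (2 * Rad) powr \<gamma>"
    using dist_B[OF assms(2,3)] gamma K0 by (intro mult_left_mono powr_mono2) auto
  finally have "ln (scale x n z) \<le> ln (dist0 * scale x n w)"
    using scale_pos[OF assms(1,3), of n] by (simp add: dist0_def ln_mult)
  then show ?thesis using scale_pos[OF assms(1,2), of n] scale_pos[OF assms(1,3), of n] by (simp add: dist0_def)
qed

lemma word_map_derivative:
  assumes x: "x \<in> X"
  shows "\<exists>D. (word_map \<omega> x n has_derivative D) (at z) \<and> (\<forall>v. norm (D v) = scale x n z * norm v)"
proof (induction n arbitrary: z)
  case 0
  then show ?case by (intro exI[of _ id]) (auto simp: id_def)
next
  case (Suc n)
  let ?f = "\<omega> (x n) (x (Suc n))"
  obtain D1 where D1: "(?f has_derivative D1) (at z)" "\<And>v. norm (D1 v) = s (x n) (x (Suc n)) z * norm v"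
    using similarity edge[OF x, of n] by blast
  obtain D2 where D2: "(word_map \<omega> x n has_derivative D2) (at (?f z))" "\<And>v. norm (D2 v) = scale x n (?f z) * norm v"
    using Suc by blast
  show ?case
  proof (intro exI[of _ "D2 \<circ> D1"] conjI allI)
    show "(word_map \<omega> x (Suc n) has_derivative D2 \<circ> D1) (at z)"
      using diff_chain_at[OF D1(1) D2(1)] by simp
  qed (simp add: D1 D2)
qed

text \<open>Mean value inequality on the convex set \<open>B\<close>; bounded distortion allows the
  stretch to be taken at any reference point \<open>y\<close>.\<close>

lemma word_map_upper:
  assumes "x \<in> X" "z \<in> B" "w \<in> B" "y \<in> B"
  shows "dist (word_map \<omega> x n z) (word_map \<omega> x n w) \<le> dist0 * scale x n y * dist z w"
proof -
  have "\<forall>z. \<exists>D. (word_map \<omega> x n has_derivative D) (at z) \<and> (\<forall>v. norm (D v) = scale x n z * norm v)"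
    using word_map_derivative[OF assms(1)] by blast
  from choice[OF this] obtain D where
    D: "\<forall>z. (word_map \<omega> x n has_derivative D z) (at z) \<and> (\<forall>v. norm (D z v) = scale x n z * norm v)" ..
  have "norm (word_map \<omega> x n z - word_map \<omega> x n w) \<le> (dist0 * scale x n y) * norm (z - w)"
  proof (rule differentiable_bound[where S = B and f' = D])
    show "\<And>z. z \<in> B \<Longrightarrow> (word_map \<omega> x n has_derivative D z) (at z within B)"
      using D has_derivative_at_withinI by blast
    show "onorm (D z) \<le> dist0 * scale x n y" if "z \<in> B" for z
      using D scale_distortion[OF assms(1) that assms(4), of n] by (intro onorm_le) (auto intro: mult_right_mono)
  qed (use assms in auto)
  then show ?thesis by (simp add: dist_norm)
qed

lemma bij_word_map: "x \<in> X \<Longrightarrow> bij (word_map \<omega> x n)"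
  by (induction n) (use bij edge in \<open>auto intro!: bij_comp\<close>)

lemma inv_word_map_differentiable:
  assumes x: "x \<in> X"
  shows "inv (word_map \<omega> x n) differentiable (at z)"
proof (induction n arbitrary: z)
  case 0
  then show ?case by (simp add: inv_id)
next
  case (Suc n)
  have "inv (word_map \<omega> x (Suc n)) = inv (\<omega> (x n) (x (Suc n))) \<circ> inv (word_map \<omega> x n)"
    using bij_word_map[OF x, of n] bij edge[OF x, of n] by (simp add: o_inv_distrib)
  moreover have "inv (\<omega> (x n) (x (Suc n))) \<circ> inv (word_map \<omega> x n) differentiable at z"
    using Suc inv_differentiable edge[OF x, of n] by (intro differentiable_chain_at) auto
  ultimately show ?case by (simp only:)
qed

text \<open>Differentiating \<open>T \<circ> inv T = id\<close> shows that the derivative of the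
  inverse divides norms by the stretch of \<open>T\<close> at the preimage.\<close>

lemma inv_word_map_derivative:
  assumes x: "x \<in> X" and pos: "scale x n (inv (word_map \<omega> x n) y) > 0"
  shows "\<exists>D. (inv (word_map \<omega> x n) has_derivative D) (at y) \<and>
    (\<forall>v. norm (D v) = norm v / scale x n (inv (word_map \<omega> x n) y))"
proof -
  let ?T = "word_map \<omega> x n" let ?G = "inv ?T"
  obtain D where D: "(?G has_derivative D) (at y)"
    using inv_word_map_differentiable[OF x, of n y] by (auto simp: differentiable_def)
  obtain D' where D': "(?T has_derivative D') (at (?G y))" "\<And>v. norm (D' v) = scale x n (?G y) * norm v"
    using word_map_derivative[OF x] by blast
  have "?T \<circ> ?G = id" using bij_word_map[OF x, of n] by (simp add: bij_is_surj surj_iff[symmetric])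
  then have "(id has_derivative D' \<circ> D) (at y)" using diff_chain_at[OF D D'(1)] by simp
  then have "D' \<circ> D = id" using has_derivative_unique[OF _ has_derivative_id] by (auto simp: id_def)
  then have "norm v = scale x n (?G y) * norm (D v)" for v using D'(2)[of "D v"] by (metis comp_apply id_apply)
  then have "norm (D v) * scale x n (?G y) = norm v" for v by (metis mult.commute)
  then have "norm (D v) = norm v / scale x n (?G y)" for v using pos by (intro eq_divide_imp) auto
  then show ?thesis using D by blast
qed

text \<open>Along the segment from \<open>T z\<close> to \<open>y\<close> consider the first time at which the preimage leaves the
  open ball around \<open>z\<close>; up to then the inverse of \<open>T\<close> is Lipschitz.\<close>

lemma word_map_ball:
  assumes x: "x \<in> X" and sub: "cball z r \<subseteq> B" and r: "0 < r" and w: "w \<in> B"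
    and y: "dist (word_map \<omega> x n z) y < r * scale x n w / dist0"
  shows "y \<in> word_map \<omega> x n ` ball z r"
proof -
  let ?T = "word_map \<omega> x n" let ?G = "inv ?T"
  have TG: "?T (?G v) = v" for v using bij_word_map[OF x, of n] by (simp add: bij_is_surj surj_f_inv_f)
  have GT: "?G (?T v) = v" for v using bij_word_map[OF x, of n] by (simp add: bij_is_inj)
  define l where "l t = ?T z + t *\<^sub>R (y - ?T z)" for t :: real
  define u where "u t = dist z (?G (l t))" for t
  have contG: "continuous_on UNIV ?G"
    using inv_word_map_differentiable[OF x, of n] differentiable_imp_continuous_within
    by (metis continuous_at_imp_continuous_on)
  have contu: "continuous_on {0..1} u"
    unfolding u_def l_def by (intro continuous_intros continuous_on_compose2[OF contG]) auto
  have u0: "u 0 = 0" by (simp add: u_def l_def GT)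
  have "u 1 < r"
  proof (rule ccontr)
    assume "\<not> u 1 < r"
    define S where "S = {t \<in> {0..1}. u t \<in> {r..}}"
    have "closed S" unfolding S_def
      using continuous_closed_preimage[OF contu, of "{r..}"] by (simp add: vimage_def Int_def conj_commute)
    moreover have "1 \<in> S" using \<open>\<not> u 1 < r\<close> by (auto simp: S_def)
    moreover have bdd: "bdd_below S" by (rule bdd_belowI[of _ 0]) (auto simp: S_def)
    ultimately have "Inf S \<in> S" by (intro closed_contains_Inf) auto
    define t where "t = Inf S"
    have t: "t \<in> {0..1}" "r \<le> u t" using \<open>Inf S \<in> S\<close> by (auto simp: t_def S_def)
    have before: "u t' < r" if "t' \<in> {0..<t}" for t'
    proof (rule ccontr)
      assume "\<not> u t' < r"
      then have "t' \<in> S" using that t by (auto simp: S_def)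
      then have "t \<le> t'" unfolding t_def using bdd by (rule cInf_lower)
      then show False using that by simp
    qed
    have t0: "0 < t" using t u0 r by (cases "t = 0") auto
    \<comment> \<open>At the exit time itself the bound follows from left continuity. Up to then all
      preimages stay in the closed ball, hence in \<open>B\<close>, where distortion is
      controlled.\<close>
    have ut: "u t' \<le> r" if "t' \<in> {0..t}" for t'
    proof (cases "t' = t")
      case True
      have "u t \<le> r"
      proof (rule tendsto_upperbound[where F = "at_left t" and f = u])
        show "(u \<longlongrightarrow> u t) (at_left t)"
        proof -
          have "(u \<longlongrightarrow> u t) (at t within {0..t})"
            using contu t(1) unfolding continuous_on_def
            by (auto intro: tendsto_within_subset[where S = "{0..1}"])
          then show ?thesis using t0 by (simp add: at_within_Icc_at_left)
        qed
        show "eventually (\<lambda>t'. u t' \<le> r) (at_left t)"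
          unfolding eventually_at_left_field using before t0 by (intro exI[of _ 0]) (auto simp: less_imp_le)
      qed simp
      then show ?thesis using True by simp
    next
      case False
      then show ?thesis using before[of t'] that by simp
    qed
    have inB: "?G (l t') \<in> B" if "t' \<in> {0..t}" for t' using ut[OF that] sub by (auto simp: u_def)
    have "\<forall>v. \<exists>D. 0 < scale x n (?G v) \<longrightarrow> (?G has_derivative D) (at v) \<and>
        (\<forall>h. norm (D h) = norm h / scale x n (?G v))"
      using inv_word_map_derivative[OF x] by blast
    from choice[OF this] obtain D where D: "\<forall>v. 0 < scale x n (?G v) \<longrightarrow> (?G has_derivative D v) (at v) \<and>
        (\<forall>h. norm (D v h) = norm h / scale x n (?G v))" ..
    have wpos: "0 < scale x n w" by (rule scale_pos[OF x w])
    have "norm (?G (l t) - ?G (l 0)) \<le> dist0 / scale x n w * norm (l t - l 0)"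
    proof (rule differentiable_bound[where S = "l ` {0..t}" and f' = D])
      have "l ` {0..t} = (\<lambda>v. ?T z + v) ` ((\<lambda>t. t *\<^sub>R (y - ?T z)) ` {0..t})"
        by (auto simp: l_def image_image)
      moreover have "convex ((\<lambda>t. t *\<^sub>R (y - ?T z)) ` {0..t})"
        by (intro convex_linear_image linear_scale_left) auto
      ultimately show "convex (l ` {0..t})" by (simp add: convex_translation)
    next
      fix v assume "v \<in> l ` {0..t}"
      then have v: "?G v \<in> B" using inB by auto
      then have pos: "0 < scale x n (?G v)" by (rule scale_pos[OF x])
      show "(?G has_derivative D v) (at v within l ` {0..t})"
        using D pos by (blast intro: has_derivative_at_withinI)
      have "norm (D v h) \<le> dist0 / scale x n w * norm h" for h
      proof -
        have "1 / scale x n (?G v) \<le> dist0 / scale x n w"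
          using scale_distortion[OF x w v, of n] pos wpos by (simp add: field_simps)
        then have "norm h * (1 / scale x n (?G v)) \<le> norm h * (dist0 / scale x n w)"
          by (rule mult_left_mono) simp
        then show ?thesis using D pos by (simp add: mult.commute)
      qed
      then show "onorm (D v) \<le> dist0 / scale x n w" by (rule onorm_le)
    qed (use t in auto)
    also have "norm (l t - l 0) = t * dist (?T z) y"
      using t by (simp add: l_def dist_norm norm_minus_commute)
    also have "dist0 / scale x n w * (t * dist (?T z) y) \<le> dist0 / scale x n w * (1 * dist (?T z) y)"
      using t wpos dist0_ge by (intro mult_left_mono mult_right_mono) auto
    also have "\<dots> < r" using y wpos dist0_ge by (simp add: field_simps)
    finally have "u t < r" by (simp add: u_def l_def GT dist_norm norm_minus_commute)
    then show False using t by simp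
  qed
  then have "?G y \<in> ball z r" by (simp add: u_def l_def)
  then show ?thesis using TG by (metis image_eqI)
qed


subsection \<open>The coding map\<close>

abbreviation \<pi> :: "(nat \<Rightarrow> nat) \<Rightarrow> 'e" where "\<pi> \<equiv> coding_map \<omega> E"

lemma attractorD:
  assumes "i \<in> {1..p}"
  shows "E i \<noteq> {}" "compact (E i)" "E i = (\<Union>j\<in>{j\<in>{1..p}. a i j = 1}. \<omega> i j ` E j)"
  using attractor assms unfolding recurrent_attractor_def by blast+

lemma continuous_on_word_map: "x \<in> X \<Longrightarrow> continuous_on S (word_map \<omega> x n)"
  using word_map_derivative[of x n] has_derivative_continuous
  by (intro continuous_at_imp_continuous_on) blast

lemma nested_pieces:
  assumes x: "x \<in> X" and "m \<le> n"
  shows "word_map \<omega> x n ` E (x n) \<subseteq> word_map \<omega> x m ` E (x m)"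
proof -
  have "word_map \<omega> x (Suc n) ` E (x (Suc n)) \<subseteq> word_map \<omega> x n ` E (x n)" for n
  proof -
    have "\<omega> (x n) (x (Suc n)) ` E (x (Suc n)) \<subseteq> E (x n)"
      using attractorD(3)[of "x n"] edge[OF x, of n] by blast
    then show ?thesis by (auto simp: image_comp[symmetric])
  qed
  then have "antimono (\<lambda>n. word_map \<omega> x n ` E (x n))" by (simp add: antimono_iff_le_Suc)
  then show ?thesis using assms(2) by (rule antimonoD)
qed

lemma piece_point_unique:
  assumes x: "x \<in> X" and y: "\<And>n. y \<in> word_map \<omega> x n ` E (x n)" and z: "\<And>n. z \<in> word_map \<omega> x n ` E (x n)"
  shows "y = z"
proof -
  have "dist y z \<le> c ^ n * (2 * Rad)" for n
  proof -
    obtain y' z' where yz: "y' \<in> E (x n)" "z' \<in> E (x n)" "y = word_map \<omega> x n y'" "z = word_map \<omega> x n z'"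
      using y[of n] z[of n] by auto
    have "y' \<in> B" "z' \<in> B" using yz E_B X_letter[OF x] by blast+
    then have "c ^ n * dist y' z' \<le> c ^ n * (2 * Rad)" using c dist_B by (intro mult_left_mono) auto
    then show ?thesis using word_map_contraction[OF x, of n y' z'] yz by simp
  qed
  moreover have "(\<lambda>n. c ^ n * (2 * Rad)) \<longlonglongrightarrow> 0 * (2 * Rad)"
    using c by (intro tendsto_mult LIMSEQ_power_zero tendsto_const) auto
  ultimately have "dist y z \<le> 0 * (2 * Rad)" by (intro LIMSEQ_le_const) auto
  then show ?thesis by simp
qed

lemma piece_point_exists:
  assumes x: "x \<in> X"
  shows "\<exists>y. \<forall>n. y \<in> word_map \<omega> x n ` E (x n)"
proof -
  have "\<Inter>(range (\<lambda>n. word_map \<omega> x n ` E (x n))) \<noteq> {}"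
  proof (rule compact_nest[where F = "\<lambda>n. word_map \<omega> x n ` E (x n)"])
    show "compact (word_map \<omega> x n ` E (x n))" for n
      by (rule compact_continuous_image[OF continuous_on_word_map[OF x] attractorD(2)[OF X_letter[OF x]]])
    show "word_map \<omega> x n ` E (x n) \<noteq> {}" for n
      using attractorD(1)[OF X_letter[OF x, of n]] by simp
  qed (rule nested_pieces[OF x])
  then show ?thesis by blast
qed

lemma coding_map_eqI:
  assumes "x \<in> X" "\<And>n. y \<in> word_map \<omega> x n ` E (x n)"
  shows "\<pi> x = y"
  unfolding coding_map_def
  by (rule the_equality) (use assms piece_point_unique[OF assms(1)] in auto)

lemma coding_map_mem: "x \<in> X \<Longrightarrow> \<pi> x \<in> word_map \<omega> x n ` E (x n)"
  using piece_point_exists coding_map_eqI by metis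

lemma coding_map_B: "x \<in> X \<Longrightarrow> \<pi> x \<in> B"
  using coding_map_mem[of x 0] E_B X_letter by fastforce

text \<open>The image of the coded shifted point lies in the pieces of all levels
  \<open>n + m\<close>, and by nesting in the pieces of all levels \<open>m\<close>.\<close>

lemma coding_map_word: "x \<in> X \<Longrightarrow> \<pi> x = word_map \<omega> x n (\<pi> ((left_shift ^^ n) x))"
proof (rule coding_map_eqI)
  fix m assume x: "x \<in> X"
  let ?y = "(left_shift ^^ n) x"
  have "word_map \<omega> x n (\<pi> ?y) \<in> word_map \<omega> x n ` word_map \<omega> ?y m ` E (?y m)"
    by (rule imageI) (rule coding_map_mem[OF shift_funpow_X[OF x]])
  also have "word_map \<omega> x n ` word_map \<omega> ?y m ` E (?y m) = word_map \<omega> x (n + m) ` E (x (n + m))"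
    by (simp only: word_map_add image_comp left_shift_funpow add.commute[of m n])
  also have "\<dots> \<subseteq> word_map \<omega> x m ` E (x m)" by (rule nested_pieces[OF x]) simp
  finally show "word_map \<omega> x n (\<pi> ?y) \<in> word_map \<omega> x m ` E (x m)" .
qed

lemma coding_map_close:
  assumes "x \<in> X" "y \<in> X" "\<forall>i\<le>n. x i = y i"
  shows "dist (\<pi> x) (\<pi> y) \<le> c ^ n * (2 * Rad)"
proof -
  have "dist (\<pi> x) (\<pi> y) \<le> c ^ n * dist (\<pi> ((left_shift ^^ n) x)) (\<pi> ((left_shift ^^ n) y))"
    using word_map_contraction[OF assms(1)] coding_map_word[OF assms(1), of n] coding_map_word[OF assms(2), of n]
      word_map_cong[OF assms(3)] by metis
  also have "\<dots> \<le> c ^ n * (2 * Rad)"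
    using c assms by (intro mult_left_mono dist_B coding_map_B shift_funpow_X) auto
  finally show ?thesis .
qed

definition \<psi> :: "(nat \<Rightarrow> nat) \<Rightarrow> real" where
  "\<psi> x = - ln (s (x 0) (x 1) (\<pi> (left_shift x)))"

abbreviation \<Lambda> :: "nat \<Rightarrow> (nat \<Rightarrow> nat) \<Rightarrow> real" where "\<Lambda> \<equiv> ergodic_sum left_shift \<psi>"

lemma psi_ge: "x \<in> X \<Longrightarrow> - ln c \<le> \<psi> x"
  using s_le[of "x 0" "x 1" "\<pi> (left_shift x)"] s_pos[of x "\<pi> (left_shift x)" 0] edge[of x 0]
    coding_map_B[OF shift_X] by (simp add: \<psi>_def)

lemma psi_le: "x \<in> X \<Longrightarrow> \<psi> x \<le> - ln smin"
  using smin(2)[of "x 0" "x 1" "\<pi> (left_shift x)"] smin(1) edge[of x 0] coding_map_B[OF shift_X] by (simp add: \<psi>_def)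

lemma psi_pos: "x \<in> X \<Longrightarrow> 0 < \<psi> x"
  using psi_ge[of x] c ln_less_zero[of c] by linarith

lemma continuous_on_psi: "continuous_on X \<psi>"
proof (rule continuous_on_XI)
  fix e :: real assume e: "0 < e"
  have "(\<lambda>n. Hc * ((c powr \<gamma>) ^ n * (2 * Rad) powr \<gamma>)) \<longlonglongrightarrow> Hc * (0 * (2 * Rad) powr \<gamma>)"
    using c_powr by (intro tendsto_mult tendsto_const LIMSEQ_power_zero) auto
  then have "eventually (\<lambda>n. Hc * ((c powr \<gamma>) ^ n * (2 * Rad) powr \<gamma>) < e) sequentially"
    using e by (intro order_tendstoD) auto
  then obtain n where n: "Hc * ((c powr \<gamma>) ^ n * (2 * Rad) powr \<gamma>) < e"
    by (meson eventually_sequentially order_refl)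
  show "\<exists>m. \<forall>x\<in>X. \<forall>y\<in>X. (\<forall>i<m. x i = y i) \<longrightarrow> dist (\<psi> x) (\<psi> y) < e"
  proof (intro exI[of _ "n + 2"] ballI impI)
    fix x y assume x: "x \<in> X" and y: "y \<in> X" and eq: "\<forall>i<n + 2. x i = y i"
    have xy: "y 0 = x 0" "y (Suc 0) = x (Suc 0)" using eq by auto
    have "dist (\<pi> (left_shift x)) (\<pi> (left_shift y)) \<le> c ^ n * (2 * Rad)"
      using eq by (intro coding_map_close shift_X x y) (auto simp: left_shift_def)
    then have "dist (\<pi> (left_shift x)) (\<pi> (left_shift y)) powr \<gamma> \<le> (c ^ n * (2 * Rad)) powr \<gamma>"
      using gamma by (intro powr_mono2) auto
    also have "\<dots> = (c powr \<gamma>) ^ n * (2 * Rad) powr \<gamma>"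
      using c Rad by (simp add: powr_mult powr_power powr_realpow[symmetric] powr_powr mult.commute)
    finally have d: "dist (\<pi> (left_shift x)) (\<pi> (left_shift y)) powr \<gamma> \<le> (c powr \<gamma>) ^ n * (2 * Rad) powr \<gamma>" .
    have "dist (\<psi> x) (\<psi> y) \<le> Hc * dist (\<pi> (left_shift x)) (\<pi> (left_shift y)) powr \<gamma>"
      using Hc(2)[of "x 0" "x 1" "\<pi> (left_shift x)" "\<pi> (left_shift y)"] edge[OF x, of 0] coding_map_B[OF shift_X] x y
      by (simp add: \<psi>_def xy dist_real_def abs_minus_commute)
    also have "\<dots> \<le> Hc * ((c powr \<gamma>) ^ n * (2 * Rad) powr \<gamma>)"
      by (rule mult_left_mono[OF d Hc(1)])
    finally show "dist (\<psi> x) (\<psi> y) < e" using n by simp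
  qed
qed

lemma Lambda_Suc: "\<Lambda> (Suc n) x = \<Lambda> n x + \<psi> ((left_shift ^^ n) x)"
  by (simp add: ergodic_sum_def)

text \<open>Chain rule along the orbit: each map sends the coded point of the shifted sequence to
  the coded point of the sequence, so the factors of the stretch are exactly those summed in
  \<open>\<Lambda>\<close>.\<close>

lemma scale_Lambda:
  assumes x: "x \<in> X"
  shows "scale x n (\<pi> ((left_shift ^^ n) x)) = exp (- \<Lambda> n x)"
proof (induction n)
  case 0
  then show ?case by (simp add: ergodic_sum_def)
next
  case (Suc n)
  let ?y = "(left_shift ^^ n) x"
  have y: "?y \<in> X" by (rule shift_funpow_X[OF x])
  have "\<pi> ?y = \<omega> (?y 0) (?y 1) (\<pi> (left_shift ?y))" using coding_map_word[OF y, of 1] by simp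
  then have 1: "\<omega> (x n) (x (Suc n)) (\<pi> (left_shift ?y)) = \<pi> ?y" by (simp add: left_shift_funpow)
  have "\<psi> ?y = - ln (s (x n) (x (Suc n)) (\<pi> (left_shift ?y)))" by (simp add: \<psi>_def left_shift_funpow)
  moreover have "0 < s (x n) (x (Suc n)) (\<pi> (left_shift ?y))"
    by (rule s_pos[OF x coding_map_B[OF shift_X[OF y]]])
  ultimately have "s (x n) (x (Suc n)) (\<pi> (left_shift ?y)) = exp (- \<psi> ?y)" by simp
  then show ?case using Suc 1 by (simp add: Lambda_Suc exp_diff exp_minus field_simps)
qed

lemma Lambda_ge: "x \<in> X \<Longrightarrow> real n * (- ln c) \<le> \<Lambda> n x"
  using sum_bounded_below[of "{..<n}" "- ln c" "\<lambda>k. \<psi> ((left_shift ^^ k) x)"] psi_ge[OF shift_funpow_X]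
  by (simp add: ergodic_sum_def)

lemma Lambda_le: "x \<in> X \<Longrightarrow> \<Lambda> n x \<le> real n * (- ln smin)"
  using sum_bounded_above[of "{..<n}" "\<lambda>k. \<psi> ((left_shift ^^ k) x)" "- ln smin"] psi_le[OF shift_funpow_X]
  by (simp add: ergodic_sum_def)

text \<open>The factor \<open>1 / smin\<close> pays for one missing map, as \<open>n\<close> common
  letters determine only \<open>n - 1\<close> maps; the second summand covers
  \<open>n = 0\<close>.\<close>

definition diamC :: real where "diamC = dist0 * (2 * Rad) * (1 / smin) + 2 * Rad"

lemma coding_map_cylinder_diam:
  assumes x: "x \<in> X" and y: "y \<in> X" and eq: "initial n x = initial n y"
  shows "dist (\<pi> x) (\<pi> y) \<le> diamC * exp (- \<Lambda> n x)"
proof (cases n)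
  case 0
  have "dist (\<pi> x) (\<pi> y) \<le> 2 * Rad" by (intro dist_B coding_map_B x y)
  also have "\<dots> \<le> diamC" using dist0_ge Rad smin by (simp add: diamC_def)
  finally show ?thesis by (simp add: 0 ergodic_sum_def)
next
  case (Suc m)
  have eq': "\<forall>i\<le>m. x i = y i" using eq by (auto simp: Suc initial_eq_iff)
  let ?x = "(left_shift ^^ m) x" and ?y = "(left_shift ^^ m) y"
  have B: "\<pi> ?x \<in> B" "\<pi> ?y \<in> B" by (intro coding_map_B shift_funpow_X x y)+
  have "dist (\<pi> x) (\<pi> y) = dist (word_map \<omega> x m (\<pi> ?x)) (word_map \<omega> x m (\<pi> ?y))"
    using coding_map_word[OF x, of m] coding_map_word[OF y, of m] word_map_cong[OF eq'] by simp
  also have "\<dots> \<le> dist0 * scale x m (\<pi> ?x) * dist (\<pi> ?x) (\<pi> ?y)"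
    by (rule word_map_upper[OF x B B(1)])
  also have "\<dots> \<le> dist0 * scale x m (\<pi> ?x) * (2 * Rad)"
    using dist0_ge scale_pos[OF x B(1), of m] dist_B[OF B] by (intro mult_left_mono) auto
  also have "\<dots> = dist0 * (2 * Rad) * exp (- \<Lambda> m x)" unfolding scale_Lambda[OF x] by simp
  also have "exp (- \<Lambda> m x) \<le> (1 / smin) * exp (- \<Lambda> n x)"
  proof -
    have "exp (\<psi> ?x) \<le> exp (- ln smin)" using psi_le[OF shift_funpow_X[OF x], of m] by simp
    then have "exp (- \<Lambda> n x) * exp (\<psi> ?x) \<le> exp (- \<Lambda> n x) * (1 / smin)"
      using smin by (intro mult_left_mono) (auto simp: exp_minus inverse_eq_divide)
    then show ?thesis by (simp add: Suc Lambda_Suc mult_exp_exp mult.commute)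
  qed
  finally have "dist (\<pi> x) (\<pi> y) \<le> dist0 * (2 * Rad) * (1 / smin) * exp (- \<Lambda> n x)"
    using dist0_ge Rad by (simp add: mult_left_mono mult.assoc)
  also have "\<dots> \<le> diamC * exp (- \<Lambda> n x)" using Rad by (intro mult_right_mono) (auto simp: diamC_def)
  finally show ?thesis .
qed

lemma diamC_pos: "0 < diamC"
  using dist0_ge Rad smin by (simp add: diamC_def add_nonneg_pos)

subsection \<open>Pieces of comparable size\<close>

lemma scale_Lambda_compare:
  assumes "x \<in> X"
  shows "exp (- \<Lambda> n x) \<le> dist0 * scale x n 0" "scale x n 0 \<le> dist0 * exp (- \<Lambda> n x)"
  using scale_distortion[OF assms coding_map_B[OF shift_funpow_X[OF assms], of n], of 0 n]
    scale_distortion[OF assms _ coding_map_B[OF shift_funpow_X[OF assms], of n], of 0 n]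
    Rad scale_Lambda[OF assms, of n] by auto

text \<open>A stopping time: the first level at which the piece has size about \<open>d\<close>. The
  stretch is measured at the fixed point \<open>0\<close>, so the decision to stop depends only on
  the letters up to that level.\<close>

definition cut :: "real \<Rightarrow> (nat \<Rightarrow> nat) \<Rightarrow> nat" where
  "cut d x = (LEAST n. scale x n 0 \<le> d)"

lemma cut_props:
  assumes x: "x \<in> X" and d: "0 < d"
  shows "scale x (cut d x) 0 \<le> d" "n < cut d x \<Longrightarrow> d < scale x n 0"
proof -
  have "(\<lambda>n. c ^ n) \<longlonglongrightarrow> 0" using c by (intro LIMSEQ_power_zero) auto
  then have "eventually (\<lambda>n. c ^ n < d) sequentially" using d by (rule order_tendstoD)
  then obtain n where "c ^ n < d" by (meson eventually_sequentially order_refl)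
  then have "scale x n 0 \<le> d" using scale_le[OF x, of 0 n] Rad by simp
  then show "scale x (cut d x) 0 \<le> d" unfolding cut_def by (rule LeastI)
  show "d < scale x n 0" if "n < cut d x" for n
    using not_less_Least that unfolding cut_def by (metis not_le)
qed

lemma cut_cong:
  assumes "x \<in> X" "y \<in> X" "0 < d" "\<forall>i\<le>cut d x. x i = y i"
  shows "cut d y = cut d x"
proof -
  have sc: "scale y n 0 = scale x n 0" if "n \<le> cut d x" for n
    using assms(4) that by (intro scale_cong) auto
  have "scale y (cut d x) 0 \<le> d" using cut_props(1)[OF assms(1,3)] sc by simp
  moreover have "\<not> scale y n 0 \<le> d" if "n < cut d x" for n
    using cut_props(2)[OF assms(1,3) that] sc[of n] that by simp
  ultimately show ?thesis unfolding cut_def[of d y]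
    by (intro Least_equality) (auto simp: not_less[symmetric])
qed

text \<open>By the stopping property neither word extends the other, so the first difference
  \<open>k\<close> occurs before both cuts; there the open set condition applies, carried over by
  the injective common prefix map. Equal first letters ensure \<open>0 < k\<close>: the open set
  condition separates only images inside the same \<open>U i\<close>.\<close>

lemma pieces_disjoint:
  assumes x: "x \<in> X" and y: "y \<in> X" and d: "0 < d" and first: "x 0 = y 0"
    and neq: "initial (Suc (cut d x)) x \<noteq> initial (Suc (cut d y)) y"
  shows "word_map \<omega> x (cut d x) ` U (x (cut d x)) \<inter> word_map \<omega> y (cut d y) ` U (y (cut d y)) = {}"
proof -
  have ex: "\<exists>i. x i \<noteq> y i"
  proof (rule ccontr)
    assume "\<not> ?thesis"
    then have "x = y" by auto
    then show False using neq by simp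
  qed
  define k where "k = (LEAST i. x i \<noteq> y i)"
  have k: "x k \<noteq> y k" unfolding k_def by (rule LeastI_ex[OF ex])
  have less: "x i = y i" if "i < k" for i using not_less_Least that unfolding k_def by blast
  have k0: "0 < k" using k first by (cases k) auto
  have kx: "k \<le> cut d x"
  proof (rule ccontr)
    assume "\<not> k \<le> cut d x"
    then have "\<forall>i\<le>cut d x. x i = y i" using less by auto
    then have "initial (Suc (cut d x)) x = initial (Suc (cut d y)) y"
      using cut_cong[OF x y d] by (simp add: initial_eq_iff less_Suc_eq_le)
    then show False using neq by simp
  qed
  have ky: "k \<le> cut d y"
  proof (rule ccontr)
    assume "\<not> k \<le> cut d y"
    then have "\<forall>i\<le>cut d y. y i = x i" using less by auto
    then have "initial (Suc (cut d x)) x = initial (Suc (cut d y)) y"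
      using cut_cong[OF y x d] by (simp add: initial_eq_iff less_Suc_eq_le)
    then show False using neq by simp
  qed
  have nest: "word_map \<omega> v n ` U (v n) \<subseteq> word_map \<omega> v m ` U (v m)" if v: "v \<in> X" and "m \<le> n" for v m n
  proof -
    have "word_map \<omega> v (Suc n) ` U (v (Suc n)) \<subseteq> word_map \<omega> v n ` U (v n)" for n
      using osc(1)[of "v n" "v (Suc n)"] edge[OF v, of n] by (auto simp: image_comp[symmetric])
    then have "antimono (\<lambda>n. word_map \<omega> v n ` U (v n))" by (simp add: antimono_iff_le_Suc)
    then show ?thesis using that by (auto dest: antimonoD)
  qed
  obtain m where m: "k = Suc m" using k0 by (cases k) auto
  have T: "word_map \<omega> x m = word_map \<omega> y m" using less m by (intro word_map_cong) auto
  have xm: "x m = y m" using less m by simp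
  have "\<omega> (x m) (x k) ` U (x k) \<inter> \<omega> (x m) (y k) ` U (y k) = {}"
    using edge[OF x, of m] edge[OF y, of m] k xm m by (intro osc(2)) auto
  then have "word_map \<omega> x m ` (\<omega> (x m) (x k) ` U (x k)) \<inter> word_map \<omega> x m ` (\<omega> (x m) (y k) ` U (y k)) = {}"
    by (simp only: image_Int[OF bij_is_inj[OF bij_word_map[OF x]], symmetric] image_empty)
  moreover have "word_map \<omega> x k ` U (x k) = word_map \<omega> x m ` (\<omega> (x m) (x k) ` U (x k))"
    by (simp add: m image_comp comp_def)
  moreover have "word_map \<omega> y k ` U (y k) = word_map \<omega> x m ` (\<omega> (x m) (y k) ` U (y k))"
    by (simp add: m image_comp comp_def T xm)
  ultimately have "word_map \<omega> x k ` U (x k) \<inter> word_map \<omega> y k ` U (y k) = {}" by simp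
  then show ?thesis using nest[OF x kx] nest[OF y ky] by blast
qed

text \<open>Comparison of Lebesgue measures.\<close>

lemma packing_bound:
  fixes y :: "'i \<Rightarrow> 'e"
  assumes F: "finite F" and r: "0 < r" and R: "0 < R"
    and disj: "disjoint_family_on (\<lambda>i. ball (y i) r) F" and sub: "\<And>i. i \<in> F \<Longrightarrow> ball (y i) r \<subseteq> ball b R"
  shows "real (card F) \<le> (R / r) ^ DIM('e)"
proof -
  let ?v = "unit_ball_vol (real DIM('e))"
  have v: "0 < ?v" by simp
  have fm: "ball z t \<in> fmeasurable lborel" if "0 < t" for z :: 'e and t
    using that by (intro fmeasurableI) (auto simp: emeasure_ball)
  have "real (card F) * (?v * r ^ DIM('e)) = (\<Sum>i\<in>F. measure lborel (ball (y i) r))"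
    using r by (simp add: content_ball)
  also have "\<dots> = measure lborel (\<Union>i\<in>F. ball (y i) r)"
    using F disj r by (intro measure_finite_Union[symmetric]) (auto simp: emeasure_ball)
  also have "\<dots> \<le> measure lborel (ball b R)"
    using sub F by (intro measure_mono_fmeasurable fm[OF R]) auto
  also have "\<dots> = ?v * R ^ DIM('e)" using R by (simp add: content_ball)
  finally have "?v * (real (card F) * r ^ DIM('e)) \<le> ?v * R ^ DIM('e)" by (simp add: mult_ac)
  then have "real (card F) * r ^ DIM('e) \<le> R ^ DIM('e)" using v by (simp only: mult_le_cancel_left_pos)
  then show ?thesis using r by (simp add: power_divide field_simps)
qed

end

context conformal_ifs
begin

text \<open>The link between geometry and symbols: a set of points whose codings are within
  \<open>d\<close> of each other is covered by at most \<open>K\<close> cylinders of size about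
  \<open>d\<close>, with \<open>K\<close> independent of \<open>d\<close>. These cylinders have
  length at least \<open>N\<close> once \<open>d < \<delta> N\<close>.\<close>

lemma scale_cover:
  obtains K C3 :: real and \<delta> :: "nat \<Rightarrow> real" where "0 < C3" "\<And>N. 0 < \<delta> N" "0 \<le> K"
    "\<And>d N S. \<lbrakk>0 < d; d < \<delta> N; S \<subseteq> X; \<And>x y. x \<in> S \<Longrightarrow> y \<in> S \<Longrightarrow> dist (\<pi> x) (\<pi> y) \<le> d\<rbrakk> \<Longrightarrow>
      \<exists>F len. finite F \<and> F \<subseteq> S \<and> real (card F) \<le> K \<and>
        (\<forall>x\<in>S. \<exists>y\<in>F. initial (len y) x = initial (len y) y) \<and>
        (\<forall>y\<in>F. N \<le> len y \<and> exp (- \<Lambda> (len y) y) \<le> C3 * d)"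
proof -
  \<comment> \<open>Every stopped piece contains a ball of radius \<open>\<kappa> * d\<close>:
    \<open>\<rho>\<close> is the radius available before mapping, \<open>smin / dist0\<close> bounds
    the overshoot of the stopping rule, and a further \<open>dist0\<close> comes from the inner ball
    lemma.\<close>
  define \<kappa> where "\<kappa> = \<rho> * smin / dist0\<^sup>2"
  \<comment> \<open>Adds the distance from the image of the centre to the coded point, the diameter
    \<open>d\<close> of the coded set, and the radius of the inner ball, all in units of
    \<open>d\<close>.\<close>
  define M where "M = dist0 * (2 * Rad) + 1 + \<kappa>"
  have d0: "0 < dist0" using dist0_ge by simp
  have kap: "0 < \<kappa>" using \<rho>(1) smin(1) d0 by (simp add: \<kappa>_def)
  have M: "0 < M" using kap d0 Rad by (simp add: M_def add_pos_pos)
  \<comment> \<open>A packing bound for each of the \<open>p\<close> possible first letters.\<close>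
  define K where "K = real p * (M / \<kappa>) ^ DIM('e)"
  \<comment> \<open>The bound \<open>1\<close> forces the cut to be positive; the other bound forces
    at least \<open>N\<close> letters, because each map shrinks at most by
    \<open>smin\<close>.\<close>
  define \<delta> where "\<delta> N = min 1 (smin ^ N / dist0)" for N
  show ?thesis
  proof (rule that[of dist0 \<delta> K])
    show "0 < dist0" by (rule d0)
    show "0 < \<delta> N" for N using smin d0 by (simp add: \<delta>_def)
    show "0 \<le> K" using M kap by (simp add: K_def)
    fix d :: real and N S
    assume d: "0 < d" "d < \<delta> N" and S: "S \<subseteq> X" and close: "\<And>x y. x \<in> S \<Longrightarrow> y \<in> S \<Longrightarrow> dist (\<pi> x) (\<pi> y) \<le> d"
    define g where "g x = initial (Suc (cut d x)) x" for x
    have "(\<lambda>n. c ^ n) \<longlonglongrightarrow> 0" using c by (intro LIMSEQ_power_zero) auto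
    then have "eventually (\<lambda>n. c ^ n < d) sequentially" using d(1) by (rule order_tendstoD)
    then obtain n0 where n0: "c ^ n0 < d" by (meson eventually_sequentially order_refl)
    have cut_le: "cut d x \<le> n0" if "x \<in> X" for x
    proof -
      have "scale x n0 0 \<le> d" using scale_le[OF that, of 0 n0] n0 Rad by simp
      then show ?thesis unfolding cut_def by (rule Least_le)
    qed
    have "g ` S \<subseteq> (\<Union>n\<le>Suc n0. words n)"
    proof
      fix w assume "w \<in> g ` S"
      then obtain x where x: "x \<in> X" "w = g x" using S by blast
      then have "w \<in> words (Suc (cut d x))" using initial_words by (simp only: g_def)
      then show "w \<in> (\<Union>n\<le>Suc n0. words n)" using cut_le[OF x(1)] by blast
    qed
    then have "finite (g ` S)" by (rule finite_subset) (intro finite_UN_I finite_words finite_atMost)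
    \<comment> \<open>One representative for each stopped word.\<close>
    moreover obtain F where F: "F \<subseteq> S" "inj_on g F" "g ` S = g ` F"
      using subset_image_inj[of "g ` S" g S] by blast
    ultimately have finF: "finite F" using finite_imageD by metis
    have FX: "x \<in> X" if "x \<in> F" for x using F(1) S that by blast
    define cen where "cen x = word_map \<omega> x (cut d x) (ctr (x (cut d x)))" for x
    have ctr_B: "cball (ctr (x n)) \<rho> \<subseteq> B" "cball (ctr (x n)) \<rho> \<subseteq> U (x n)" "ctr (x n) \<in> B" if "x \<in> X" for x n
      using \<rho>(2)[OF X_letter[OF that, of n]] \<rho>(1) by (auto simp: subset_iff)
    \<comment> \<open>One level before the cut the stretch still exceeds \<open>d\<close>; the last
      map multiplies it by at least \<open>smin\<close>, and the change of base point costs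
      \<open>dist0\<close>.\<close>
    have scale_ge: "d * smin / dist0 \<le> scale x (cut d x) 0" if x: "x \<in> X" for x
    proof -
      have "cut d x \<noteq> 0"
      proof
        assume "cut d x = 0"
        then have "1 \<le> d" using cut_props(1)[OF x d(1)] by simp
        then show False using d(2) by (simp add: \<delta>_def)
      qed
      then obtain m where m: "cut d x = Suc m" by (cases "cut d x") auto
      let ?w = "\<omega> (x m) (x (Suc m)) 0"
      have w: "?w \<in> B" "0 \<in> B" using maps_B[of "x m" "x (Suc m)" 0] edge[OF x, of m] Rad by auto
      have "d < scale x m 0" using cut_props(2)[OF x d(1), of m] m by simp
      also have "\<dots> \<le> dist0 * scale x m ?w" by (rule scale_distortion[OF x w(2,1)])
      finally have "d / dist0 \<le> scale x m ?w" using d0 by (simp add: field_simps)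
      moreover have "smin \<le> s (x m) (x (Suc m)) 0" using smin(2) edge[OF x, of m] w by blast
      ultimately have "d / dist0 * smin \<le> scale x m ?w * s (x m) (x (Suc m)) 0"
        using smin(1) d(1) d0 scale_pos[OF x w(1), of m] by (intro mult_mono) auto
      then show ?thesis by (simp add: m)
    qed
    have ball_in: "ball (cen x) (\<kappa> * d) \<subseteq> word_map \<omega> x (cut d x) ` U (x (cut d x))" if x: "x \<in> X" for x
    proof
      fix v assume "v \<in> ball (cen x) (\<kappa> * d)"
      then have "dist (cen x) v < \<kappa> * d" by simp
      also have "\<kappa> * d = \<rho> * (d * smin / dist0) / dist0" by (simp add: \<kappa>_def power2_eq_square)
      also have "\<dots> \<le> \<rho> * scale x (cut d x) 0 / dist0"
        using scale_ge[OF x] \<rho>(1) d0 by (intro divide_right_mono mult_left_mono) auto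
      finally have "v \<in> word_map \<omega> x (cut d x) ` ball (ctr (x (cut d x))) \<rho>"
        using Rad by (intro word_map_ball[OF x ctr_B(1)[OF x] \<rho>(1), of 0]) (auto simp: cen_def)
      then show "v \<in> word_map \<omega> x (cut d x) ` U (x (cut d x))"
        using ctr_B(2)[OF x, of "cut d x"] ball_subset_cball by blast
    qed
    have cen_close: "dist (cen x) (\<pi> x) \<le> dist0 * (2 * Rad) * d" if x: "x \<in> X" for x
    proof -
      let ?n = "cut d x"
      have B: "\<pi> ((left_shift ^^ ?n) x) \<in> B" "0 \<in> B" using coding_map_B[OF shift_funpow_X[OF x]] Rad by auto
      have "dist (cen x) (\<pi> x) \<le> dist0 * scale x ?n 0 * dist (ctr (x ?n)) (\<pi> ((left_shift ^^ ?n) x))"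
        unfolding cen_def coding_map_word[OF x, of ?n] by (rule word_map_upper[OF x ctr_B(3)[OF x] B])
      also have "\<dots> \<le> dist0 * d * (2 * Rad)"
        using cut_props(1)[OF x d(1)] d0 d(1) scale_pos[OF x B(2), of ?n] dist_B[OF ctr_B(3)[OF x] B(1)]
        by (intro mult_mono mult_left_mono) auto
      finally show ?thesis by (simp add: mult_ac)
    qed
    have card_i: "real (card {x \<in> F. x 0 = i}) \<le> (M / \<kappa>) ^ DIM('e)" for i
    proof (cases "{x \<in> F. x 0 = i} = {}")
      case True
      show ?thesis unfolding True using M kap by simp
    next
      case False
      then obtain x0 where x0: "x0 \<in> F" "x0 0 = i" by auto
      have "real (card {x \<in> F. x 0 = i}) \<le> (M * d / (\<kappa> * d)) ^ DIM('e)"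
      proof (rule packing_bound[where y = cen and b = "\<pi> x0"])
        show "disjoint_family_on (\<lambda>x. ball (cen x) (\<kappa> * d)) {x \<in> F. x 0 = i}"
        proof (unfold disjoint_family_on_def, intro ballI impI)
          fix x y assume x: "x \<in> {x \<in> F. x 0 = i}" and y: "y \<in> {x \<in> F. x 0 = i}" and "x \<noteq> y"
          then have "g x \<noteq> g y" using F(2) by (auto simp: inj_on_def)
          then have "word_map \<omega> x (cut d x) ` U (x (cut d x)) \<inter> word_map \<omega> y (cut d y) ` U (y (cut d y)) = {}"
            using x y FX d(1) by (intro pieces_disjoint) (auto simp: g_def)
          then show "ball (cen x) (\<kappa> * d) \<inter> ball (cen y) (\<kappa> * d) = {}"
            using ball_in[of x] ball_in[of y] x y FX by blast
        qed
        fix x assume x: "x \<in> {x \<in> F. x 0 = i}"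
        show "ball (cen x) (\<kappa> * d) \<subseteq> ball (\<pi> x0) (M * d)"
        proof
          fix v assume "v \<in> ball (cen x) (\<kappa> * d)"
          then have "dist (cen x) v < \<kappa> * d" by simp
          moreover have "dist (cen x) (\<pi> x) \<le> dist0 * (2 * Rad) * d" using cen_close x FX by blast
          moreover have "dist (\<pi> x) (\<pi> x0) \<le> d" using close F(1) x x0 by blast
          moreover have "dist (\<pi> x0) v \<le> dist (\<pi> x) (\<pi> x0) + dist (cen x) (\<pi> x) + dist (cen x) v"
            by (smt (verit) dist_commute dist_triangle)
          moreover have "M * d = dist0 * (2 * Rad) * d + d + \<kappa> * d" by (simp add: M_def algebra_simps)
          ultimately show "v \<in> ball (\<pi> x0) (M * d)" by simp
        qed
      qed (use finF kap M d in auto)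
      then show ?thesis using d(1) by simp
    qed
    have "F = (\<Union>i\<in>{1..p}. {x \<in> F. x 0 = i})" using FX X_letter by auto
    then have "card F = card (\<Union>i\<in>{1..p}. {x \<in> F. x 0 = i})" by (rule arg_cong)
    also have "\<dots> \<le> (\<Sum>i\<in>{1..p}. card {x \<in> F. x 0 = i})" by (rule card_UN_le) simp
    finally have "card F \<le> (\<Sum>i\<in>{1..p}. card {x \<in> F. x 0 = i})" .
    then have "real (card F) \<le> (\<Sum>i\<in>{1..p}. real (card {x \<in> F. x 0 = i}))"
      by (simp only: of_nat_le_iff flip: of_nat_sum)
    also have "\<dots> \<le> (\<Sum>i\<in>{1..p}. (M / \<kappa>) ^ DIM('e))" by (intro sum_mono card_i)
    also have "\<dots> = K" by (simp add: K_def)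
    finally have cardF: "real (card F) \<le> K" .
    have cover: "\<exists>y\<in>F. initial (Suc (cut d y)) x = initial (Suc (cut d y)) y" if "x \<in> S" for x
    proof -
      have "g x \<in> g ` F" unfolding F(3)[symmetric] using that by (rule imageI)
      then obtain y where y: "y \<in> F" "g x = g y" by (auto elim!: imageE)
      then have "length (g x) = length (g y)" by simp
      then have "cut d x = cut d y" by (simp add: g_def)
      then show ?thesis using y by (auto simp: g_def)
    qed
    have fine: "N \<le> Suc (cut d y) \<and> exp (- \<Lambda> (Suc (cut d y)) y) \<le> dist0 * d" if y: "y \<in> X" for y
    proof
      have sc: "smin \<le> 1" "scale y (cut d y) 0 \<le> d"
        using smin(2)[of "y 0" "y 1" 0] s_le[of "y 0" "y 1" 0] edge[OF y, of 0] Rad c cut_props(1)[OF y d(1)] by auto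
      show "N \<le> Suc (cut d y)"
      proof (rule ccontr)
        assume "\<not> N \<le> Suc (cut d y)"
        then have "smin ^ N \<le> smin ^ cut d y" using sc(1) smin(1) by (intro power_decreasing) auto
        also have "\<dots> = exp (real (cut d y) * ln smin)" using smin(1) by (simp add: exp_of_nat_mult)
        also have "\<dots> \<le> exp (- \<Lambda> (cut d y) y)" using Lambda_le[OF y, of "cut d y"] by simp
        also have "\<dots> \<le> dist0 * scale y (cut d y) 0" by (rule scale_Lambda_compare[OF y])
        also have "\<dots> \<le> dist0 * d" using sc(2) d0 by simp
        finally have "smin ^ N / dist0 \<le> d" using d0 by (simp add: field_simps)
        then show False using d(2) by (simp add: \<delta>_def)
      qed
      have "exp (- \<Lambda> (Suc (cut d y)) y) \<le> exp (- \<Lambda> (cut d y) y)"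
        using psi_pos[OF shift_funpow_X[OF y], of "cut d y"] by (simp add: Lambda_Suc)
      also have "\<dots> \<le> dist0 * scale y (cut d y) 0" by (rule scale_Lambda_compare[OF y])
      also have "\<dots> \<le> dist0 * d" using sc(2) d0 by simp
      finally show "exp (- \<Lambda> (Suc (cut d y)) y) \<le> dist0 * d" .
    qed
    show "\<exists>F len. finite F \<and> F \<subseteq> S \<and> real (card F) \<le> K \<and>
        (\<forall>x\<in>S. \<exists>y\<in>F. initial (len y) x = initial (len y) y) \<and>
        (\<forall>y\<in>F. N \<le> len y \<and> exp (- \<Lambda> (len y) y) \<le> dist0 * d)"
      using finF F(1) cardF cover fine FX by (intro exI[of _ F] exI[of _ "\<lambda>y. Suc (cut d y)"]) blast
  qed
qed

end

section \<open>Hausdorff measure and dimension\<close>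

text \<open>A form free of suprema and infima, in which the passage to subsets and countable unions
  is a matter of choosing covers.\<close>

lemma hausdorff_null_iff:
  fixes S :: "'a::metric_space set"
  shows "hausdorff_measure t S = 0 \<longleftrightarrow>
    (\<forall>\<delta>>0. \<forall>e>0. \<exists>U :: nat \<Rightarrow> 'a set. S \<subseteq> (\<Union>i. U i) \<and> (\<forall>i. bounded (U i) \<and> diameter (U i) \<le> \<delta>) \<and>
      (\<Sum>i. ennreal (diameter_power t (U i))) < ennreal e)"
    (is "_ \<longleftrightarrow> (\<forall>\<delta>>0. \<forall>e>0. ?P \<delta> e)")
proof -
  let ?C = "\<lambda>\<delta>. {U :: nat \<Rightarrow> 'a set. S \<subseteq> (\<Union>i. U i) \<and> (\<forall>i. bounded (U i) \<and> diameter (U i) \<le> \<delta>)}"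
  let ?f = "\<lambda>U :: nat \<Rightarrow> 'a set. \<Sum>i. ennreal (diameter_power t (U i))"
  have "hausdorff_measure t S = 0 \<longleftrightarrow> (\<forall>\<delta>>0. (INF U\<in>?C \<delta>. ?f U) = 0)"
    unfolding hausdorff_measure_def bot_ennreal[symmetric] SUP_bot_conv by auto
  also have "\<dots> \<longleftrightarrow> (\<forall>\<delta>>0. \<forall>e>0. (INF U\<in>?C \<delta>. ?f U) < ennreal e)"
  proof -
    have eq: "x = 0 \<longleftrightarrow> (\<forall>e>0. x < ennreal e)" for x :: ennreal
    proof
      assume "\<forall>e>0. x < ennreal e"
      then have "x \<le> 0 + ennreal e" if "0 < e" for e using that by (simp add: less_imp_le)
      then show "x = 0" using ennreal_le_epsilon[of 0 x] by simp
    qed simp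
    show ?thesis by (simp only: eq)
  qed
  finally show ?thesis by (simp add: INF_less_iff conj_assoc)
qed

lemma hausdorff_null_mono:
  "hausdorff_measure t T = 0 \<Longrightarrow> S \<subseteq> T \<Longrightarrow> hausdorff_measure t S = 0"
  unfolding hausdorff_null_iff by (meson order_trans)

lemma hausdorff_null_UN:
  fixes A :: "nat \<Rightarrow> 'a::metric_space set"
  assumes "\<And>n. hausdorff_measure t (A n) = 0"
  shows "hausdorff_measure t (\<Union>n. A n) = 0"
  unfolding hausdorff_null_iff
proof (intro allI impI)
  fix \<delta> e :: real assume pos: "0 < \<delta>" "0 < e"
  \<comment> \<open>The budgets add up to \<open>e / 2\<close>, which keeps the final inequality
    strict.\<close>
  define d where "d n = e / 2 * (1/2) ^ Suc n" for n
  have d: "0 < d n" for n using pos by (simp add: d_def)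
  have "\<forall>n. \<exists>U. A n \<subseteq> (\<Union>i. U i) \<and> (\<forall>i. bounded (U i) \<and> diameter (U i) \<le> \<delta>) \<and>
      (\<Sum>i. ennreal (diameter_power t (U i))) < ennreal (d n)"
    using assms pos d unfolding hausdorff_null_iff by blast
  from choice[OF this] obtain U where U: "\<And>n. A n \<subseteq> (\<Union>i. U n i)"
    "\<And>n i. bounded (U n i) \<and> diameter (U n i) \<le> \<delta>"
    "\<And>n. (\<Sum>i. ennreal (diameter_power t (U n i))) < ennreal (d n)"
    by blast
  define V where "V k = case_prod U (prod_decode k)" for k
  have "(\<Union>n. A n) \<subseteq> (\<Union>k. V k)"
  proof
    fix x assume "x \<in> (\<Union>n. A n)"
    then obtain n i where "x \<in> U n i" using U(1) by blast
    then have "x \<in> V (prod_encode (n, i))" by (simp add: V_def)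
    then show "x \<in> (\<Union>k. V k)" by blast
  qed
  moreover have "bounded (V k) \<and> diameter (V k) \<le> \<delta>" for k
    using U(2) by (simp add: V_def case_prod_beta)
  moreover have "(\<Sum>k. ennreal (diameter_power t (V k))) < ennreal e"
  proof -
    have "(\<Sum>k. ennreal (diameter_power t (V k))) = (\<Sum>n. \<Sum>i. ennreal (diameter_power t (U n i)))"
      unfolding V_def using suminf_ennreal_2dimen[of "\<lambda>n. \<Sum>i. ennreal (diameter_power t (U n i))"
          "\<lambda>(n, i). ennreal (diameter_power t (U n i))"] by (simp add: case_prod_beta)
    also have "\<dots> \<le> (\<Sum>n. ennreal (d n))"
      using U(3) by (intro suminf_le) (auto simp: less_imp_le)
    also have "\<dots> = ennreal (e / 2)"
    proof -
      have "d sums (e / 2 * 1)" unfolding d_def by (intro sums_mult power_half_series)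
      then show ?thesis using d by (intro suminf_ennreal_eq) (auto simp: less_imp_le)
    qed
    also have "\<dots> < ennreal e" using pos by (simp add: ennreal_less_iff)
    finally show ?thesis .
  qed
  ultimately show "\<exists>U :: nat \<Rightarrow> 'a set. (\<Union>n. A n) \<subseteq> (\<Union>i. U i) \<and> (\<forall>i. bounded (U i) \<and> diameter (U i) \<le> \<delta>) \<and>
      (\<Sum>i. ennreal (diameter_power t (U i))) < ennreal e" by blast
qed

text \<open>Positive bounds \<open>D x\<close> replace the diameters, so that
  \<open>D x powr t\<close> dominates \<open>diameter_power\<close> also for single points and for
  \<open>t = 0\<close>.\<close>

lemma hausdorff_null_finite_covers:
  fixes S :: "'a::metric_space set"
  assumes "\<And>\<delta> e. 0 < \<delta> \<Longrightarrow> 0 < e \<Longrightarrow> \<exists>R (V :: 'i \<Rightarrow> 'a set) D. finite R \<and> S \<subseteq> (\<Union>x\<in>R. V x) \<and>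
    (\<forall>x\<in>R. 0 < D x \<and> D x \<le> \<delta> \<and> (\<forall>y\<in>V x. \<forall>z\<in>V x. dist y z \<le> D x)) \<and> (\<Sum>x\<in>R. D x powr t) < e"
    and t: "0 \<le> t"
  shows "hausdorff_measure t S = 0"
  unfolding hausdorff_null_iff
proof (intro allI impI)
  fix \<delta> e :: real assume pos: "0 < \<delta>" "0 < e"
  obtain R and V :: "'i \<Rightarrow> 'a set" and D where R: "finite R" "S \<subseteq> (\<Union>x\<in>R. V x)" "(\<Sum>x\<in>R. D x powr t) < e"
    and D: "\<And>x. x \<in> R \<Longrightarrow> 0 < D x \<and> D x \<le> \<delta> \<and> (\<forall>y\<in>V x. \<forall>z\<in>V x. dist y z \<le> D x)"
    using assms(1)[OF pos] by blast
  obtain h where h: "bij_betw h {..<card R} R"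
    using ex_bij_betw_nat_finite[OF R(1)] by (auto simp: atLeast0LessThan)
  define U where "U i = (if i < card R then V (h i) else {})" for i
  have hR: "h i \<in> R" if "i < card R" for i using h that by (auto simp: bij_betw_def)
  have diam: "diameter (V x) \<le> D x" "bounded (V x)" if "x \<in> R" for x
  proof -
    show "bounded (V x)" using D[OF that] unfolding bounded_two_points by blast
    show "diameter (V x) \<le> D x"
    proof (cases "V x = {}")
      case True
      then show ?thesis using D[OF that] by (simp add: less_imp_le)
    next
      case False
      then show ?thesis unfolding diameter_def using D[OF that] by (auto intro!: cSUP_least)
    qed
  qed
  have dp: "diameter_power t (V x) \<le> D x powr t" if "x \<in> R" for x
    using diam[OF that] D[OF that] diameter_ge_0[of "V x"] t
    by (auto simp: diameter_power_def intro!: powr_mono2)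
  have "S \<subseteq> (\<Union>i. U i)"
  proof
    fix y assume "y \<in> S"
    then obtain x where "x \<in> R" "y \<in> V x" using R(2) by blast
    then have "x \<in> h ` {..<card R}" using h by (simp add: bij_betw_def)
    then obtain i where "i < card R" "h i = x" by auto
    then have "y \<in> U i" using \<open>y \<in> V x\<close> by (auto simp: U_def)
    then show "y \<in> (\<Union>i. U i)" by blast
  qed
  moreover have "bounded (U i) \<and> diameter (U i) \<le> \<delta>" for i
    using diam[OF hR] D[OF hR] pos by (auto simp: U_def intro: order_trans)
  moreover have "(\<Sum>i. ennreal (diameter_power t (U i))) < ennreal e"
  proof -
    have "(\<Sum>i. ennreal (diameter_power t (U i))) = (\<Sum>i<card R. ennreal (diameter_power t (U i)))"
      by (intro suminf_finite) (auto simp: U_def diameter_power_def)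
    also have "\<dots> = (\<Sum>i<card R. ennreal (diameter_power t (V (h i))))"
      by (intro sum.cong) (auto simp: U_def)
    also have "\<dots> = (\<Sum>x\<in>R. ennreal (diameter_power t (V x)))"
      by (rule sum.reindex_bij_betw[OF h])
    also have "\<dots> \<le> (\<Sum>x\<in>R. ennreal (D x powr t))" using dp by (intro sum_mono ennreal_leI)
    also have "\<dots> = ennreal (\<Sum>x\<in>R. D x powr t)" by (simp add: sum_ennreal)
    also have "\<dots> < ennreal e" using R(3) pos by (simp add: ennreal_less_iff sum_nonneg)
    finally show ?thesis .
  qed
  ultimately show "\<exists>U :: nat \<Rightarrow> 'a set. S \<subseteq> (\<Union>i. U i) \<and> (\<forall>i. bounded (U i) \<and> diameter (U i) \<le> \<delta>) \<and>
      (\<Sum>i. ennreal (diameter_power t (U i))) < ennreal e" by blast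
qed

lemma hausdorff_measure_0_nonempty:
  assumes "S \<noteq> {}"
  shows "hausdorff_measure 0 S \<noteq> 0"
proof
  assume "hausdorff_measure 0 S = 0"
  then obtain U where U: "S \<subseteq> (\<Union>i. U i)" "(\<Sum>i. ennreal (diameter_power 0 (U i))) < ennreal 1"
    unfolding hausdorff_null_iff using zero_less_one by blast
  obtain i where "U i \<noteq> {}" using U(1) assms by blast
  then have "ennreal (diameter_power 0 (U i)) = 1" by (simp add: diameter_power_def)
  moreover have "(\<Sum>i\<in>{i}. ennreal (diameter_power 0 (U i))) \<le> (\<Sum>i. ennreal (diameter_power 0 (U i)))"
    by (rule sum_le_suminf) auto
  ultimately show False using U(2) by simp
qed

text \<open>For nonempty \<open>S\<close> the case \<open>t = 0\<close> gives
  \<open>0 \<le> M\<close>; every real number above \<open>M\<close> is then a competitor in the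
  infimum.\<close>

lemma hausdorff_dim_leI:
  assumes "\<And>t. 0 \<le> t \<Longrightarrow> hausdorff_measure t S \<noteq> 0 \<Longrightarrow> ereal t \<le> M"
  shows "hausdorff_dim S \<le> M"
proof (cases "S = {}")
  case True
  then show ?thesis by (simp add: hausdorff_dim_def)
next
  case False
  have M0: "0 \<le> M" using assms[of 0] hausdorff_measure_0_nonempty[OF False] by (simp add: zero_ereal_def)
  show ?thesis
  proof (rule dense_ge)
    fix z assume z: "M < z"
    then obtain t where t: "M < ereal t" "ereal t < z" using ereal_dense2 by blast
    then have "0 \<le> t" using M0 by (metis ereal_less_eq(5) less_imp_le order_trans)
    moreover then have "hausdorff_measure t S = 0" using assms[of t] t by (meson not_less)
    ultimately have "hausdorff_dim S \<le> ereal t" using False by (auto simp: hausdorff_dim_def intro!: INF_lower)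
    then show "hausdorff_dim S \<le> z" using t by simp
  qed
qed

lemma hausdorff_dim_geI:
  assumes "S \<noteq> {}" "\<And>t. 0 \<le> t \<Longrightarrow> ereal t < M \<Longrightarrow> hausdorff_measure t S \<noteq> 0"
  shows "M \<le> hausdorff_dim S"
proof -
  have "M \<le> ereal t" if "0 \<le> t" "hausdorff_measure t S = 0" for t
    using assms(2)[OF that(1)] that(2) by (meson not_less)
  then show ?thesis using assms(1) by (auto simp: hausdorff_dim_def intro!: INF_greatest)
qed

section \<open>The upper bound\<close>

locale ratio_spectrum = conformal_ifs p a \<omega> s \<gamma> c Rad smin Hc \<rho> E U ctr
  for p :: nat and a :: "nat \<Rightarrow> nat \<Rightarrow> nat"
    and \<omega> :: "nat \<Rightarrow> nat \<Rightarrow> 'e::euclidean_space \<Rightarrow> 'e" and s :: "nat \<Rightarrow> nat \<Rightarrow> 'e \<Rightarrow> real"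
    and \<gamma> c Rad smin Hc \<rho> :: real and E U :: "nat \<Rightarrow> 'e set" and ctr :: "nat \<Rightarrow> 'e" +
  fixes f g :: "'m::finite \<Rightarrow> (nat \<Rightarrow> nat) \<Rightarrow> real" and C :: "(real ^ 'm) set"
  assumes cont_f: "\<And>j. continuous_on X (f j)" and cont_g: "\<And>j. continuous_on X (g j)"
    and g_nonzero: "\<And>j \<mu>. \<mu> \<in> invariants \<Longrightarrow> (\<integral>x. g j x \<partial>\<mu>) \<noteq> 0"
    and closed_C: "closed C"
begin

section \<open>Ratios of ergodic sums and the level set\<close>

abbreviation S\<^sub>n :: "((nat \<Rightarrow> nat) \<Rightarrow> real) \<Rightarrow> nat \<Rightarrow> (nat \<Rightarrow> nat) \<Rightarrow> real" where
  "S\<^sub>n \<equiv> ergodic_sum left_shift"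

definition ratio :: "nat \<Rightarrow> (nat \<Rightarrow> nat) \<Rightarrow> real ^ 'm" where
  "ratio n x = (\<chi> j. S\<^sub>n (f j) n x / S\<^sub>n (g j) n x)"

definition mean_ratio :: "(nat \<Rightarrow> nat) measure \<Rightarrow> real ^ 'm" where
  "mean_ratio \<mu> = (\<chi> i. (\<integral>x. f i x \<partial>\<mu>) / (\<integral>x. g i x \<partial>\<mu>))"

definition level :: "(nat \<Rightarrow> nat) set" where
  "level = {x \<in> X. accumulation_points {n. \<forall>j. S\<^sub>n (g j) n x \<noteq> 0} (\<lambda>n. ratio n x) \<subseteq> C}"

lemma ergodic_sum_bound:
  assumes "\<And>x. x \<in> X \<Longrightarrow> \<bar>\<phi> x\<bar> \<le> K" "x \<in> X"
  shows "\<bar>S\<^sub>n \<phi> n x\<bar> \<le> real n * K"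
proof -
  have "\<bar>S\<^sub>n \<phi> n x\<bar> \<le> (\<Sum>k<n. \<bar>\<phi> ((left_shift ^^ k) x)\<bar>)" unfolding ergodic_sum_def by (rule sum_abs)
  also have "\<dots> \<le> (\<Sum>k<n. K)" using assms shift_funpow_X by (intro sum_mono) auto
  finally show ?thesis by simp
qed

text \<open>Otherwise orbit segments of growing length with averages of \<open>g j\<close> tending
  to \<open>0\<close> would, as empirical measures of single points, accumulate at an invariant
  measure that integrates \<open>g j\<close> to zero.\<close>

lemma denominator_bound1: "\<exists>d>0. \<exists>N. \<forall>n\<ge>N. \<forall>x\<in>X. d * real n \<le> \<bar>S\<^sub>n (g j) n x\<bar>"
proof (rule ccontr)
  assume "\<not> ?thesis"
  then have *: "\<And>d N. 0 < d \<Longrightarrow> \<exists>n\<ge>N. \<exists>x\<in>X. \<bar>S\<^sub>n (g j) n x\<bar> < d * real n" by (meson not_le)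
  have "\<forall>k. \<exists>nx. k < fst nx \<and> snd nx \<in> X \<and> \<bar>S\<^sub>n (g j) (fst nx) (snd nx)\<bar> < 1 / real (Suc k) * real (fst nx)"
  proof
    fix k
    obtain n x where "n \<ge> Suc k" "x \<in> X" "\<bar>S\<^sub>n (g j) n x\<bar> < 1 / real (Suc k) * real n"
      using *[of "1 / real (Suc k)" "Suc k"] by auto
    then show "\<exists>nx. k < fst nx \<and> snd nx \<in> X \<and> \<bar>S\<^sub>n (g j) (fst nx) (snd nx)\<bar> < 1 / real (Suc k) * real (fst nx)"
      by (intro exI[of _ "(n, x)"]) auto
  qed
  from choice[OF this] obtain nx where nx: "\<forall>k. k < fst (nx k) \<and> snd (nx k) \<in> X \<and>
      \<bar>S\<^sub>n (g j) (fst (nx k)) (snd (nx k))\<bar> < 1 / real (Suc k) * real (fst (nx k))" ..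
  define n and x where "n k = fst (nx k)" and "x k = snd (nx k)" for k
  have n: "k < n k" and x: "x k \<in> X" and small: "\<bar>S\<^sub>n (g j) (n k) (x k)\<bar> < 1 / real (Suc k) * real (n k)" for k
    using nx by (simp_all add: n_def x_def)
  obtain r \<mu> where r: "strict_mono (r :: nat \<Rightarrow> nat)" and mu: "\<mu> \<in> invariants"
    and lim: "\<And>\<phi>. continuous_on X \<phi> \<Longrightarrow> (\<lambda>k. (\<Sum>y\<in>{x (r k)}. 1 * S\<^sub>n \<phi> (n (r k)) y) / real (n (r k))) \<longlonglongrightarrow> (\<integral>x. \<phi> x \<partial>\<mu>)"
    by (rule empirical_limit[of n "\<lambda>k. {x k}" "\<lambda>_ _. 1"]) (use n x in auto)
  have "(\<lambda>k. S\<^sub>n (g j) (n (r k)) (x (r k)) / real (n (r k))) \<longlonglongrightarrow> (\<integral>x. g j x \<partial>\<mu>)"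
    using lim[OF cont_g[of j]] by simp
  moreover have "(\<lambda>k. S\<^sub>n (g j) (n (r k)) (x (r k)) / real (n (r k))) \<longlonglongrightarrow> 0"
  proof (rule Lim_null_comparison)
    show "(\<lambda>k. 1 / real (Suc (r k))) \<longlonglongrightarrow> 0"
      using LIMSEQ_subseq_LIMSEQ[OF LIMSEQ_inverse_real_of_nat r] by (simp add: o_def inverse_eq_divide)
    show "eventually (\<lambda>k. norm (S\<^sub>n (g j) (n (r k)) (x (r k)) / real (n (r k))) \<le> 1 / real (Suc (r k))) sequentially"
    proof (rule always_eventually, rule allI)
      fix k
      have "0 < real (n (r k))" using n[of "r k"] by simp
      then show "norm (S\<^sub>n (g j) (n (r k)) (x (r k)) / real (n (r k))) \<le> 1 / real (Suc (r k))"
        using small[of "r k"] by (simp add: field_simps less_imp_le)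
    qed
  qed
  ultimately have "(\<integral>x. g j x \<partial>\<mu>) = 0" by (rule LIMSEQ_unique)
  then show False using g_nonzero[OF mu] by blast
qed

lemma denominator_bound:
  obtains d N0 where "0 < d" "0 < N0" "\<And>n x j. N0 \<le> n \<Longrightarrow> x \<in> X \<Longrightarrow> d * real n \<le> \<bar>S\<^sub>n (g j) n x\<bar>"
proof -
  have "\<forall>j. \<exists>dN. 0 < fst dN \<and> (\<forall>n\<ge>snd dN. \<forall>x\<in>X. fst dN * real n \<le> \<bar>S\<^sub>n (g j) n x\<bar>)"
    using denominator_bound1 by fastforce
  from choice[OF this] obtain dN where dN: "\<forall>j. 0 < fst (dN j) \<and> (\<forall>n\<ge>snd (dN j). \<forall>x\<in>X. fst (dN j) * real n \<le> \<bar>S\<^sub>n (g j) n x\<bar>)" ..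
  define d where "d = Min (range (\<lambda>j. fst (dN j)))"
  define N where "N = Suc (Max (range (\<lambda>j. snd (dN j))))"
  have "0 < d" unfolding d_def using dN by (subst Min_gr_iff) auto
  moreover have "0 < N" by (simp add: N_def)
  moreover have "d * real n \<le> \<bar>S\<^sub>n (g j) n x\<bar>" if "N \<le> n" "x \<in> X" for n x j
  proof -
    have "d \<le> fst (dN j)" unfolding d_def by (rule Min_le) auto
    then have "d * real n \<le> fst (dN j) * real n" by (rule mult_right_mono) simp
    moreover have "snd (dN j) \<le> Max (range (\<lambda>j. snd (dN j)))" by (rule Max_ge) auto
    then have "snd (dN j) \<le> n" using that(1) unfolding N_def by linarith
    then have "fst (dN j) * real n \<le> \<bar>S\<^sub>n (g j) n x\<bar>" using dN that(2) by blast
    ultimately show ?thesis by simp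
  qed
  ultimately show ?thesis by (rule that)
qed

text \<open>From some length on, uniformly in \<open>x\<close>, all ratios are defined and lie in
  one compact cube. This provides accumulation points and finite nets.\<close>

lemma ratio_bounded:
  "\<exists>Q N0. \<forall>n\<ge>N0. \<forall>x\<in>X. ratio n x \<in> cbox (\<chi> j. - Q) (\<chi> j. Q) \<and> (\<forall>j. S\<^sub>n (g j) n x \<noteq> 0)"
proof -
  obtain d N0 where d: "0 < d" "0 < N0" "\<And>n x j. N0 \<le> n \<Longrightarrow> x \<in> X \<Longrightarrow> d * real n \<le> \<bar>S\<^sub>n (g j) n x\<bar>"
    using denominator_bound by blast
  have "\<forall>j. \<exists>K>0. \<forall>x\<in>X. \<bar>f j x\<bar> \<le> K"
  proof
    fix j
    obtain K where "0 < K" "\<And>x. x \<in> X \<Longrightarrow> \<bar>f j x\<bar> \<le> K" using continuous_on_X_bounded[OF cont_f] by blast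
    then show "\<exists>K>0. \<forall>x\<in>X. \<bar>f j x\<bar> \<le> K" by (intro exI[of _ K]) simp
  qed
  from choice[OF this] obtain K where K: "\<forall>j. 0 < K j \<and> (\<forall>x\<in>X. \<bar>f j x\<bar> \<le> K j)" ..
  define Km where "Km = Max (range K)"
  have Km: "K j \<le> Km" for j unfolding Km_def by (rule Max_ge) auto
  show ?thesis
  proof (rule exI[of _ "Km / d"], rule exI[of _ N0], intro allI impI ballI conjI)
    fix n x assume n: "N0 \<le> n" and x: "x \<in> X"
    have n0: "0 < real n" using n d(2) by simp
    show "S\<^sub>n (g j) n x \<noteq> 0" for j
      using d(3)[OF n x, of j] d(1) n0 by (smt (verit) mult_pos_pos)
    have "\<bar>ratio n x $ j\<bar> \<le> Km / d" for j
    proof -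
      have "\<bar>S\<^sub>n (f j) n x\<bar> \<le> real n * K j" using K x by (intro ergodic_sum_bound) auto
      also have "\<dots> \<le> real n * Km" using Km by (intro mult_left_mono) auto
      finally have "\<bar>S\<^sub>n (f j) n x\<bar> / \<bar>S\<^sub>n (g j) n x\<bar> \<le> real n * Km / (d * real n)"
        using d n0 d(3)[OF n x, of j] by (intro frac_le) auto
      then show ?thesis using n0 by (simp add: ratio_def)
    qed
    then show "ratio n x \<in> cbox (\<chi> j. - (Km / d)) (\<chi> j. Km / d)"
      unfolding mem_box_cart by (auto simp: abs_le_iff) (metis minus_le_iff)
  qed
qed

text \<open>Otherwise infinitely many ratios stay at distance \<open>e\<close> from
  \<open>C\<close>; by compactness they have an accumulation point, which lies in \<open>C\<close>
  by assumption. For empty \<open>C\<close> this says that \<open>level\<close> is empty.\<close>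

lemma level_eventually:
  assumes "x \<in> level" and e: "0 < e"
  shows "\<exists>N. \<forall>n\<ge>N. \<exists>v\<in>C. dist (ratio n x) v < e"
proof (rule ccontr)
  assume "\<not> ?thesis"
  then have far: "\<forall>N. \<exists>n\<ge>N. \<forall>v\<in>C. \<not> dist (ratio n x) v < e" by simp
  have x: "x \<in> X" using assms(1) by (simp add: level_def)
  obtain Q N0 where QN: "\<forall>n\<ge>N0. \<forall>x\<in>X. ratio n x \<in> cbox (\<chi> j. - Q) (\<chi> j. Q) \<and> (\<forall>j. S\<^sub>n (g j) n x \<noteq> 0)"
    using ratio_bounded by (elim exE)
  have Q: "ratio n x \<in> cbox (\<chi> j. - Q) (\<chi> j. Q)" and nz: "S\<^sub>n (g j) n x \<noteq> 0"
    if "N0 \<le> n" "x \<in> X" for n x j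
    using QN that by simp_all
  define S where "S = {n. N0 \<le> n \<and> (\<forall>v\<in>C. \<not> dist (ratio n x) v < e)}"
  have "infinite S"
    unfolding infinite_nat_iff_unbounded_le
  proof
    fix m
    from far[THEN spec, of "max m N0"]
    obtain n where "n \<ge> max m N0" "\<forall>v\<in>C. \<not> dist (ratio n x) v < e" by auto
    then show "\<exists>n\<ge>m. n \<in> S" by (auto simp: S_def)
  qed
  then obtain r1 :: "nat \<Rightarrow> nat" where r1: "strict_mono r1" "\<forall>n. r1 n \<in> S" using infinite_enumerate by blast
  have "\<forall>n. ratio (r1 n) x \<in> cbox (\<chi> j. - Q) (\<chi> j. Q)" using r1(2) Q x by (auto simp: S_def)
  then have "\<exists>l\<in>cbox (\<chi> j. - Q) (\<chi> j. Q). \<exists>r. strict_mono (r :: nat \<Rightarrow> nat) \<and> ((\<lambda>n. ratio (r1 n) x) \<circ> r) \<longlonglongrightarrow> l"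
    using compact_cbox[of "(\<chi> j. - Q) :: real ^ 'm" "\<chi> j. Q"] unfolding compact_def
    by (elim allE[of _ "\<lambda>n. ratio (r1 n) x"]) simp
  then obtain l r2 where r2: "strict_mono (r2 :: nat \<Rightarrow> nat)" "((\<lambda>n. ratio (r1 n) x) \<circ> r2) \<longlonglongrightarrow> l"
    by auto
  have "l \<in> accumulation_points {n. \<forall>j. S\<^sub>n (g j) n x \<noteq> 0} (\<lambda>n. ratio n x)"
    unfolding accumulation_points_def
  proof (intro CollectI exI[of _ "r1 \<circ> r2"] conjI)
    show "strict_mono (r1 \<circ> r2)" by (rule strict_mono_o[OF r1(1) r2(1)])
    show "range (r1 \<circ> r2) \<subseteq> {n. \<forall>j. S\<^sub>n (g j) n x \<noteq> 0}" using r1(2) nz x by (auto simp: S_def)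
    show "((\<lambda>n. ratio n x) \<circ> (r1 \<circ> r2)) \<longlonglongrightarrow> l" using r2(2) by (simp add: o_def)
  qed
  then have "l \<in> C" using assms(1) by (auto simp: level_def)
  moreover have "eventually (\<lambda>n. dist (ratio (r1 (r2 n)) x) l < e) sequentially"
    using tendstoD[OF r2(2) e] by (simp add: o_def)
  then obtain n where "dist (ratio (r1 (r2 n)) x) l < e" by (meson eventually_sequentially order_refl)
  ultimately show False using r1(2) by (auto simp: S_def)
qed

lemma level_if_convergent:
  assumes "x \<in> X" "(\<lambda>n. ratio n x) \<longlonglongrightarrow> l" "l \<in> C"
  shows "x \<in> level"
proof -
  have "l' = l" if "strict_mono r" "((\<lambda>n. ratio n x) \<circ> r) \<longlonglongrightarrow> l'" for r l'
    using LIMSEQ_unique[OF that(2) LIMSEQ_subseq_LIMSEQ[OF assms(2) that(1)]] .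
  then show ?thesis using assms unfolding level_def accumulation_points_def by blast
qed

text \<open>By contraposition: arbitrarily small sums at arbitrarily large lengths are covers by
  cylinder images of small diameter with small \<open>t\<close>-sums, so that the measure would
  vanish.\<close>

lemma partition_sum_lower_bound:
  assumes t: "0 \<le> t" and A: "A \<subseteq> X" and pos: "hausdorff_measure t (\<pi> ` A) \<noteq> 0"
  obtains c0 n1 where "0 < c0" "\<And>n R. n1 \<le> n \<Longrightarrow> finite R \<Longrightarrow> R \<subseteq> A \<Longrightarrow> initial n ` R = initial n ` A \<Longrightarrow>
      c0 \<le> (\<Sum>x\<in>R. exp (- t * \<Lambda> n x))"
proof (rule ccontr)
  note choose = that
  assume neg: "\<not> thesis"
  have *: "\<exists>n R. n1 \<le> n \<and> finite R \<and> R \<subseteq> A \<and> initial n ` R = initial n ` A \<and> (\<Sum>x\<in>R. exp (- t * \<Lambda> n x)) < c0"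
    if c0: "0 < c0" for c0 n1
  proof (rule ccontr)
    assume no: "\<not> ?thesis"
    have "c0 \<le> (\<Sum>x\<in>R. exp (- t * \<Lambda> n x))"
      if "n1 \<le> n" "finite R" "R \<subseteq> A" "initial n ` R = initial n ` A" for n R
    proof (rule ccontr)
      assume "\<not> ?thesis"
      then have "(\<Sum>x\<in>R. exp (- t * \<Lambda> n x)) < c0" by simp
      with no that show False by blast
    qed
    from choose[OF c0 this] neg show False by blast
  qed
  have "hausdorff_measure t (\<pi> ` A) = 0"
  proof (rule hausdorff_null_finite_covers[OF _ t])
    fix \<delta> e :: real assume d: "0 < \<delta>" and e: "0 < e"
    \<comment> \<open>Two points of a piece are compared through its representative, whence the
      factor 2.\<close>
    define D0 where "D0 = 2 * diamC"
    have D0: "0 < D0" using diamC_pos by (simp add: D0_def)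
    have "(\<lambda>n. D0 * c ^ n) \<longlonglongrightarrow> D0 * 0"
      using c by (intro tendsto_mult LIMSEQ_power_zero tendsto_const) auto
    then have "eventually (\<lambda>n. D0 * c ^ n < \<delta>) sequentially"
      using d by (intro order_tendstoD) auto
    then obtain n1 where n1: "\<And>n. n1 \<le> n \<Longrightarrow> D0 * c ^ n < \<delta>" by (auto simp: eventually_sequentially)
    obtain n R where n: "n1 \<le> n" and R: "finite R" "R \<subseteq> A" "initial n ` R = initial n ` A"
      and small: "(\<Sum>x\<in>R. exp (- t * \<Lambda> n x)) < e / D0 powr t"
      using *[of "e / D0 powr t" n1] e D0 by auto
    define V where "V x = \<pi> ` {y \<in> A. initial n x = initial n y}" for x
    define D where "D x = D0 * exp (- \<Lambda> n x)" for x
    have cov: "\<pi> ` A \<subseteq> (\<Union>x\<in>R. V x)"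
    proof
      fix v assume "v \<in> \<pi> ` A"
      then obtain y where y: "y \<in> A" "v = \<pi> y" by blast
      then have "initial n y \<in> initial n ` R" using R(3) by blast
      then obtain x where "x \<in> R" "initial n y = initial n x" by blast
      then have "v \<in> V x" unfolding V_def using y by (intro image_eqI[of _ _ y]) auto
      then show "v \<in> (\<Union>x\<in>R. V x)" using \<open>x \<in> R\<close> by blast
    qed
    have piece: "0 < D x \<and> D x \<le> \<delta> \<and> (\<forall>y\<in>V x. \<forall>z\<in>V x. dist y z \<le> D x)" if "x \<in> R" for x
    proof (intro conjI ballI)
      have x: "x \<in> X" using that R(2) A by blast
      show "0 < D x" using D0 by (simp add: D_def)
      have "exp (- \<Lambda> n x) \<le> exp (real n * ln c)" using Lambda_ge[OF x, of n] by simp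
      also have "\<dots> = c ^ n" using c by (simp add: exp_of_nat_mult)
      finally have "D x \<le> D0 * c ^ n" using D0 by (simp add: D_def)
      then show "D x \<le> \<delta>" using n1[OF n] by simp
      fix v w assume "v \<in> V x" "w \<in> V x"
      then obtain y z where y: "y \<in> A" "initial n x = initial n y" "v = \<pi> y"
        and z: "z \<in> A" "initial n x = initial n z" "w = \<pi> z"
        unfolding V_def by blast
      have "dist v (\<pi> x) \<le> diamC * exp (- \<Lambda> n x)" "dist (\<pi> x) w \<le> diamC * exp (- \<Lambda> n x)"
        using coding_map_cylinder_diam[OF x subsetD[OF A y(1)] y(2)]
          coding_map_cylinder_diam[OF x subsetD[OF A z(1)] z(2)] y(3) z(3) by (simp_all add: dist_commute)
      then show "dist v w \<le> D x" using dist_triangle[of v w "\<pi> x"] by (simp add: D_def D0_def)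
    qed
    have sm: "(\<Sum>x\<in>R. D x powr t) < e"
    proof -
      have "(\<Sum>x\<in>R. D x powr t) = D0 powr t * (\<Sum>x\<in>R. exp (- t * \<Lambda> n x))"
        using D0 by (simp add: D_def powr_mult sum_distrib_left exp_powr_real mult.commute)
      also have "\<dots> < e" using small D0 by (simp add: field_simps)
      finally show ?thesis .
    qed
    show "\<exists>R (V :: (nat \<Rightarrow> nat) \<Rightarrow> 'e set) D. finite R \<and> \<pi> ` A \<subseteq> (\<Union>x\<in>R. V x) \<and>
      (\<forall>x\<in>R. 0 < D x \<and> D x \<le> \<delta> \<and> (\<forall>y\<in>V x. \<forall>z\<in>V x. dist y z \<le> D x)) \<and> (\<Sum>x\<in>R. D x powr t) < e"
      by (rule exI[of _ R], rule exI[of _ V], rule exI[of _ D], intro conjI R(1) cov sm ballI)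
         (use piece in simp_all)
  qed
  then show False using pos by simp
qed

end

section \<open>From partition sums to an invariant measure\<close>

context ratio_spectrum
begin

text \<open>Restricting the words to those whose ratio is close to a single \<open>v\<close>, which is close to \<open>C\<close>, costs
  only a constant factor of the partition sum and forces the ratio of the limit measure into \<open>C\<close>.\<close>

theorem spectrum_upper:
  assumes t: "0 \<le> t" and pos: "hausdorff_measure t (\<pi> ` level) \<noteq> 0"
  obtains \<mu> h where "\<mu> \<in> invariants" "mean_ratio \<mu> \<in> C" "metric_entropy left_shift \<mu> = ereal h"
    "t * (\<integral>x. \<psi> x \<partial>\<mu>) \<le> h"
proof -
  obtain Q N0 where QN: "\<forall>n\<ge>N0. \<forall>x\<in>X. ratio n x \<in> cbox (\<chi> j. - Q) (\<chi> j. Q) \<and> (\<forall>j. S\<^sub>n (g j) n x \<noteq> 0)"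
    using ratio_bounded by (elim exE)
  have Q: "ratio n x \<in> cbox (\<chi> j. - Q) (\<chi> j. Q)" and nz: "S\<^sub>n (g j) n x \<noteq> 0"
    if "N0 \<le> n" "x \<in> X" for n x j
    using QN that by simp_all
  \<comment> \<open>Everything wanted at stage \<open>k\<close> is bundled for one application of
    choice. All tolerances are tied to \<open>1 / (k + 1)\<close> and vanish in the limit.\<close>
  define good where "good k nRv \<longleftrightarrow> (case nRv of (n, R, v) \<Rightarrow> k < n \<and> N0 \<le> n \<and> finite R \<and> R \<subseteq> X \<and> inj_on (initial n) R \<and>
      exp (- real n / real (Suc k)) \<le> (\<Sum>x\<in>R. exp (- t * \<Lambda> n x)) \<and>
      (\<forall>x\<in>R. dist (ratio n x) v < 1 / real (Suc k)) \<and> (\<exists>u\<in>C. dist v u < 2 / real (Suc k)))" for k nRv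
  have "\<exists>nRv. good k nRv" for k
  proof -
    define e where "e = 1 / real (Suc k)"
    have e: "0 < e" by (simp add: e_def)
    \<comment> \<open>The time from which ratios are close to \<open>C\<close> depends on the point.
      Countable subadditivity singles out one \<open>N\<close> for which the points with this time
      at most \<open>N\<close> still have an image of nonzero measure.\<close>
    define A where "A N = {x \<in> X. \<forall>n\<ge>N. \<exists>v\<in>C. dist (ratio n x) v < e}" for N
    have "level \<subseteq> (\<Union>N. A N)"
      using level_eventually[OF _ e] by (auto simp: A_def level_def)
    then have "\<pi> ` level \<subseteq> (\<Union>N. \<pi> ` A N)" by blast
    then have "hausdorff_measure t (\<Union>N. \<pi> ` A N) \<noteq> 0" using pos hausdorff_null_mono by blast
    then have "\<not> (\<forall>N. hausdorff_measure t (\<pi> ` A N) = 0)"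
      using hausdorff_null_UN[of t "\<lambda>N. \<pi> ` A N"] by auto
    then obtain N where N: "hausdorff_measure t (\<pi> ` A N) \<noteq> 0" by auto
    have AX: "A N \<subseteq> X" by (auto simp: A_def)
    obtain c0 n1 where c0: "0 < c0" and n1: "\<And>n R. n1 \<le> n \<Longrightarrow> finite R \<Longrightarrow> R \<subseteq> A N \<Longrightarrow> initial n ` R = initial n ` A N \<Longrightarrow>
      c0 \<le> (\<Sum>x\<in>R. exp (- t * \<Lambda> n x))"
      using partition_sum_lower_bound[OF t AX N] by blast
    define Bx :: "(real ^ 'm) set" where "Bx = cbox (\<chi> j. - Q) (\<chi> j. Q)"
    obtain T where T: "T \<subseteq> Bx" "finite T" "Bx \<subseteq> (\<Union>v\<in>T. ball v e)"
    proof (rule compactE_image[of Bx Bx "\<lambda>v. ball v e"])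
      show "compact Bx" unfolding Bx_def by (rule compact_cbox)
      show "Bx \<subseteq> (\<Union>v\<in>Bx. ball v e)" using e by auto
    qed auto
    \<comment> \<open>Lengths beyond \<open>n2\<close> make \<open>exp (- n / (k + 1))\<close>
      smaller than the share of the partition sum left by the pigeonhole step.\<close>
    obtain n2 :: nat where n2: "real (Suc k) * (- ln (c0 / (real (card T) + 1))) \<le> real n2"
      using real_arch_simple by blast
    define n where "n = Max {Suc k, N0, N, n1, n2}"
    have n: "Suc k \<le> n" "N0 \<le> n" "N \<le> n" "n1 \<le> n" "n2 \<le> n" by (auto simp: n_def)
    obtain R where R: "R \<subseteq> A N" "inj_on (initial n) R" "initial n ` A N = initial n ` R"
      using subset_image_inj[of "initial n ` A N" "initial n" "A N"] by blast
    have "initial n ` R \<subseteq> words n" using R(1) AX initial_words by blast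
    then have "finite (initial n ` R)" using finite_words by (rule finite_subset)
    then have finR: "finite R" using R(2) finite_imageD by blast
    define Rv where "Rv v = {x \<in> R. dist (ratio n x) v < e}" for v
    define w where "w x = exp (- t * \<Lambda> n x)" for x
    have w0: "0 \<le> w x" for x by (simp add: w_def)
    have "sum w R \<le> (\<Sum>x\<in>R. \<Sum>v\<in>T. if x \<in> Rv v then w x else 0)"
    proof (rule sum_mono)
      fix x assume x: "x \<in> R"
      then have "x \<in> X" using R(1) AX by blast
      then have "ratio n x \<in> Bx" unfolding Bx_def by (rule Q[OF n(2)])
      then obtain v where v: "v \<in> T" "ratio n x \<in> ball v e" using T(3) by blast
      then have "(if x \<in> Rv v then w x else 0) = w x" using x by (simp add: Rv_def dist_commute)
      then show "w x \<le> (\<Sum>v\<in>T. if x \<in> Rv v then w x else 0)"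
        using member_le_sum[OF v(1) _ T(2), of "\<lambda>v. if x \<in> Rv v then w x else 0"] w0 by auto
    qed
    also have "\<dots> = (\<Sum>v\<in>T. sum w (Rv v))"
    proof -
      have "(\<Sum>x\<in>R. if x \<in> Rv v then w x else 0) = sum w (Rv v)" for v
        by (rule sum.mono_neutral_cong_right) (use finR in \<open>auto simp: Rv_def\<close>)
      then show ?thesis by (subst sum.swap) simp
    qed
    finally have sumT: "c0 \<le> (\<Sum>v\<in>T. sum w (Rv v))"
      using n1[OF n(4) finR R(1) R(3)[symmetric]] by (simp add: w_def)
    \<comment> \<open>Pigeonhole over the finite net \<open>T\<close>; the denominator
      \<open>card T + 1\<close> makes the contradiction strict.\<close>
    have "\<exists>v\<in>T. c0 / (real (card T) + 1) \<le> sum w (Rv v)"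
    proof (rule ccontr)
      assume "\<not> ?thesis"
      then have "(\<Sum>v\<in>T. sum w (Rv v)) \<le> (\<Sum>v\<in>T. c0 / (real (card T) + 1))" by (intro sum_mono) (meson not_le less_imp_le)
      also have "\<dots> < c0" using c0 by (simp add: field_simps)
      finally show False using sumT by simp
    qed
    then obtain v where v: "v \<in> T" "c0 / (real (card T) + 1) \<le> sum w (Rv v)" by blast
    have "0 < c0 / (real (card T) + 1)" using c0 by (simp add: add_nonneg_pos)
    moreover have "- real n / real (Suc k) \<le> ln (c0 / (real (card T) + 1))"
    proof -
      have "real (Suc k) * (- ln (c0 / (real (card T) + 1))) \<le> real n" using n2 n(5) by linarith
      then have "- ln (c0 / (real (card T) + 1)) \<le> real n / real (Suc k)" by (subst pos_le_divide_eq) (auto simp: mult.commute)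
      then show ?thesis by simp
    qed
    ultimately have ex: "exp (- real n / real (Suc k)) \<le> c0 / (real (card T) + 1)"
      by (simp add: ln_ge_iff)
    have "Rv v \<noteq> {}"
    proof
      assume "Rv v = {}"
      then show False using v(2) \<open>0 < c0 / (real (card T) + 1)\<close> by simp
    qed
    then obtain x where x: "x \<in> R" "dist (ratio n x) v < e" by (auto simp: Rv_def)
    then obtain u where u: "u \<in> C" "dist (ratio n x) u < e" using R(1) n(3) by (auto simp: A_def)
    have "dist v u < 2 * e" using x(2) u(2) dist_triangle3[of v u "ratio n x"] by simp
    then have "good k (n, Rv v, v)"
      using n finR R AX v ex u(1) by (auto simp: good_def Rv_def w_def e_def intro: inj_on_subset)
    then show ?thesis by blast
  qed
  then have "\<forall>k. \<exists>nRv. good k nRv" by blast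
  from choice[OF this] obtain nRv where nRv: "\<forall>k. good k (nRv k)" ..
  define n R v where "n k = fst (nRv k)" and "R k = fst (snd (nRv k))" and "v k = snd (snd (nRv k))" for k
  have n: "k < n k" "N0 \<le> n k" and R: "finite (R k)" "R k \<subseteq> X" "inj_on (initial (n k)) (R k)"
    and Z_ge: "exp (- real (n k) / real (Suc k)) \<le> (\<Sum>x\<in>R k. exp (- t * \<Lambda> (n k) x))"
    and rat: "\<And>x. x \<in> R k \<Longrightarrow> dist (ratio (n k) x) (v k) < 1 / real (Suc k)"
    and vC: "\<exists>u\<in>C. dist (v k) u < 2 / real (Suc k)" for k
    using nRv[rule_format, of k] by (auto simp: good_def n_def R_def v_def split: prod.splits)
  define Z where "Z k = (\<Sum>x\<in>R k. exp (- t * \<Lambda> (n k) x))" for k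
  \<comment> \<open>Gibbs weights. Their entropy is \<open>t\<close> times the mean of
    \<open>\<Lambda>\<close> plus \<open>ln (Z k)\<close>, and the latter is at least
    \<open>- n k / (k + 1)\<close>, hence negligible below after division by
    \<open>n k\<close>.\<close>
  define q where "q k x = exp (- t * \<Lambda> (n k) x) / Z k" for k x
  have Z0: "0 < Z k" for k using Z_ge[of k] less_le_trans[OF exp_gt_zero] by (simp add: Z_def)
  have q0: "0 \<le> q k x" for k x using Z0[of k] by (simp add: q_def)
  have q1: "sum (q k) (R k) = 1" for k
    unfolding q_def sum_divide_distrib[symmetric] Z_def[symmetric] using Z0[of k] by simp
  obtain r \<mu> h where r: "strict_mono (r :: nat \<Rightarrow> nat)" and mu: "\<mu> \<in> invariants"
    and lim: "\<And>\<phi>. continuous_on X \<phi> \<Longrightarrow> (\<lambda>k. (\<Sum>x\<in>R (r k). q (r k) x * S\<^sub>n \<phi> (n (r k)) x) / real (n (r k))) \<longlonglongrightarrow> (\<integral>x. \<phi> x \<partial>\<mu>)"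
    and h: "metric_entropy left_shift \<mu> = ereal h"
    and h_ge: "\<And>L l. L \<longlonglongrightarrow> l \<Longrightarrow>
       (\<And>k. L k \<le> - (\<Sum>x\<in>R (r k). q (r k) x * ln (q (r k) x)) / real (n (r k))) \<Longrightarrow> l \<le> h"
    by (rule empirical_limit[of n R q, OF n(1) R q0 q1]) blast
  have inv_r: "(\<lambda>k. b / real (Suc (r k))) \<longlonglongrightarrow> 0" for b :: real
    using tendsto_mult_right_zero[OF LIMSEQ_subseq_LIMSEQ[OF LIMSEQ_inverse_real_of_nat r], of b] by (simp add: o_def divide_inverse)
  have n0: "0 < real (n k)" for k using n(1)[of k] by simp
  have entropy: "t * (\<integral>x. \<psi> x \<partial>\<mu>) \<le> h"
  proof (rule h_ge)
    show "(\<lambda>k. t * ((\<Sum>x\<in>R (r k). q (r k) x * \<Lambda> (n (r k)) x) / real (n (r k))) - 1 / real (Suc (r k)))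
        \<longlonglongrightarrow> t * (\<integral>x. \<psi> x \<partial>\<mu>)"
      using tendsto_diff[OF tendsto_mult[OF tendsto_const lim[OF continuous_on_psi]] inv_r[of 1]] by simp
    fix k
    let ?k = "r k"
    have "(\<Sum>x\<in>R ?k. q ?k x * ln (q ?k x)) = (\<Sum>x\<in>R ?k. q ?k x * (- t * \<Lambda> (n ?k) x)) - (\<Sum>x\<in>R ?k. q ?k x) * ln (Z ?k)"
      unfolding sum_distrib_right sum_subtractf[symmetric] using Z0[of ?k]
      by (intro sum.cong refl) (simp add: q_def ln_div right_diff_distrib)
    also have "(\<Sum>x\<in>R ?k. q ?k x * (- t * \<Lambda> (n ?k) x)) = - t * (\<Sum>x\<in>R ?k. q ?k x * \<Lambda> (n ?k) x)"
      by (simp add: sum_distrib_left mult_ac sum_negf)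
    finally have ent: "- (\<Sum>x\<in>R ?k. q ?k x * ln (q ?k x)) = t * (\<Sum>x\<in>R ?k. q ?k x * \<Lambda> (n ?k) x) + ln (Z ?k)"
      by (simp add: q1)
    have "- real (n ?k) / real (Suc ?k) \<le> ln (Z ?k)"
      using Z_ge[of ?k] Z0[of ?k] by (simp add: ln_ge_iff Z_def)
    then have "(- real (n ?k) / real (Suc ?k)) / real (n ?k) \<le> ln (Z ?k) / real (n ?k)"
      by (rule divide_right_mono) simp
    then have "- (1 / real (Suc ?k)) \<le> ln (Z ?k) / real (n ?k)" using n0[of ?k] by simp
    then show "t * ((\<Sum>x\<in>R ?k. q ?k x * \<Lambda> (n ?k) x) / real (n ?k)) - 1 / real (Suc ?k)
        \<le> - (\<Sum>x\<in>R ?k. q ?k x * ln (q ?k x)) / real (n ?k)"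
      unfolding ent by (simp add: add_divide_distrib)
  qed
  have v_lim: "(\<lambda>k. v (r k)) \<longlonglongrightarrow> mean_ratio \<mu>"
  proof (rule vec_tendstoI)
    fix j
    define F where "F k = (\<Sum>x\<in>R (r k). q (r k) x * S\<^sub>n (f j) (n (r k)) x) / real (n (r k))" for k
    define G where "G k = (\<Sum>x\<in>R (r k). q (r k) x * S\<^sub>n (g j) (n (r k)) x) / real (n (r k))" for k
    have F: "F \<longlonglongrightarrow> (\<integral>x. f j x \<partial>\<mu>)" unfolding F_def[abs_def] by (rule lim[OF cont_f])
    have G: "G \<longlonglongrightarrow> (\<integral>x. g j x \<partial>\<mu>)" unfolding G_def[abs_def] by (rule lim[OF cont_g])
    obtain Kg where Kg: "0 < Kg" "\<And>x. x \<in> X \<Longrightarrow> \<bar>g j x\<bar> \<le> Kg" using continuous_on_X_bounded[OF cont_g] by blast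
    \<comment> \<open>The relation is kept in product form: a mean of ratios is not the ratio of the
      means, but the difference of \<open>v\<close> times the denominator and the numerator is
      linear.\<close>
    have close: "\<bar>v (r k) $ j * G k - F k\<bar> \<le> Kg / real (Suc (r k))" for k
    proof -
      let ?k = "r k" and ?n = "n (r k)"
      have "\<bar>v ?k $ j * S\<^sub>n (g j) ?n x - S\<^sub>n (f j) ?n x\<bar> \<le> 1 / real (Suc ?k) * (real ?n * Kg)" if x: "x \<in> R ?k" for x
      proof -
        have xX: "x \<in> X" using x R(2) by blast
        have "S\<^sub>n (f j) ?n x = ratio ?n x $ j * S\<^sub>n (g j) ?n x" using nz[OF n(2) xX] by (simp add: ratio_def)
        then have eq: "\<bar>v ?k $ j * S\<^sub>n (g j) ?n x - S\<^sub>n (f j) ?n x\<bar> = \<bar>(ratio ?n x - v ?k) $ j\<bar> * \<bar>S\<^sub>n (g j) ?n x\<bar>"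
          by (simp add: abs_mult[symmetric] left_diff_distrib abs_minus_commute)
        have "\<bar>S\<^sub>n (g j) ?n x\<bar> \<le> real ?n * Kg" by (rule ergodic_sum_bound[OF _ xX]) (rule Kg(2))
        then have "\<bar>(ratio ?n x - v ?k) $ j\<bar> * \<bar>S\<^sub>n (g j) ?n x\<bar> \<le> 1 / real (Suc ?k) * (real ?n * Kg)"
          using rat[OF x] component_le_norm_cart[of "ratio ?n x - v ?k" j]
          by (intro mult_mono) (auto simp: dist_norm)
        then show ?thesis unfolding eq .
      qed
      then have "\<bar>q ?k x * (v ?k $ j * S\<^sub>n (g j) ?n x - S\<^sub>n (f j) ?n x)\<bar> \<le> q ?k x * (1 / real (Suc ?k) * (real ?n * Kg))"
        if "x \<in> R ?k" for x
        unfolding abs_mult abs_of_nonneg[OF q0] using that q0 by (intro mult_left_mono)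
      then have "\<bar>\<Sum>x\<in>R ?k. q ?k x * (v ?k $ j * S\<^sub>n (g j) ?n x - S\<^sub>n (f j) ?n x)\<bar> \<le> (\<Sum>x\<in>R ?k. q ?k x * (1 / real (Suc ?k) * (real ?n * Kg)))"
        by (intro order_trans[OF sum_abs sum_mono])
      also have "\<dots> = 1 / real (Suc ?k) * (real ?n * Kg)" unfolding sum_distrib_right[symmetric] q1 by simp
      finally have "\<bar>\<Sum>x\<in>R ?k. q ?k x * (v ?k $ j * S\<^sub>n (g j) ?n x - S\<^sub>n (f j) ?n x)\<bar> / real ?n \<le> 1 / real (Suc ?k) * (real ?n * Kg) / real ?n"
        by (rule divide_right_mono) simp
      moreover have "v ?k $ j * G k - F k = (\<Sum>x\<in>R ?k. q ?k x * (v ?k $ j * S\<^sub>n (g j) ?n x - S\<^sub>n (f j) ?n x)) / real ?n"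
        by (simp add: F_def G_def diff_divide_distrib[symmetric] sum_subtractf[symmetric] sum_distrib_left right_diff_distrib mult_ac)
      ultimately show ?thesis using n0[of ?k] by simp
    qed
    have "(\<lambda>k. v (r k) $ j * G k - F k) \<longlonglongrightarrow> 0"
      by (rule Lim_null_comparison[OF always_eventually inv_r[of Kg]]) (use close in auto)
    from tendsto_add[OF this F] have "(\<lambda>k. v (r k) $ j * G k) \<longlonglongrightarrow> (\<integral>x. f j x \<partial>\<mu>)" by simp
    from tendsto_divide[OF this G g_nonzero[OF mu]]
    have "(\<lambda>k. v (r k) $ j * G k / G k) \<longlonglongrightarrow> mean_ratio \<mu> $ j" by (simp add: mean_ratio_def)
    moreover have "eventually (\<lambda>k. v (r k) $ j * G k / G k = v (r k) $ j) sequentially"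
      using tendsto_imp_eventually_ne[OF G g_nonzero[OF mu]] by eventually_elim simp
    ultimately show "(\<lambda>k. v (r k) $ j) \<longlonglongrightarrow> mean_ratio \<mu> $ j" by (rule Lim_transform_eventually)
  qed
  have "mean_ratio \<mu> \<in> C"
  proof -
    have "\<forall>k. \<exists>u. u \<in> C \<and> dist (v (r k)) u < 2 / real (Suc (r k))" using vC by blast
    from choice[OF this] obtain u where u: "\<forall>k. u k \<in> C \<and> dist (v (r k)) (u k) < 2 / real (Suc (r k))" ..
    have "(\<lambda>k. u k - v (r k)) \<longlonglongrightarrow> 0"
      by (rule Lim_null_comparison[OF always_eventually inv_r[of 2]])
         (use u in \<open>auto simp: dist_norm norm_minus_commute less_imp_le\<close>)
    from tendsto_add[OF this v_lim] have "u \<longlonglongrightarrow> mean_ratio \<mu>" by simp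
    then show ?thesis using u closed_C closed_sequentially by blast
  qed
  then show ?thesis by (rule that[OF mu _ h entropy])
qed

end

section \<open>The lower bound\<close>

subsection \<open>A weighted law of large numbers\<close>

context
  fixes \<mu> :: "'a measure"
  assumes mu: "prob_space \<mu>"
begin

interpretation P: product_prob_space "\<lambda>_. \<mu>" "UNIV :: nat set"
  using mu by (simp add: product_prob_space_def product_prob_space_axioms_def product_sigma_finite_def
      prob_space_imp_sigma_finite)

lemma indep_vars_coordinates:
  "prob_space.indep_vars (Pi\<^sub>M UNIV (\<lambda>_::nat. \<mu>)) (\<lambda>_. \<mu>) (\<lambda>i \<omega>. \<omega> i) UNIV"
proof (subst P.P.indep_vars_iff_distr_eq_PiM')
  have "distr (Pi\<^sub>M UNIV (\<lambda>_. \<mu>)) (Pi\<^sub>M UNIV (\<lambda>_. \<mu>)) (\<lambda>x. \<lambda>i\<in>UNIV. x i) = Pi\<^sub>M UNIV (\<lambda>_::nat. \<mu>)"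
    by (simp add: restrict_UNIV distr_id2)
  moreover have "distr (Pi\<^sub>M UNIV (\<lambda>_::nat. \<mu>)) \<mu> (\<lambda>\<omega>. \<omega> i) = \<mu>" for i
    using distr_PiM_component[of UNIV "\<lambda>_. \<mu>" i] mu by simp
  ultimately show "distr (Pi\<^sub>M UNIV (\<lambda>_. \<mu>)) (Pi\<^sub>M UNIV (\<lambda>_. \<mu>)) (\<lambda>x. \<lambda>i\<in>UNIV. x i) =
      Pi\<^sub>M UNIV (\<lambda>i::nat. distr (Pi\<^sub>M UNIV (\<lambda>_. \<mu>)) \<mu> (\<lambda>\<omega>. \<omega> i))"
    by simp
qed auto

text \<open>The \<open>k\<close>-th variable ranges over an interval of length
  \<open>2 * K * (k + 1)\<close>, so the squared lengths sum to at most
  \<open>4 * K^2 * m^3\<close>. Hoeffding's inequality for deviations \<open>e * m^2\<close> then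
  gives \<open>2 * exp (- e^2 * m / (2 * K^2))\<close>, which is summable, and Borel-Cantelli
  applies.\<close>

lemma weighted_slln:
  fixes Z :: "nat \<Rightarrow> 'a \<Rightarrow> real"
  assumes Z: "\<And>k. Z k \<in> borel_measurable \<mu>" and K: "0 < K"
    and bound: "\<And>k y. y \<in> space \<mu> \<Longrightarrow> \<bar>Z k y\<bar> \<le> K * real (Suc k)"
  shows "AE \<omega> in Pi\<^sub>M UNIV (\<lambda>_::nat. \<mu>). (\<lambda>m. ((\<Sum>k<m. Z k (\<omega> k)) - (\<Sum>k<m. \<integral>y. Z k y \<partial>\<mu>)) / (real m)\<^sup>2) \<longlonglongrightarrow> 0"
proof -
  let ?P = "Pi\<^sub>M UNIV (\<lambda>_::nat. \<mu>)"
  define W where "W k \<omega> = Z k (\<omega> k)" for k \<omega>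
  have W_meas [measurable]: "W k \<in> borel_measurable ?P" for k
    unfolding W_def by (rule measurable_compose[OF _ Z]) simp
  have expW: "P.P.expectation (W k) = (\<integral>y. Z k y \<partial>\<mu>)" for k
  proof -
    have "(\<integral>y. Z k y \<partial>distr ?P \<mu> (\<lambda>\<omega>. \<omega> k)) = P.P.expectation (W k)"
      unfolding W_def by (rule integral_distr) (auto intro: Z)
    then show ?thesis using distr_PiM_component[of UNIV "\<lambda>_. \<mu>" k] mu by simp
  qed
  have indep: "P.P.indep_vars (\<lambda>_. borel) W I" for I
  proof (rule P.P.indep_vars_subset)
    show "P.P.indep_vars (\<lambda>_. borel) W UNIV"
      unfolding W_def by (rule P.P.indep_vars_compose2[OF indep_vars_coordinates Z])
  qed simp
  have dev: "P.P.prob {\<omega> \<in> space ?P. \<bar>(\<Sum>k<m. W k \<omega>) - (\<Sum>k<m. \<integral>y. Z k y \<partial>\<mu>)\<bar> \<ge> e * (real m)\<^sup>2}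
      \<le> 2 * exp (- (e\<^sup>2 / (2 * K\<^sup>2))) ^ m" if e: "0 < e" and m: "0 < m" for e m
  proof -
    interpret Hoeffding_ineq ?P "{..<m}" W "\<lambda>k. - (K * real (Suc k))" "\<lambda>k. K * real (Suc k)" "\<Sum>k<m. P.P.expectation (W k)"
    proof unfold_locales
      fix k
      have "\<omega> k \<in> space \<mu>" if "\<omega> \<in> space ?P" for \<omega> using that by (auto simp: space_PiM PiE_def)
      then have "\<bar>W k \<omega>\<bar> \<le> K * real (Suc k)" if "\<omega> \<in> space ?P" for \<omega>
        using bound that unfolding W_def by blast
      then show "AE \<omega> in ?P. W k \<omega> \<in> {- (K * real (Suc k))..K * real (Suc k)}"
        by (intro AE_I2) (smt (verit) atLeastAtMost_iff)
    qed (auto intro: indep)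
    define d where "d = (\<Sum>k<m. (K * real (Suc k) - - (K * real (Suc k)))\<^sup>2)"
    have d0: "0 < d" unfolding d_def using m K by (intro sum_pos) auto
    have "d \<le> (\<Sum>k<m. (2 * K * real m)\<^sup>2)"
      unfolding d_def using K by (intro sum_mono power_mono) (auto intro!: mult_left_mono)
    also have "\<dots> = 4 * K\<^sup>2 * real m ^ 3" by (simp add: power2_eq_square power3_eq_cube)
    finally have d: "d \<le> 4 * K\<^sup>2 * real m ^ 3" .
    have "P.P.prob {\<omega> \<in> space ?P. \<bar>(\<Sum>k<m. W k \<omega>) - (\<Sum>k<m. P.P.expectation (W k))\<bar> \<ge> e * (real m)\<^sup>2}
        \<le> 2 * exp (- 2 * (e * (real m)\<^sup>2)\<^sup>2 / d)"
      unfolding d_def using d0 e by (intro Hoeffding_ineq_abs_ge) (auto simp: d_def)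
    also have "\<dots> \<le> 2 * exp (- (e\<^sup>2 / (2 * K\<^sup>2)) * real m)"
    proof -
      have "e\<^sup>2 / (2 * K\<^sup>2) * real m * d \<le> e\<^sup>2 / (2 * K\<^sup>2) * real m * (4 * K\<^sup>2 * real m ^ 3)"
        using d K by (intro mult_left_mono) auto
      also have "\<dots> = 2 * (e * (real m)\<^sup>2)\<^sup>2"
        using K by (simp add: field_simps power2_eq_square power3_eq_cube)
      finally have "e\<^sup>2 / (2 * K\<^sup>2) * real m \<le> 2 * (e * (real m)\<^sup>2)\<^sup>2 / d"
        using d0 by (subst pos_le_divide_eq) auto
      then show ?thesis by simp
    qed
    also have "exp (- (e\<^sup>2 / (2 * K\<^sup>2)) * real m) = exp (- (e\<^sup>2 / (2 * K\<^sup>2))) ^ m"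
      by (simp add: exp_of_nat2_mult[symmetric])
    finally show ?thesis by (simp add: expW)
  qed
  have ev: "AE \<omega> in ?P. eventually (\<lambda>m. \<bar>(\<Sum>k<m. W k \<omega>) - (\<Sum>k<m. \<integral>y. Z k y \<partial>\<mu>)\<bar> < e * (real m)\<^sup>2) sequentially"
    if e: "0 < e" for e
  proof -
    define A where "A m = {\<omega> \<in> space ?P. \<bar>(\<Sum>k<m. W k \<omega>) - (\<Sum>k<m. \<integral>y. Z k y \<partial>\<mu>)\<bar> \<ge> e * (real m)\<^sup>2}" for m
    have "AE \<omega> in ?P. eventually (\<lambda>m. \<omega> \<in> space ?P - A m) sequentially"
    proof (rule borel_cantelli_AE1)
      show "A m \<in> P.P.events" for m unfolding A_def by measurable
      show "emeasure ?P (A m) < \<infinity>" for m by (simp add: P.P.emeasure_eq_measure)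
      show "summable (\<lambda>m. P.P.prob (A m))"
      proof (rule summable_comparison_test'[where N = 1])
        show "summable (\<lambda>m. 2 * exp (- (e\<^sup>2 / (2 * K\<^sup>2))) ^ m)"
          using e K by (intro summable_mult summable_geometric) auto
        show "norm (P.P.prob (A m)) \<le> 2 * exp (- (e\<^sup>2 / (2 * K\<^sup>2))) ^ m" if "1 \<le> m" for m
          using dev[OF e, of m] that unfolding A_def by simp
      qed
    qed
    then show ?thesis
    proof (rule AE_mp, intro AE_I2 impI)
      fix \<omega> assume "eventually (\<lambda>m. \<omega> \<in> space ?P - A m) sequentially"
      then show "eventually (\<lambda>m. \<bar>(\<Sum>k<m. W k \<omega>) - (\<Sum>k<m. \<integral>y. Z k y \<partial>\<mu>)\<bar> < e * (real m)\<^sup>2) sequentially"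
        by eventually_elim (auto simp: A_def)
    qed
  qed
  \<comment> \<open>Countably many tolerances suffice and keep the exceptional set null.\<close>
  have "AE \<omega> in ?P. \<forall>i. eventually (\<lambda>m. \<bar>(\<Sum>k<m. W k \<omega>) - (\<Sum>k<m. \<integral>y. Z k y \<partial>\<mu>)\<bar> < 1 / real (Suc i) * (real m)\<^sup>2) sequentially"
    unfolding AE_all_countable by (intro allI ev) simp
  then show ?thesis
  proof (rule AE_mp, intro AE_I2 impI)
    fix \<omega>
    assume ev: "\<forall>i. eventually (\<lambda>m. \<bar>(\<Sum>k<m. W k \<omega>) - (\<Sum>k<m. \<integral>y. Z k y \<partial>\<mu>)\<bar> < 1 / real (Suc i) * (real m)\<^sup>2) sequentially"
    show "(\<lambda>m. ((\<Sum>k<m. Z k (\<omega> k)) - (\<Sum>k<m. \<integral>y. Z k y \<partial>\<mu>)) / (real m)\<^sup>2) \<longlonglongrightarrow> 0"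
    proof (rule tendstoI)
      fix e :: real assume "0 < e"
      then obtain i where i: "1 / real (Suc i) < e" using nat_approx_posE by blast
      show "eventually (\<lambda>m. dist (((\<Sum>k<m. Z k (\<omega> k)) - (\<Sum>k<m. \<integral>y. Z k y \<partial>\<mu>)) / (real m)\<^sup>2) 0 < e) sequentially"
        using ev[rule_format, of i] eventually_gt_at_top[of 0]
      proof eventually_elim
        case (elim m)
        then have "\<bar>(\<Sum>k<m. W k \<omega>) - (\<Sum>k<m. \<integral>y. Z k y \<partial>\<mu>)\<bar> / (real m)\<^sup>2 < 1 / real (Suc i)"
          by (subst pos_divide_less_eq) auto
        then show ?case using i by (simp add: W_def)
      qed
    qed
  qed
qed

lemma prob_coordinates:
  assumes "\<And>k. k < m \<Longrightarrow> A k \<in> sets \<mu>"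
  shows "{\<omega> \<in> space (Pi\<^sub>M UNIV (\<lambda>_::nat. \<mu>)). \<forall>k<m. \<omega> k \<in> A k} \<in> sets (Pi\<^sub>M UNIV (\<lambda>_. \<mu>))"
    and "measure (Pi\<^sub>M UNIV (\<lambda>_. \<mu>)) {\<omega> \<in> space (Pi\<^sub>M UNIV (\<lambda>_::nat. \<mu>)). \<forall>k<m. \<omega> k \<in> A k} = (\<Prod>k<m. measure \<mu> (A k))"
proof -
  let ?P = "Pi\<^sub>M UNIV (\<lambda>_::nat. \<mu>)"
  have eq: "{\<omega> \<in> space ?P. \<forall>k<m. \<omega> k \<in> A k} = prod_emb UNIV (\<lambda>_. \<mu>) {..<m} (Pi\<^sub>E {..<m} A)"
    by (auto simp: prod_emb_def space_PiM Pi_iff PiE_iff)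
  show "{\<omega> \<in> space ?P. \<forall>k<m. \<omega> k \<in> A k} \<in> sets ?P"
    unfolding eq using assms by (intro sets_PiM_I_finite measurable_prod_emb sets_PiM_I) auto
  show "measure ?P {\<omega> \<in> space ?P. \<forall>k<m. \<omega> k \<in> A k} = (\<Prod>k<m. measure \<mu> (A k))"
    unfolding eq by (rule P.measure_PiM_emb) (use assms in auto)
qed

end

subsection \<open>Splicing blocks of increasing length\<close>

text \<open>A positive entry of a power has a positive summand, that is a path to the last but one
  letter followed by a nonzero, hence unit, entry.\<close>

lemma (in subshift_space) path_of_matrix_power:
  assumes "i \<in> {1..p}" "j \<in> {1..p}" "0 < matrix_power p a n i j"
  shows "\<exists>w. w 0 = i \<and> w n = j \<and> (\<forall>k\<le>n. w k \<in> {1..p}) \<and> (\<forall>k<n. a (w k) (w (Suc k)) = 1)"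
  using assms(2,3)
proof (induction n arbitrary: j)
  case 0
  then have "i = j" by (simp split: if_splits)
  then show ?case using assms(1) by (intro exI[of _ "\<lambda>_. i"]) auto
next
  case (Suc n)
  from Suc.prems(2) have "(\<Sum>k=1..p. matrix_power p a n i k * a k j) \<noteq> 0"
    by (simp only: matrix_power.simps neq0_conv)
  then obtain k where k: "k \<in> {1..p}" "matrix_power p a n i k * a k j \<noteq> 0" by (meson sum.neutral)
  then have "0 < matrix_power p a n i k" by simp
  then obtain w where w: "w 0 = i" "w n = k" "\<forall>l\<le>n. w l \<in> {1..p}" "\<forall>l<n. a (w l) (w (Suc l)) = 1"
    using Suc.IH[OF k(1)] by blast
  have "a k j \<in> {0, 1}" using zero_one k(1) Suc.prems(1) unfolding zero_one_matrix_def by blast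
  then have "a k j = 1" using k(2) by auto
  then show ?case using w Suc.prems(1)
    by (intro exI[of _ "w(Suc n := j)"]) (auto simp: less_Suc_eq le_Suc_eq)
qed

text \<open>The strictly positive power provides one length for all pairs of letters, so that the
  positions of the blocks do not depend on the blocks themselves.\<close>

lemma (in subshift_space) connectors:
  obtains L conn where "0 < (L :: nat)"
    "\<And>i j. i \<in> {1..p} \<Longrightarrow> j \<in> {1..p} \<Longrightarrow> conn i j 0 = i \<and> conn i j L = j \<and>
      (\<forall>k\<le>L. conn i j k \<in> {1..p}) \<and> (\<forall>k<L. a (conn i j k) (conn i j (Suc k)) = 1)"
proof -
  obtain L where L: "0 < L" "\<forall>i\<in>{1..p}. \<forall>j\<in>{1..p}. 0 < matrix_power p a L i j"
    using irred unfolding irreducible_aperiodic_def by blast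
  have "\<forall>ij. \<exists>w. fst ij \<in> {1..p} \<longrightarrow> snd ij \<in> {1..p} \<longrightarrow> w 0 = fst ij \<and> w L = snd ij \<and>
      (\<forall>k\<le>L. w k \<in> {1..p}) \<and> (\<forall>k<L. a (w k) (w (Suc k)) = 1)"
  proof
    fix ij
    show "\<exists>w. fst ij \<in> {1..p} \<longrightarrow> snd ij \<in> {1..p} \<longrightarrow> w 0 = fst ij \<and> w L = snd ij \<and>
      (\<forall>k\<le>L. w k \<in> {1..p}) \<and> (\<forall>k<L. a (w k) (w (Suc k)) = 1)"
    proof (cases "fst ij \<in> {1..p} \<and> snd ij \<in> {1..p}")
      case True
      then show ?thesis using path_of_matrix_power[of "fst ij" "snd ij" L] L(2) by auto
    next
      case False
      then show ?thesis by (auto simp del: atLeastAtMost_iff)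
    qed
  qed
  from choice[OF this] obtain w where w: "\<forall>ij. fst ij \<in> {1..p} \<longrightarrow> snd ij \<in> {1..p} \<longrightarrow> w ij 0 = fst ij \<and> w ij L = snd ij \<and>
      (\<forall>k\<le>L. w ij k \<in> {1..p}) \<and> (\<forall>k<L. a (w ij k) (w ij (Suc k)) = 1)" ..
  show ?thesis
    by (rule that[of L "\<lambda>i j. w (i, j)"]) (use L(1) w in auto)
qed

locale splicing = subshift_space p a for p and a +
  fixes L :: nat and conn :: "nat \<Rightarrow> nat \<Rightarrow> nat \<Rightarrow> nat"
  assumes L: "0 < L"
    and conn: "\<And>i j. i \<in> {1..p} \<Longrightarrow> j \<in> {1..p} \<Longrightarrow> conn i j 0 = i \<and> conn i j L = j \<and>
      (\<forall>k\<le>L. conn i j k \<in> {1..p}) \<and> (\<forall>k<L. a (conn i j k) (conn i j (Suc k)) = 1)"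
begin

text \<open>Block \<open>k\<close> consists of the first \<open>k + 1\<close> letters of \<open>w k\<close> and of \<open>L - 1\<close> further letters of a
  connector, whose first and last letter are shared with the adjacent blocks. Blocks of growing length
  make the connectors negligible, yet one block is negligible against its predecessors.\<close>

definition start :: "nat \<Rightarrow> nat" where "start m = (\<Sum>k<m. k + L)"

definition block_of :: "nat \<Rightarrow> nat" where "block_of i = (LEAST k. i < start (Suc k))"

definition splice :: "(nat \<Rightarrow> nat \<Rightarrow> nat) \<Rightarrow> nat \<Rightarrow> nat" where
  "splice w i = (let k = block_of i; d = i - start k
     in if d \<le> k then w k d else conn (w k k) (w (Suc k) 0) (d - k))"

lemma start_0 [simp]: "start 0 = 0" and start_Suc: "start (Suc k) = start k + k + L"
  by (simp_all add: start_def)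

lemma start_mono: "m \<le> n \<Longrightarrow> start m \<le> start n"
  by (rule lift_Suc_mono_le[of start]) (simp_all add: start_Suc)

lemma start_ge: "m \<le> start m"
proof (induction m)
  case (Suc m)
  then show ?case using L by (simp add: start_Suc)
qed simp

lemma block_of_start:
  assumes "d < k + L"
  shows "block_of (start k + d) = k"
  unfolding block_of_def
proof (rule Least_equality)
  show "start k + d < start (Suc k)" using assms by (simp add: start_Suc)
  fix j assume j: "start k + d < start (Suc j)"
  show "k \<le> j"
  proof (rule ccontr)
    assume "\<not> k \<le> j"
    then have "start (Suc j) \<le> start k" by (intro start_mono) simp
    then show False using j by simp
  qed
qed

lemma block_of_bounds: "start (block_of i) \<le> i" "i < start (Suc (block_of i))"
proof -
  have ex: "i < start (Suc i)" using start_ge[of "Suc i"] by simp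
  show "i < start (Suc (block_of i))" unfolding block_of_def by (rule LeastI[of _ i]) (rule ex)
  show "start (block_of i) \<le> i"
  proof (cases "block_of i")
    case (Suc k)
    have "\<not> i < start (Suc k)" using not_less_Least[of k "\<lambda>k. i < start (Suc k)"] Suc unfolding block_of_def by simp
    then show ?thesis by (simp add: Suc)
  qed simp
qed

lemma block_of_at_top: "filterlim block_of at_top sequentially"
  unfolding filterlim_at_top
proof
  fix Z
  show "eventually (\<lambda>n. Z \<le> block_of n) sequentially"
    using eventually_ge_at_top[of "start Z"]
  proof eventually_elim
    case (elim n)
    show ?case
    proof (rule ccontr)
      assume "\<not> Z \<le> block_of n"
      then have "start (Suc (block_of n)) \<le> start Z" by (intro start_mono) simp
      then show False using block_of_bounds(2)[of n] elim by simp
    qed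
  qed
qed

lemma splice_block: "d \<le> k \<Longrightarrow> splice w (start k + d) = w k d"
  using block_of_start[of d k] L by (simp add: splice_def)

text \<open>The end letters of a connector are letters of the adjacent words, so the formula also
  holds for \<open>d = 0\<close> and \<open>d = L\<close>, where \<open>splice\<close> reads from
  \<open>w\<close>.\<close>

lemma splice_connector:
  assumes w: "\<And>k. w k \<in> X" and d: "d \<le> L"
  shows "splice w (start k + k + d) = conn (w k k) (w (Suc k) 0) d"
proof -
  note c = conn[OF X_letter[OF w[of k], of k] X_letter[OF w[of "Suc k"], of 0]]
  consider "d = 0" | "0 < d" "d < L" | "d = L" using d by linarith
  then show ?thesis
  proof cases
    case 1
    then show ?thesis using splice_block[of k k w] c by simp
  next
    case 2
    then show ?thesis using block_of_start[of "k + d" k] by (simp add: splice_def add.assoc)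
  next
    case 3
    then show ?thesis using splice_block[of 0 "Suc k" w] c by (simp add: start_Suc)
  qed
qed

lemma splice_X:
  assumes w: "\<And>k. w k \<in> X"
  shows "splice w \<in> X"
proof -
  have "splice w i \<in> {1..p} \<and> a (splice w i) (splice w (Suc i)) = 1" for i
  proof -
    define k where "k = block_of i"
    define d where "d = i - start k"
    have i: "i = start k + d" "d < k + L"
      using block_of_bounds[of i] by (auto simp: k_def d_def start_Suc)
    show ?thesis
    proof (cases "d < k")
      case True
      then have "splice w i = w k d" "splice w (Suc i) = w k (Suc d)"
        using splice_block[of d k w] splice_block[of "Suc d" k w] by (simp_all add: i)
      then show ?thesis using X_letter[OF w] X_edge[OF w] by simp
    next
      case False
      then obtain e where e: "d = k + e" "e < L" using i(2) by (metis add_diff_inverse_nat nat_add_left_cancel_less)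
      note c = conn[OF X_letter[OF w[of k], of k] X_letter[OF w[of "Suc k"], of 0]]
      have "splice w i = conn (w k k) (w (Suc k) 0) e" "splice w (Suc i) = conn (w k k) (w (Suc k) 0) (Suc e)"
        using splice_connector[of w e k, OF w] splice_connector[of w "Suc e" k, OF w] e by (simp_all add: i add.assoc)
      then show ?thesis using c e(2) by simp
    qed
  qed
  then show ?thesis by (simp add: subshift_def)
qed

lemma ergodic_sum_add:
  "ergodic_sum left_shift \<phi> (m + n) x = ergodic_sum left_shift \<phi> m x + ergodic_sum left_shift \<phi> n ((left_shift ^^ m) x)"
proof (induction n)
  case (Suc n)
  have "(left_shift ^^ (m + n)) x = (left_shift ^^ n) ((left_shift ^^ m) x)"
    by (simp add: left_shift_funpow add.commute add.left_commute)
  with Suc show ?case by (simp add: ergodic_sum_def)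
qed (simp add: ergodic_sum_def)

lemma ergodic_sum_abs_le:
  assumes "\<And>x. x \<in> X \<Longrightarrow> \<bar>\<phi> x\<bar> \<le> K" "x \<in> X"
  shows "\<bar>ergodic_sum left_shift \<phi> n x\<bar> \<le> real n * K"
proof -
  have "\<bar>ergodic_sum left_shift \<phi> n x\<bar> \<le> (\<Sum>k<n. \<bar>\<phi> ((left_shift ^^ k) x)\<bar>)" unfolding ergodic_sum_def by (rule sum_abs)
  also have "\<dots> \<le> (\<Sum>k<n. K)" using assms shift_funpow_X by (intro sum_mono) auto
  finally show ?thesis by simp
qed

text \<open>The shifted splice and the shifted \<open>w k\<close> share at least \<open>N\<close>
  letters at all but at most \<open>N\<close> places of the block, where the error is
  \<open>2 * K\<close> instead; the \<open>L - 1\<close> connector places cost at most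
  \<open>K\<close> each.\<close>

lemma splice_block_sum:
  fixes \<phi> :: "(nat \<Rightarrow> nat) \<Rightarrow> real"
  assumes w: "\<And>k. w k \<in> X" and K: "0 < K" "\<And>x. x \<in> X \<Longrightarrow> \<bar>\<phi> x\<bar> \<le> K"
    and e: "0 \<le> e" "\<And>x y. x \<in> X \<Longrightarrow> y \<in> X \<Longrightarrow> \<forall>i<N. x i = y i \<Longrightarrow> \<bar>\<phi> x - \<phi> y\<bar> \<le> e"
  shows "\<bar>ergodic_sum left_shift \<phi> (k + L) ((left_shift ^^ start k) (splice w)) - ergodic_sum left_shift \<phi> (Suc k) (w k)\<bar>
    \<le> real (Suc k) * e + (2 * real N + real L) * K"
proof -
  let ?x = "(left_shift ^^ start k) (splice w)"
  have x: "?x \<in> X" by (rule shift_funpow_X[OF splice_X[OF w]])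
  have near: "\<bar>\<phi> ((left_shift ^^ d) ?x) - \<phi> ((left_shift ^^ d) (w k))\<bar> \<le> e + (if Suc k < d + N then 2 * K else 0)"
    if "d < Suc k" for d
  proof (cases "Suc k < d + N")
    case True
    have "\<bar>\<phi> ((left_shift ^^ d) ?x)\<bar> \<le> K" "\<bar>\<phi> ((left_shift ^^ d) (w k))\<bar> \<le> K"
      using K(2) shift_funpow_X x w by auto
    then show ?thesis using True e(1) by simp
  next
    case False
    have "(left_shift ^^ d) ?x i = (left_shift ^^ d) (w k) i" if "i < N" for i
      using splice_block[of "i + d" k w] False that by (simp add: left_shift_funpow add_ac)
    then show ?thesis using False e(2)[of "(left_shift ^^ d) ?x" "(left_shift ^^ d) (w k)"] shift_funpow_X x w by auto
  qed
  have "(\<Sum>d<Suc k. if Suc k < d + N then 2 * K else 0) \<le> 2 * real N * K"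
  proof -
    have "(\<Sum>d<Suc k. if Suc k < d + N then 2 * K else 0) = (\<Sum>d\<in>{d. d < Suc k \<and> Suc k < d + N}. 2 * K)"
      by (rule sum.mono_neutral_cong_right) auto
    also have "\<dots> = real (card {d. d < Suc k \<and> Suc k < d + N}) * (2 * K)" by simp
    also have "\<dots> \<le> real N * (2 * K)"
    proof (intro mult_right_mono)
      have "{d. d < Suc k \<and> Suc k < d + N} \<subseteq> {Suc k - N..<Suc k}" by auto
      then have "card {d. d < Suc k \<and> Suc k < d + N} \<le> card {Suc k - N..<Suc k}" by (intro card_mono) auto
      then show "real (card {d. d < Suc k \<and> Suc k < d + N}) \<le> real N" by simp
    qed (use K in auto)
    finally show ?thesis by simp
  qed
  moreover have "\<bar>ergodic_sum left_shift \<phi> (Suc k) ?x - ergodic_sum left_shift \<phi> (Suc k) (w k)\<bar>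
      \<le> (\<Sum>d<Suc k. e + (if Suc k < d + N then 2 * K else 0))"
    unfolding ergodic_sum_def sum_subtractf[symmetric] using near
    by (intro order_trans[OF sum_abs sum_mono]) auto
  ultimately have 1: "\<bar>ergodic_sum left_shift \<phi> (Suc k) ?x - ergodic_sum left_shift \<phi> (Suc k) (w k)\<bar> \<le> real (Suc k) * e + 2 * real N * K"
    by (simp add: sum.distrib)
  have "ergodic_sum left_shift \<phi> (k + L) ?x = ergodic_sum left_shift \<phi> (Suc k) ?x + ergodic_sum left_shift \<phi> (L - 1) ((left_shift ^^ Suc k) ?x)"
    using ergodic_sum_add[of \<phi> "Suc k" "L - 1" ?x] L by simp
  moreover have "\<bar>ergodic_sum left_shift \<phi> (L - 1) ((left_shift ^^ Suc k) ?x)\<bar> \<le> real (L - 1) * K"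
    by (rule ergodic_sum_abs_le[OF _ shift_funpow_X[OF x]]) (rule K(2))
  moreover have "real (L - 1) * K \<le> real L * K" using K by (intro mult_right_mono) auto
  ultimately show ?thesis using 1 by (simp add: distrib_right)
qed

lemma splice_sum:
  fixes \<phi> :: "(nat \<Rightarrow> nat) \<Rightarrow> real"
  assumes w: "\<And>k. w k \<in> X" and K: "0 < K" "\<And>x. x \<in> X \<Longrightarrow> \<bar>\<phi> x\<bar> \<le> K"
    and e: "0 \<le> e" "\<And>x y. x \<in> X \<Longrightarrow> y \<in> X \<Longrightarrow> \<forall>i<N. x i = y i \<Longrightarrow> \<bar>\<phi> x - \<phi> y\<bar> \<le> e"
  shows "\<bar>ergodic_sum left_shift \<phi> (start m) (splice w) - (\<Sum>k<m. ergodic_sum left_shift \<phi> (Suc k) (w k))\<bar>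
    \<le> (real m)\<^sup>2 * e + real m * ((2 * real N + real L) * K)"
proof -
  have "ergodic_sum left_shift \<phi> (start m) (splice w) = (\<Sum>k<m. ergodic_sum left_shift \<phi> (k + L) ((left_shift ^^ start k) (splice w)))"
  proof (induction m)
    case (Suc m)
    then show ?case using ergodic_sum_add[of \<phi> "start m" "m + L" "splice w"] by (simp add: start_Suc add.assoc)
  qed (simp add: ergodic_sum_def)
  then have "\<bar>ergodic_sum left_shift \<phi> (start m) (splice w) - (\<Sum>k<m. ergodic_sum left_shift \<phi> (Suc k) (w k))\<bar>
    = \<bar>\<Sum>k<m. ergodic_sum left_shift \<phi> (k + L) ((left_shift ^^ start k) (splice w)) - ergodic_sum left_shift \<phi> (Suc k) (w k)\<bar>"
    by (simp add: sum_subtractf)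
  also have "\<dots> \<le> (\<Sum>k<m. real m * e + (2 * real N + real L) * K)"
  proof (rule order_trans[OF sum_abs sum_mono])
    fix k assume "k \<in> {..<m}"
    then have "real (Suc k) * e \<le> real m * e" using e(1) by (intro mult_right_mono) auto
    then show "\<bar>ergodic_sum left_shift \<phi> (k + L) ((left_shift ^^ start k) (splice w)) - ergodic_sum left_shift \<phi> (Suc k) (w k)\<bar>
        \<le> real m * e + (2 * real N + real L) * K"
      using splice_block_sum[where w = w and \<phi> = \<phi> and K = K and e = e and N = N and k = k, OF w K(1)] K(2) e by fastforce
  qed
  also have "\<dots> = (real m)\<^sup>2 * e + real m * ((2 * real N + real L) * K)"
    by (simp add: power2_eq_square algebra_simps)
  finally show ?thesis .
qed

text \<open>The lengths of \<open>m\<close> blocks add up to \<open>m * (m + 1) / 2\<close>, whence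
  the factor \<open>1 / 2\<close> in the limits below.\<close>

lemma sum_Suc_limit: "(\<lambda>m. (\<Sum>k<m. real (Suc k) * I) / (real m)\<^sup>2) \<longlonglongrightarrow> I / 2"
proof -
  have s: "(\<Sum>k<m. real (Suc k) * I) = real m * (real m + 1) / 2 * I" for m
    by (induction m) (auto simp: field_simps)
  have "(\<lambda>m. I / 2 + I / 2 / real m) \<longlonglongrightarrow> I / 2 + 0"
    by (intro tendsto_add tendsto_const lim_const_over_n)
  moreover have "eventually (\<lambda>m. I / 2 + I / 2 / real m = (\<Sum>k<m. real (Suc k) * I) / (real m)\<^sup>2) sequentially"
    using eventually_gt_at_top[of 0]
    by eventually_elim (simp only: s, simp add: field_simps power2_eq_square)
  ultimately show ?thesis using Lim_transform_eventually by fastforce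
qed

text \<open>The sums are normalised by the square of the number of complete blocks, which is the
  same for every \<open>\<phi>\<close> and cancels when two such sums are compared.\<close>

lemma splice_sum_limit:
  fixes \<phi> :: "(nat \<Rightarrow> nat) \<Rightarrow> real"
  assumes w: "\<And>k. w k \<in> X" and phi: "continuous_on X \<phi>"
    and lim: "(\<lambda>m. ((\<Sum>k<m. ergodic_sum left_shift \<phi> (Suc k) (w k)) - (\<Sum>k<m. real (Suc k) * I)) / (real m)\<^sup>2) \<longlonglongrightarrow> 0"
  shows "(\<lambda>n. ergodic_sum left_shift \<phi> n (splice w) / (real (block_of n))\<^sup>2) \<longlonglongrightarrow> I / 2"
proof -
  obtain K where K: "0 < K" "\<And>x. x \<in> X \<Longrightarrow> \<bar>\<phi> x\<bar> \<le> K" using continuous_on_X_bounded[OF phi] by blast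
  let ?S = "\<lambda>n. ergodic_sum left_shift \<phi> n (splice w)"
  let ?A = "\<lambda>m. \<Sum>k<m. ergodic_sum left_shift \<phi> (Suc k) (w k)"
  have d0: "(\<lambda>m. (?S (start m) - ?A m) / (real m)\<^sup>2) \<longlonglongrightarrow> 0"
  proof (rule tendstoI)
    fix e :: real assume e: "0 < e"
    obtain N where N: "\<And>x y. x \<in> X \<Longrightarrow> y \<in> X \<Longrightarrow> \<forall>i<N. x i = y i \<Longrightarrow> dist (\<phi> x) (\<phi> y) < e / 2"
      using continuous_on_X_uniform[OF phi, of "e / 2"] e by auto
    define Q where "Q = (2 * real N + real L) * K"
    have "(\<lambda>m. Q / real m) \<longlonglongrightarrow> 0" by (rule lim_const_over_n)
    then have "eventually (\<lambda>m. Q / real m < e / 2) sequentially" using e by (intro order_tendstoD) auto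
    then show "eventually (\<lambda>m. dist ((?S (start m) - ?A m) / (real m)\<^sup>2) 0 < e) sequentially"
      using eventually_gt_at_top[of 0]
    proof eventually_elim
      case (elim m)
      have "\<bar>?S (start m) - ?A m\<bar> \<le> (real m)\<^sup>2 * (e / 2) + real m * Q"
        unfolding Q_def
        by (rule splice_sum[OF w K]) (use e N in \<open>auto simp: dist_real_def intro: less_imp_le\<close>)
      then have "\<bar>?S (start m) - ?A m\<bar> / (real m)\<^sup>2 \<le> ((real m)\<^sup>2 * (e / 2) + real m * Q) / (real m)\<^sup>2"
        by (rule divide_right_mono) simp
      also have "\<dots> = e / 2 + Q / real m" using elim by (simp add: field_simps power2_eq_square)
      also have "\<dots> < e" using elim by linarith
      finally show ?case by simp
    qed
  qed
  have "(\<lambda>m. (?S (start m) - ?A m) / (real m)\<^sup>2 + ((?A m - (\<Sum>k<m. real (Suc k) * I)) / (real m)\<^sup>2 + (\<Sum>k<m. real (Suc k) * I) / (real m)\<^sup>2))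
      \<longlonglongrightarrow> 0 + (0 + I / 2)"
    by (intro tendsto_add d0 lim sum_Suc_limit)
  then have lim1: "(\<lambda>m. ?S (start m) / (real m)\<^sup>2) \<longlonglongrightarrow> I / 2"
    by (simp add: add_divide_distrib[symmetric])
  have lim2: "(\<lambda>n. ?S (start (block_of n)) / (real (block_of n))\<^sup>2) \<longlonglongrightarrow> I / 2"
    by (rule filterlim_compose[OF lim1 block_of_at_top])
  \<comment> \<open>The unfinished block has fewer than \<open>m + L\<close> letters, where
    \<open>m\<close> is the number of complete blocks, and is negligible against
    \<open>m^2\<close>.\<close>
  have "(\<lambda>n. (?S n - ?S (start (block_of n))) / (real (block_of n))\<^sup>2) \<longlonglongrightarrow> 0"
  proof (rule Lim_null_comparison)
    have "(\<lambda>m. K / real m + real L * K / real m * (1 / real m)) \<longlonglongrightarrow> 0 + 0 * 0"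
      by (intro tendsto_add tendsto_mult lim_const_over_n)
    from filterlim_compose[OF this block_of_at_top]
    show "(\<lambda>n. K / real (block_of n) + real L * K / real (block_of n) * (1 / real (block_of n))) \<longlonglongrightarrow> 0" by simp
    have "eventually (\<lambda>n. 1 \<le> block_of n) sequentially"
      using block_of_at_top unfolding filterlim_at_top by blast
    then show "eventually (\<lambda>n. norm ((?S n - ?S (start (block_of n))) / (real (block_of n))\<^sup>2)
        \<le> K / real (block_of n) + real L * K / real (block_of n) * (1 / real (block_of n))) sequentially"
    proof eventually_elim
      case (elim n)
      let ?m = "block_of n"
      obtain d where d: "n = start ?m + d" "d < ?m + L"
        using block_of_bounds[of n] le_iff_add[of "start ?m" n] by (auto simp: start_Suc)
      have "\<bar>?S n - ?S (start ?m)\<bar> = \<bar>ergodic_sum left_shift \<phi> d ((left_shift ^^ start ?m) (splice w))\<bar>"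
        using ergodic_sum_add[of \<phi> "start ?m" d "splice w"] d(1) by simp
      also have "\<dots> \<le> real d * K"
        by (rule ergodic_sum_abs_le[OF _ shift_funpow_X[OF splice_X[OF w]]]) (rule K(2))
      also have "\<dots> \<le> (real ?m + real L) * K" using d(2) K(1) by (intro mult_right_mono) auto
      finally have "\<bar>?S n - ?S (start ?m)\<bar> / (real ?m)\<^sup>2 \<le> (real ?m + real L) * K / (real ?m)\<^sup>2"
        by (rule divide_right_mono) simp
      also have "\<dots> = K / real ?m + real L * K / real ?m * (1 / real ?m)"
        using elim by (simp add: field_simps power2_eq_square)
      finally show ?case by simp
    qed
  qed
  from tendsto_add[OF this lim2] show ?thesis by (simp add: add_divide_distrib[symmetric])
qed

end

subsection \<open>Truncated information of words\<close>

context subshift_space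
begin

definition word_mass :: "(nat \<Rightarrow> nat) measure \<Rightarrow> nat \<Rightarrow> (nat \<Rightarrow> nat) \<Rightarrow> real" where
  "word_mass \<mu> n y = measure \<mu> {z \<in> X. initial n z \<in> {initial n y}}"

text \<open>The truncation level \<open>p\<^sup>-\<^sup>2\<^sup>n\<close> makes the information a bounded function while changing its mean
  by at most the number \<open>p\<^sup>n\<close> of words times this level.\<close>

definition info :: "(nat \<Rightarrow> nat) measure \<Rightarrow> nat \<Rightarrow> (nat \<Rightarrow> nat) \<Rightarrow> real" where
  "info \<mu> n y = - ln (max (word_mass \<mu> n y) (1 / real p ^ (2 * n)))"

context
  fixes \<mu> :: "(nat \<Rightarrow> nat) measure"
  assumes mu: "prob_space \<mu>" "sets \<mu> = sets BX"
begin

lemma info_measurable: "info \<mu> n \<in> borel_measurable \<mu>"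
proof -
  have "continuous_on X (info \<mu> n)"
    unfolding info_def word_mass_def
    by (rule continuous_on_initial[of X "\<lambda>w. - ln (max (measure \<mu> {z \<in> X. initial n z \<in> {w}}) (1 / real p ^ (2 * n)))" n])
  then show ?thesis using continuous_measurable_BX measurable_cong_sets[OF mu(2) refl] by blast
qed

lemma word_mass_le: "word_mass \<mu> n y \<le> exp (- info \<mu> n y)"
proof -
  have "0 < max (word_mass \<mu> n y) (1 / real p ^ (2 * n))" using p_ge_2 by (simp add: less_max_iff_disj)
  then show ?thesis by (simp add: info_def)
qed

lemma info_bounds: "0 \<le> info \<mu> n y" "info \<mu> n y \<le> 2 * ln (real p) * real n"
proof -
  interpret prob_space \<mu> by (rule mu)
  have th: "0 < 1 / real p ^ (2 * n)" "1 / real p ^ (2 * n) \<le> 1" using p_ge_2 by simp_all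
  have "max (word_mass \<mu> n y) (1 / real p ^ (2 * n)) \<le> 1" using th(2) by (simp add: word_mass_def)
  then show "0 \<le> info \<mu> n y" using th(1) by (simp add: info_def less_max_iff_disj)
  have "ln (1 / real p ^ (2 * n)) \<le> ln (max (word_mass \<mu> n y) (1 / real p ^ (2 * n)))"
    using th(1) by (subst ln_le_cancel_iff) (auto simp: less_max_iff_disj)
  then show "info \<mu> n y \<le> 2 * ln (real p) * real n"
    using p_ge_2 by (simp add: info_def ln_div ln_realpow mult_ac)
qed

lemma info_mean: "var_entropy \<mu> (initial n) - 1 \<le> (\<integral>y. info \<mu> n y \<partial>\<mu>)"
proof -
  interpret prob_space \<mu> by (rule mu)
  have space: "space \<mu> = X" using sets_eq_imp_space_eq[OF mu(2)] by simp
  define m where "m w = measure \<mu> {z \<in> X. initial n z \<in> {w}}" for w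
  define th where "th = 1 / real p ^ (2 * n)"
  have th: "0 < th" using p_ge_2 by (simp add: th_def)
  define H where "H w = - ln (max (m w) th)" for w
  have "(\<integral>y. info \<mu> n y \<partial>\<mu>) = (\<integral>y. (\<Sum>w\<in>words n. H w * indicator {z \<in> X. initial n z \<in> {w}} y) \<partial>\<mu>)"
  proof (rule Bochner_Integration.integral_cong[OF refl])
    fix y assume "y \<in> space \<mu>"
    then have y: "y \<in> X" by (simp add: space)
    have "(\<Sum>w\<in>words n. H w * indicator {z \<in> X. initial n z \<in> {w}} y) = (\<Sum>w\<in>{initial n y}. H w)"
      using y initial_words[OF y, of n] by (intro sum.mono_neutral_cong_right finite_words) (auto simp: indicator_def)
    then show "info \<mu> n y = (\<Sum>w\<in>words n. H w * indicator {z \<in> X. initial n z \<in> {w}} y)"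
      by (simp add: info_def H_def m_def th_def word_mass_def)
  qed
  also have "\<dots> = (\<Sum>w\<in>words n. H w * m w)"
  proof -
    define A where "A w = {z \<in> X. initial n z \<in> {w}}" for w
    have "A w \<in> events" for w unfolding A_def mu(2) by (rule initial_in_BX)
    then show ?thesis unfolding m_def A_def[symmetric]
      by (subst Bochner_Integration.integral_sum) (auto simp: emeasure_eq_measure)
  qed
  finally have mean: "(\<integral>y. info \<mu> n y \<partial>\<mu>) = (\<Sum>w\<in>words n. H w * m w)" .
  have "(\<Sum>w\<in>words n. - (m w * ln (m w)) - th) \<le> (\<integral>y. info \<mu> n y \<partial>\<mu>)"
    unfolding mean
  proof (rule sum_mono)
    fix w
    have m0: "0 \<le> m w" by (simp add: m_def)
    show "- (m w * ln (m w)) - th \<le> H w * m w"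
    proof (cases "m w = 0")
      case True
      then show ?thesis using th by simp
    next
      case False
      then have pos: "0 < m w" using m0 by simp
      define M where "M = max (m w) th"
      have M: "0 < M" "M - m w \<le> th" using pos th by (auto simp: M_def max_def)
      \<comment> \<open>Truncating at \<open>th\<close> costs at most
        \<open>M - m w \<le> th\<close> in the mean for each word; with \<open>p ^ n\<close> words
        and \<open>th = p ^ (- 2 * n)\<close> the total is at most 1.\<close>
      have "ln (M / m w) \<le> M / m w - 1" using M pos by (intro ln_le_minus_one) simp
      then have "m w * ln (M / m w) \<le> m w * (M / m w - 1)" using pos by (intro mult_left_mono) auto
      also have "\<dots> = M - m w" using pos by (simp add: right_diff_distrib)
      finally have "m w * (ln M - ln (m w)) \<le> th" using M pos by (simp add: ln_div)
      then show ?thesis by (simp add: H_def M_def algebra_simps)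
    qed
  qed
  moreover have "(\<Sum>w\<in>words n. - (m w * ln (m w)) - th) = var_entropy \<mu> (initial n) - real (card (words n)) * th"
  proof -
    have "initial n -` {w} \<inter> space \<mu> = {z \<in> X. initial n z \<in> {w}}" for w by (auto simp: space)
    moreover have "initial n ` space \<mu> \<subseteq> words n" unfolding space using initial_words by blast
    ultimately have "var_entropy \<mu> (initial n) = - (\<Sum>w\<in>words n. m w * ln (m w))"
      using var_entropy_superset[OF finite_words[of n], where F = "initial n" and M = \<mu>] by (simp add: m_def)
    then show ?thesis by (simp add: sum_subtractf sum_negf)
  qed
  moreover have "real (card (words n)) * th \<le> 1"
  proof -
    have "card (words n) = p ^ n" by (subst card_lists_length_eq) auto
    moreover have "real p ^ n \<le> real p ^ (2 * n)" using p_ge_2 by (intro power_increasing) auto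
    ultimately show ?thesis using p_ge_2 by (simp add: th_def)
  qed
  ultimately show ?thesis by linarith
qed

end

end

subsection \<open>The mass distribution argument\<close>

context ratio_spectrum
begin

text \<open>If the image of \<open>level\<close> were null, a fine cover with small
  \<open>t\<close>-sum would confine almost every sequence of independent blocks to events of total
  probability below 1.\<close>

theorem spectrum_lower:
  assumes mu: "\<mu> \<in> invariants" and C: "mean_ratio \<mu> \<in> C" and h: "metric_entropy left_shift \<mu> = ereal h"
  shows "level \<noteq> {}" and "0 \<le> t \<Longrightarrow> t * (\<integral>x. \<psi> x \<partial>\<mu>) < h \<Longrightarrow> hausdorff_measure t (\<pi> ` level) \<noteq> 0"
proof -
  note inv = invariantsD[OF mu]
  interpret M: prob_space \<mu> by (rule inv(1))
  obtain L conn where LC: "0 < (L :: nat)"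
    "\<And>i j. i \<in> {1..p} \<Longrightarrow> j \<in> {1..p} \<Longrightarrow> conn i j 0 = i \<and> conn i j L = j \<and>
      (\<forall>k\<le>L. conn i j k \<in> {1..p}) \<and> (\<forall>k<L. a (conn i j k) (conn i j (Suc k)) = 1)"
    using connectors by blast
  interpret splicing p a L conn by unfold_locales (fact LC)+
  let ?P = "Pi\<^sub>M UNIV (\<lambda>_::nat. \<mu>)"
  interpret P: prob_space ?P by (rule prob_space_PiM) (rule inv(1))
  have spP: "w k \<in> X" if "w \<in> space ?P" for w k
    using that inv(3) by (auto simp: space_PiM PiE_def Pi_def)
  define conv where "conv w \<phi> \<longleftrightarrow> (\<lambda>m. ((\<Sum>k<m. S\<^sub>n \<phi> (Suc k) (w k)) - (\<Sum>k<m. real (Suc k) * (\<integral>x. \<phi> x \<partial>\<mu>))) / (real m)\<^sup>2) \<longlonglongrightarrow> 0"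
    for w and \<phi> :: "(nat \<Rightarrow> nat) \<Rightarrow> real"
  have AE_conv: "AE w in ?P. conv w \<phi>" if phi: "continuous_on X \<phi>" for \<phi>
  proof -
    obtain K where K: "0 < K" "\<And>x. x \<in> X \<Longrightarrow> \<bar>\<phi> x\<bar> \<le> K" using continuous_on_X_bounded[OF phi] by blast
    have "AE w in ?P. (\<lambda>m. ((\<Sum>k<m. S\<^sub>n \<phi> (Suc k) (w k)) - (\<Sum>k<m. \<integral>y. S\<^sub>n \<phi> (Suc k) y \<partial>\<mu>)) / (real m)\<^sup>2) \<longlonglongrightarrow> 0"
    proof (rule weighted_slln[OF inv(1) _ K(1)])
      show "S\<^sub>n \<phi> (Suc k) \<in> borel_measurable \<mu>" for k
        using continuous_measurable_BX[OF continuous_on_ergodic_sum[OF phi]] measurable_cong_sets[OF inv(2) refl] by blast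
      fix k y assume "y \<in> space \<mu>"
      then have "y \<in> X" by (simp add: inv(3))
      then have "\<bar>S\<^sub>n \<phi> (Suc k) y\<bar> \<le> real (Suc k) * K" using K(2) by (intro ergodic_sum_bound)
      then show "\<bar>S\<^sub>n \<phi> (Suc k) y\<bar> \<le> K * real (Suc k)" by (simp only: mult.commute)
    qed
    then show ?thesis unfolding conv_def integral_ergodic_sum[OF mu phi] .
  qed
  define Y where "Y k = info \<mu> (Suc k)" for k
  define EY where "EY k = (\<integral>y. Y k y \<partial>\<mu>)" for k
  define convY where "convY w \<longleftrightarrow> (\<lambda>m. ((\<Sum>k<m. Y k (w k)) - (\<Sum>k<m. EY k)) / (real m)\<^sup>2) \<longlonglongrightarrow> 0" for w
  have AE_Y: "AE w in ?P. convY w"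
    unfolding convY_def EY_def
  proof (rule weighted_slln[OF inv(1)])
    show "0 < 2 * ln (real p)" using p_ge_2 by simp
    show "Y k \<in> borel_measurable \<mu>" for k unfolding Y_def by (rule info_measurable[OF inv(1,2)])
    show "\<bar>Y k y\<bar> \<le> 2 * ln (real p) * real (Suc k)" for k y
      using info_bounds[OF inv(1,2), of "Suc k" y] by (simp add: Y_def)
  qed
  define typical where "typical w \<longleftrightarrow> w \<in> space ?P \<and> (\<forall>j. conv w (f j)) \<and> (\<forall>j. conv w (g j)) \<and> conv w \<psi> \<and> convY w" for w
  have AE_all: "AE w in ?P. \<forall>j. conv w (\<Phi> j)" if "\<And>j. continuous_on X (\<Phi> j)" for \<Phi> :: "'m \<Rightarrow> (nat \<Rightarrow> nat) \<Rightarrow> real"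
    using AE_finite_allI[where S = UNIV and Q = "\<lambda>j w. conv w (\<Phi> j)" and M = ?P] AE_conv[OF that] by simp
  have AE_typical: "AE w in ?P. typical w"
    using AE_space AE_all[of f, OF cont_f] AE_all[of g, OF cont_g] AE_conv[OF continuous_on_psi] AE_Y
    by eventually_elim (simp add: typical_def)
  have sums: "(\<lambda>n. S\<^sub>n \<phi> n (splice w) / (real (block_of n))\<^sup>2) \<longlonglongrightarrow> (\<integral>x. \<phi> x \<partial>\<mu>) / 2"
    if "w \<in> space ?P" "conv w \<phi>" "continuous_on X \<phi>" for w \<phi>
    using that unfolding conv_def by (intro splice_sum_limit spP)
  have block_pos: "eventually (\<lambda>n. 1 \<le> block_of n) sequentially"
    using block_of_at_top unfolding filterlim_at_top by blast
  have typical_level: "splice w \<in> level" if w: "typical w" for w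
  proof (rule level_if_convergent[OF splice_X _ C])
    have wP: "w \<in> space ?P" using w by (simp add: typical_def)
    show "w k \<in> X" for k by (rule spP[OF wP])
    show "(\<lambda>n. ratio n (splice w)) \<longlonglongrightarrow> mean_ratio \<mu>"
    proof (rule vec_tendstoI)
      fix j
      have g2: "(\<integral>x. g j x \<partial>\<mu>) / 2 \<noteq> 0" using g_nonzero[OF mu] by simp
      have "(\<lambda>n. (S\<^sub>n (f j) n (splice w) / (real (block_of n))\<^sup>2) / (S\<^sub>n (g j) n (splice w) / (real (block_of n))\<^sup>2))
          \<longlonglongrightarrow> ((\<integral>x. f j x \<partial>\<mu>) / 2) / ((\<integral>x. g j x \<partial>\<mu>) / 2)"
        by (intro tendsto_divide sums wP cont_f cont_g g2) (use w in \<open>auto simp: typical_def\<close>)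
      moreover have "eventually (\<lambda>n. (S\<^sub>n (f j) n (splice w) / (real (block_of n))\<^sup>2) / (S\<^sub>n (g j) n (splice w) / (real (block_of n))\<^sup>2)
          = ratio n (splice w) $ j) sequentially"
        using block_pos by eventually_elim (simp add: ratio_def)
      ultimately show "(\<lambda>n. ratio n (splice w) $ j) \<longlonglongrightarrow> mean_ratio \<mu> $ j"
        using Lim_transform_eventually by (fastforce simp: mean_ratio_def)
    qed
  qed
  show "level \<noteq> {}"
  proof -
    have "\<exists>w. typical w"
    proof (rule ccontr)
      assume "\<not> ?thesis"
      then have "AE w in ?P. False" using AE_typical by simp
      then show False using P.AE_False by simp
    qed
    then show ?thesis using typical_level by blast
  qed
  assume t: "0 \<le> t" and th: "t * (\<integral>x. \<psi> x \<partial>\<mu>) < h"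
  \<comment> \<open>The entropy is the infimum of the block entropies per letter, so it bounds every
    single block length; the loss of 1 is due to truncation.\<close>
  have EY_ge: "real (Suc k) * h - 1 \<le> EY k" for k
  proof -
    obtain h' where h': "metric_entropy left_shift \<mu> = ereal h'" "\<And>n. 0 < n \<Longrightarrow> h' \<le> var_entropy \<mu> (initial n) / real n"
      using metric_entropy_blocks[OF mu] by metis
    have "h \<le> var_entropy \<mu> (initial (Suc k)) / real (Suc k)" using h h'(1) h'(2)[of "Suc k"] by simp
    then have "real (Suc k) * h \<le> var_entropy \<mu> (initial (Suc k))" by (simp add: field_simps)
    then show ?thesis using info_mean[OF inv(1,2), of "Suc k"] by (simp add: EY_def Y_def)
  qed
  \<comment> \<open>With \<open>m\<close> complete blocks the left side is about
    \<open>m^2 / 2\<close> times \<open>t * (\<integral>x. \<psi> x \<partial>\<mu>)\<close>, while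
    the right side is at least about \<open>m^2 / 2\<close> times \<open>h\<close>; the strict
    inequality \<open>th\<close> absorbs all errors.\<close>
  have typical_mass: "eventually (\<lambda>n. t * \<Lambda> n (splice w) \<le> (\<Sum>k<block_of n. Y k (w k))) sequentially" if w: "typical w" for w
  proof -
    have wP: "w \<in> space ?P" using w by (simp add: typical_def)
    have "(\<lambda>m. ((\<Sum>k<m. Y k (w k)) - (\<Sum>k<m. EY k)) / (real m)\<^sup>2 + ((\<Sum>k<m. real (Suc k) * h) / (real m)\<^sup>2 - 1 / real m)) \<longlonglongrightarrow> 0 + (h / 2 - 0)"
      using w by (intro tendsto_add tendsto_diff sum_Suc_limit lim_const_over_n) (simp add: typical_def convY_def)
    from filterlim_compose[OF this block_of_at_top]
    have lim1: "(\<lambda>n. ((\<Sum>k<block_of n. Y k (w k)) - (\<Sum>k<block_of n. EY k)) / (real (block_of n))\<^sup>2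
        + ((\<Sum>k<block_of n. real (Suc k) * h) / (real (block_of n))\<^sup>2 - 1 / real (block_of n))) \<longlonglongrightarrow> h / 2"
      by simp
    have lim2: "(\<lambda>n. t * (\<Lambda> n (splice w) / (real (block_of n))\<^sup>2)) \<longlonglongrightarrow> t * ((\<integral>x. \<psi> x \<partial>\<mu>) / 2)"
      by (intro tendsto_mult tendsto_const sums[OF wP _ continuous_on_psi]) (use w in \<open>simp add: typical_def\<close>)
    have "0 < h / 2 - t * ((\<integral>x. \<psi> x \<partial>\<mu>) / 2)" using th by simp
    from order_tendstoD(1)[OF tendsto_diff[OF lim1 lim2] this] block_pos
    show ?thesis
    proof eventually_elim
      case (elim n)
      let ?m = "block_of n"
      have "(\<Sum>k<?m. real (Suc k) * h) - real ?m \<le> (\<Sum>k<?m. EY k)"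
        using sum_mono[of "{..<?m}" "\<lambda>k. real (Suc k) * h - 1" EY] EY_ge by (simp add: sum_subtractf)
      then have "((\<Sum>k<?m. real (Suc k) * h) - real ?m) / (real ?m)\<^sup>2 \<le> (\<Sum>k<?m. EY k) / (real ?m)\<^sup>2"
        by (rule divide_right_mono) simp
      moreover have "((\<Sum>k<?m. real (Suc k) * h) - real ?m) / (real ?m)\<^sup>2 = (\<Sum>k<?m. real (Suc k) * h) / (real ?m)\<^sup>2 - 1 / real ?m"
        using elim(2) by (simp add: diff_divide_distrib power2_eq_square)
      ultimately have "0 < (\<Sum>k<?m. Y k (w k)) / (real ?m)\<^sup>2 - t * (\<Lambda> n (splice w) / (real ?m)\<^sup>2)"
        using elim(1) by (simp add: diff_divide_distrib)
      then have "0 < ((\<Sum>k<?m. Y k (w k)) - t * \<Lambda> n (splice w)) / (real ?m)\<^sup>2" by (simp add: diff_divide_distrib)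
      then show ?case by (simp add: zero_less_divide_iff)
    qed
  qed
  \<comment> \<open>The block sequences whose complete blocks agree with those read off from
    \<open>x\<close>. Ignoring connectors and the unfinished block only enlarges the set and leaves
    a product of independent conditions.\<close>
  define box where "box n x = {w \<in> space ?P. \<forall>k<block_of n. w k \<in> {z \<in> X. initial (Suc k) z \<in> {initial (Suc k) ((left_shift ^^ start k) x)}}}" for n x
  have box_sets: "box n x \<in> P.events" for n x
    unfolding box_def by (rule prob_coordinates(1)[OF inv(1)]) (simp only: inv(2), rule initial_in_BX)
  have splice_initial: "initial (Suc k) ((left_shift ^^ start k) (splice w)) = initial (Suc k) (w k)" for w k
    using splice_block[of _ k w] by (auto simp: initial_eq_iff left_shift_funpow add.commute less_Suc_eq_le)
  have box_mem: "w \<in> box n x" if "w \<in> space ?P" "initial n (splice w) = initial n x" for w n x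
  proof -
    have "initial (Suc k) (w k) = initial (Suc k) ((left_shift ^^ start k) x)" if k: "k < block_of n" for k
    proof -
      have "start k + Suc k \<le> start (Suc k)" using LC(1) by (simp add: start_Suc)
      also have "\<dots> \<le> start (block_of n)" using k by (intro start_mono) simp
      also have "\<dots> \<le> n" by (rule block_of_bounds)
      finally have "\<forall>i<Suc k. splice w (i + start k) = x (i + start k)"
        using \<open>initial n (splice w) = initial n x\<close> by (simp add: initial_eq_iff)
      then have "initial (Suc k) ((left_shift ^^ start k) (splice w)) = initial (Suc k) ((left_shift ^^ start k) x)"
        by (simp add: initial_eq_iff left_shift_funpow)
      then show ?thesis by (simp only: splice_initial)
    qed
    then show ?thesis using spP[OF that(1)] that(1) by (simp add: box_def)
  qed
  have box_prob: "P.prob (box n (splice w)) \<le> exp (- (\<Sum>k<block_of n. Y k (w k)))" for n w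
  proof -
    have "P.prob (box n (splice w)) = (\<Prod>k<block_of n. word_mass \<mu> (Suc k) (w k))"
      unfolding box_def splice_initial word_mass_def
      by (rule prob_coordinates(2)[OF inv(1)]) (simp only: inv(2), rule initial_in_BX)
    also have "\<dots> \<le> (\<Prod>k<block_of n. exp (- Y k (w k)))"
      using word_mass_le[OF inv(1,2)] by (intro prod_mono) (auto simp: Y_def word_mass_def)
    also have "\<dots> = exp (- (\<Sum>k<block_of n. Y k (w k)))" by (simp only: sum_negf[symmetric] exp_sum finite_lessThan)
    finally show ?thesis .
  qed
  obtain K C3 :: real and \<delta> where C3: "0 < C3" and \<delta>: "\<And>N. 0 < \<delta> N" and K: "0 \<le> K"
    and cover: "\<And>d N S. \<lbrakk>0 < d; d < \<delta> N; S \<subseteq> X; \<And>x y. x \<in> S \<Longrightarrow> y \<in> S \<Longrightarrow> dist (\<pi> x) (\<pi> y) \<le> d\<rbrakk> \<Longrightarrow>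
      \<exists>F len. finite F \<and> F \<subseteq> S \<and> real (card F) \<le> K \<and>
        (\<forall>x\<in>S. \<exists>y\<in>F. initial (len y) x = initial (len y) y) \<and>
        (\<forall>y\<in>F. N \<le> len y \<and> exp (- \<Lambda> (len y) y) \<le> C3 * d)"
  proof (rule scale_cover)
    fix K C3 :: real and \<delta> :: "nat \<Rightarrow> real"
    assume A: "0 < C3" "\<And>N. 0 < \<delta> N" "0 \<le> K"
      "\<And>d N S. \<lbrakk>0 < d; d < \<delta> N; S \<subseteq> X; \<And>x y. x \<in> S \<Longrightarrow> y \<in> S \<Longrightarrow> dist (\<pi> x) (\<pi> y) \<le> d\<rbrakk> \<Longrightarrow>
      \<exists>F len. finite F \<and> F \<subseteq> S \<and> real (card F) \<le> K \<and>
        (\<forall>x\<in>S. \<exists>y\<in>F. initial (len y) x = initial (len y) y) \<and>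
        (\<forall>y\<in>F. N \<le> len y \<and> exp (- \<Lambda> (len y) y) \<le> C3 * d)"
    show thesis by (rule that) (fact A)+
  qed
  \<comment> \<open>The mass estimate holds from a time that depends on \<open>w\<close>; on
    \<open>Q N\<close> it holds from \<open>N\<close> on.\<close>
  define Q where "Q N = {w. typical w \<and> (\<forall>n\<ge>N. t * \<Lambda> n (splice w) \<le> (\<Sum>k<block_of n. Y k (w k)))}" for N
  \<comment> \<open>All sequences spliced into a set of diameter at most \<open>d\<close> lie in at
    most \<open>K\<close> boxes. The base points of the boxes are themselves spliced from
    \<open>Q N\<close>, so each box has probability at most \<open>(C3 * d) powr t\<close>.\<close>
  have piece: "\<exists>W\<in>P.events. {w \<in> Q N. \<pi> (splice w) \<in> V} \<subseteq> W \<and> P.prob W \<le> K * (C3 powr t * d powr t)"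
    if d: "0 < d" "d < \<delta> N" and V: "\<And>u v. u \<in> V \<Longrightarrow> v \<in> V \<Longrightarrow> dist u v \<le> d" for N d V
  proof -
    define S where "S = splice ` {w \<in> Q N. \<pi> (splice w) \<in> V}"
    have QP: "w \<in> space ?P" if "w \<in> Q N" for w using that by (simp add: Q_def typical_def)
    have SX: "S \<subseteq> X" using splice_X[OF spP[OF QP]] by (auto simp: S_def)
    have "dist (\<pi> x) (\<pi> y) \<le> d" if "x \<in> S" "y \<in> S" for x y using that V by (auto simp: S_def)
    from cover[OF d SX this] obtain F len where F: "finite F" "F \<subseteq> S" "real (card F) \<le> K"
      and near: "\<forall>x\<in>S. \<exists>y\<in>F. initial (len y) x = initial (len y) y"
      and size: "\<forall>y\<in>F. N \<le> len y \<and> exp (- \<Lambda> (len y) y) \<le> C3 * d" by blast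
    define W where "W = (\<Union>y\<in>F. box (len y) y)"
    have "W \<in> P.events" unfolding W_def using F(1) box_sets by (intro sets.finite_UN) auto
    moreover have "{w \<in> Q N. \<pi> (splice w) \<in> V} \<subseteq> W"
    proof
      fix w assume w: "w \<in> {w \<in> Q N. \<pi> (splice w) \<in> V}"
      then have "splice w \<in> S" by (auto simp: S_def)
      then obtain y where y: "y \<in> F" "initial (len y) (splice w) = initial (len y) y" using near by blast
      then show "w \<in> W" using box_mem[OF QP, of w "len y" y] w by (auto simp: W_def)
    qed
    moreover have "P.prob W \<le> K * (C3 powr t * d powr t)"
    proof -
      have "P.prob W \<le> (\<Sum>y\<in>F. P.prob (box (len y) y))"
        unfolding W_def using F(1) box_sets by (intro measure_UNION_le) auto
      also have "\<dots> \<le> (\<Sum>y\<in>F. C3 powr t * d powr t)"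
      proof (rule sum_mono)
        fix y assume y: "y \<in> F"
        then obtain w where w: "w \<in> Q N" "y = splice w" using F(2) by (auto simp: S_def)
        have len: "N \<le> len y" "exp (- \<Lambda> (len y) y) \<le> C3 * d" using size y by blast+
        have "P.prob (box (len y) y) \<le> exp (- (\<Sum>k<block_of (len y). Y k (w k)))"
          unfolding w(2) by (rule box_prob)
        also have "\<dots> \<le> exp (- (t * \<Lambda> (len y) y))" using w len(1) by (simp add: Q_def)
        also have "\<dots> = exp (- \<Lambda> (len y) y) powr t" by (simp add: exp_powr_real mult.commute)
        also have "\<dots> \<le> (C3 * d) powr t" using len(2) t by (intro powr_mono2) auto
        also have "\<dots> = C3 powr t * d powr t" using C3 d by (simp add: powr_mult)
        finally show "P.prob (box (len y) y) \<le> C3 powr t * d powr t" .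
      qed
      also have "\<dots> = real (card F) * (C3 powr t * d powr t)" by simp
      also have "\<dots> \<le> K * (C3 powr t * d powr t)" using F(3) by (intro mult_right_mono) auto
      finally show ?thesis .
    qed
    ultimately show ?thesis by blast
  qed
  show "hausdorff_measure t (\<pi> ` level) \<noteq> 0"
  proof
    assume null: "hausdorff_measure t (\<pi> ` level) = 0"
    define B where "B = K * C3 powr t"
    have B: "0 \<le> B" using K by (simp add: B_def)
    have small: "\<exists>W\<in>P.events. Q N \<subseteq> W \<and> P.prob W \<le> B * e" if e: "0 < e" for N e
    proof -
      have pos: "0 < \<delta> N / 2" "0 < e / 2" using \<delta>[of N] e by simp_all
      from null[unfolded hausdorff_null_iff, rule_format, OF pos]
      obtain V :: "nat \<Rightarrow> 'e set" where V': "\<pi> ` level \<subseteq> (\<Union>i. V i) \<and> (\<forall>i. bounded (V i) \<and> diameter (V i) \<le> \<delta> N / 2) \<and>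
        (\<Sum>i. ennreal (diameter_power t (V i))) < ennreal (e / 2)" by (elim exE)
      then have V: "\<pi> ` level \<subseteq> (\<Union>i. V i)" "\<And>i. bounded (V i) \<and> diameter (V i) \<le> \<delta> N / 2"
        and sumV: "(\<Sum>i. ennreal (diameter_power t (V i))) < ennreal (e / 2)" by simp_all
      \<comment> \<open>Slack for covering sets of diameter zero, for which a positive scale
        \<open>d\<close> has to be invented; it adds up to \<open>e / 2\<close>.\<close>
      define r where "r i = e / 2 * (1/2) ^ Suc i" for i
      have r: "0 < r i" for i using e by (simp add: r_def)
      have "\<exists>W\<in>P.events. {w \<in> Q N. \<pi> (splice w) \<in> V i} \<subseteq> W \<and> P.prob W \<le> B * (diameter_power t (V i) + r i)" for i
      proof (cases "V i = {}")
        case True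
        then show ?thesis using B r[of i] by (intro bexI[of _ "{}"]) (auto simp: diameter_power_def)
      next
        case False
        \<comment> \<open>A positive diameter serves itself. For diameter zero and
          \<open>t = 0\<close> any admissible scale works, as both powers are 1; otherwise
          \<open>d\<close> is so small that \<open>d powr t \<le> r i\<close>.\<close>
        have "\<exists>d. 0 < d \<and> d < \<delta> N \<and> diameter (V i) \<le> d \<and> d powr t \<le> diameter_power t (V i) + r i"
        proof (cases "diameter (V i) = 0")
          case False
          then have "0 < diameter (V i)" using diameter_ge_0[of "V i"] V(2)[of i] by simp
          then show ?thesis using \<open>V i \<noteq> {}\<close> V(2)[of i] \<delta>[of N] r[of i]
            by (intro exI[of _ "diameter (V i)"]) (auto simp: diameter_power_def)
        next
          case True
          show ?thesis
          proof (cases "t = 0")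
            case True
            then show ?thesis using \<open>V i \<noteq> {}\<close> \<open>diameter (V i) = 0\<close> \<delta>[of N] r[of i]
              by (intro exI[of _ "\<delta> N / 2"]) (auto simp: diameter_power_def)
          next
            case False
            then have t0: "0 < t" using t by simp
            define d where "d = min (\<delta> N / 2) (r i powr (1 / t))"
            have "d powr t \<le> (r i powr (1 / t)) powr t" using \<delta>[of N] r[of i] t by (intro powr_mono2) (auto simp: d_def)
            also have "\<dots> = r i" using t0 r[of i] by (simp add: powr_powr)
            finally show ?thesis using \<delta>[of N] r[of i] \<open>diameter (V i) = 0\<close>
              by (intro exI[of _ d]) (auto simp: d_def diameter_power_def)
          qed
        qed
        then obtain d where d: "0 < d" "d < \<delta> N" "diameter (V i) \<le> d" "d powr t \<le> diameter_power t (V i) + r i" by blast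
        have dV: "dist u v \<le> d" if "u \<in> V i" "v \<in> V i" for u v
          using diameter_bounded_bound[of "V i" u v] V(2)[of i] that d(3) by simp
        obtain W where W: "W \<in> P.events" "{w \<in> Q N. \<pi> (splice w) \<in> V i} \<subseteq> W" "P.prob W \<le> K * (C3 powr t * d powr t)"
          using piece[OF d(1,2) dV] by blast
        have "K * (C3 powr t * d powr t) = B * d powr t" by (simp add: B_def)
        also have "\<dots> \<le> B * (diameter_power t (V i) + r i)" by (rule mult_left_mono[OF d(4) B])
        finally show ?thesis using W by (intro bexI[of _ W]) auto
      qed
      then have "\<forall>i. \<exists>W. W \<in> P.events \<and> {w \<in> Q N. \<pi> (splice w) \<in> V i} \<subseteq> W \<and> P.prob W \<le> B * (diameter_power t (V i) + r i)"
        by blast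
      from choice[OF this] obtain W where W: "\<And>i. W i \<in> P.events" "\<And>i. {w \<in> Q N. \<pi> (splice w) \<in> V i} \<subseteq> W i"
        "\<And>i. P.prob (W i) \<le> B * (diameter_power t (V i) + r i)" by blast
      have "Q N \<subseteq> (\<Union>i. W i)"
      proof
        fix w assume w: "w \<in> Q N"
        then have "splice w \<in> level" using typical_level by (simp add: Q_def)
        then obtain i where "\<pi> (splice w) \<in> V i" using V(1) by blast
        then have "w \<in> W i" using W(2)[of i] w by blast
        then show "w \<in> (\<Union>i. W i)" by blast
      qed
      moreover have "P.prob (\<Union>i. W i) \<le> B * e"
      proof -
        have dp0: "0 \<le> diameter_power t (V i)" for i by (simp add: diameter_power_def)
        have "emeasure ?P (\<Union>i. W i) \<le> (\<Sum>i. emeasure ?P (W i))" using W(1) by (intro emeasure_subadditive_countably) auto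
        also have "\<dots> \<le> (\<Sum>i. ennreal B * (ennreal (diameter_power t (V i)) + ennreal (r i)))"
        proof (rule suminf_le)
          fix i
          have "emeasure ?P (W i) = ennreal (P.prob (W i))" by (rule P.emeasure_eq_measure)
          also have "\<dots> \<le> ennreal (B * (diameter_power t (V i) + r i))" using W(3) by (rule ennreal_leI)
          also have "\<dots> = ennreal B * (ennreal (diameter_power t (V i)) + ennreal (r i))"
            using B dp0[of i] r[of i] by (simp add: ennreal_mult ennreal_plus)
          finally show "emeasure ?P (W i) \<le> ennreal B * (ennreal (diameter_power t (V i)) + ennreal (r i))" .
        qed auto
        also have "\<dots> = ennreal B * ((\<Sum>i. ennreal (diameter_power t (V i))) + (\<Sum>i. ennreal (r i)))"
          by (simp add: suminf_add[symmetric])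
        also have "(\<Sum>i. ennreal (r i)) = ennreal (e / 2)"
        proof -
          have "r sums (e / 2 * 1)" unfolding r_def by (intro sums_mult power_half_series)
          then show ?thesis using r by (intro suminf_ennreal_eq) (auto simp: less_imp_le)
        qed
        also have "ennreal B * ((\<Sum>i. ennreal (diameter_power t (V i))) + ennreal (e / 2)) \<le> ennreal B * (ennreal (e / 2) + ennreal (e / 2))"
          using sumV by (intro mult_left_mono add_right_mono) (auto simp: less_imp_le)
        also have "\<dots> = ennreal (B * e)" using B e by (simp flip: ennreal_plus ennreal_mult)
        finally show ?thesis using B e by (simp add: P.emeasure_eq_measure)
      qed
      moreover have "(\<Union>i. W i) \<in> P.events" using W(1) by auto
      ultimately show ?thesis by blast
    qed
    \<comment> \<open>As \<open>B / (B + 1) \<le> 1\<close>, the probabilities are at most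
      \<open>1 / 4 * (1/2) ^ N\<close> and add up to at most \<open>1 / 2\<close>, although the
      \<open>Q N\<close> exhaust almost every sequence.\<close>
    have "\<forall>N. \<exists>W. W \<in> P.events \<and> Q N \<subseteq> W \<and> P.prob W \<le> B * (1 / (4 * (B + 1)) * (1/2) ^ N)"
    proof
      fix N
      have "0 < 1 / (4 * (B + 1)) * (1/2 :: real) ^ N" using B by simp
      from small[OF this] show "\<exists>W. W \<in> P.events \<and> Q N \<subseteq> W \<and> P.prob W \<le> B * (1 / (4 * (B + 1)) * (1/2) ^ N)" by blast
    qed
    from choice[OF this] obtain W where W: "\<And>N. W N \<in> P.events" "\<And>N. Q N \<subseteq> W N"
      "\<And>N. P.prob (W N) \<le> B * (1 / (4 * (B + 1)) * (1/2) ^ N)" by blast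
    have W4: "P.prob (W N) \<le> 1 / 4 * (1/2) ^ N" for N
    proof -
      have "B * (1 / (4 * (B + 1)) * (1/2) ^ N) = B / (B + 1) * (1 / 4 * (1/2) ^ N)" by simp
      also have "\<dots> \<le> 1 * (1 / 4 * (1/2) ^ N)" using B by (intro mult_right_mono) auto
      finally show ?thesis using W(3)[of N] by linarith
    qed
    have "AE w in ?P. w \<in> (\<Union>N. W N)"
      using AE_typical
    proof (rule AE_mp, intro AE_I2 impI)
      fix w assume w: "typical w"
      then obtain N where "\<forall>n\<ge>N. t * \<Lambda> n (splice w) \<le> (\<Sum>k<block_of n. Y k (w k))"
        using typical_mass unfolding eventually_sequentially by blast
      then have "w \<in> Q N" using w by (simp add: Q_def)
      then show "w \<in> (\<Union>N. W N)" using W(2) by blast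
    qed
    moreover have Wev: "(\<Union>N. W N) \<in> P.events" using W(1) by auto
    ultimately have "1 = emeasure ?P (\<Union>N. W N)" by (intro P.emeasure_eq_1_AE[symmetric])
    also have "emeasure ?P (\<Union>N. W N) \<le> (\<Sum>N. emeasure ?P (W N))" using W(1) by (intro emeasure_subadditive_countably) auto
    also have "\<dots> \<le> (\<Sum>N. ennreal (1 / 4 * (1/2) ^ N))"
      using W4 by (intro suminf_le) (auto simp: P.emeasure_eq_measure intro: ennreal_leI)
    also have "\<dots> = ennreal (1 / 2)"
    proof -
      have "(\<lambda>N. 1 / 4 * (1/2 :: real) ^ N) sums (1 / 4 * (1 / (1 - 1 / 2)))"
        by (intro sums_mult geometric_sums) simp
      then show ?thesis by (intro suminf_ennreal_eq) auto
    qed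
    also have "\<dots> < ennreal 1" by (subst ennreal_less_iff) auto
    finally show False by simp
  qed
qed

end

section \<open>The dimension spectrum\<close>

lemma abs_ln_diff_le:
  fixes u v m :: real
  assumes "0 < m" "m \<le> u" "m \<le> v"
  shows "\<bar>ln u - ln v\<bar> \<le> \<bar>u - v\<bar> / m"
proof -
  have *: "ln x - ln y \<le> \<bar>x - y\<bar> / m" if "m \<le> x" "m \<le> y" for x y
  proof -
    have pos: "0 < x" "0 < y" using that assms(1) by auto
    have "ln x - ln y \<le> (x - y) / y" by (rule ln_diff_le[OF pos])
    also have "\<dots> \<le> \<bar>x - y\<bar> / y" using pos by (intro divide_right_mono) auto
    also have "\<dots> \<le> \<bar>x - y\<bar> / m" using that assms(1) by (intro divide_left_mono) auto
    finally show ?thesis .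
  qed
  show ?thesis using *[of u v] *[of v u] assms by (simp add: abs_le_iff abs_minus_commute)
qed

lemma derivative_norm_le_lipschitz:
  fixes w :: "'e::real_normed_vector \<Rightarrow> 'e"
  assumes D: "(w has_derivative D) (at z)" and lip: "\<And>x y. dist (w x) (w y) \<le> c * dist x y"
  shows "norm (D v) \<le> c * norm v"
proof -
  have lin: "linear D" using D by (rule has_derivative_linear)
  have "norm (D v) \<le> c * norm v + e * norm v" if e: "0 < e" for e
  proof -
    obtain d where d: "0 < d" "\<And>y. norm (y - z) < d \<Longrightarrow> norm (w y - w z - D (y - z)) \<le> e * norm (y - z)"
      using D e unfolding has_derivative_at_alt by blast
    \<comment> \<open>A step with \<open>t * norm v < d\<close>; adding 1 in the denominator covers
      \<open>v = 0\<close>.\<close>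
    define t where "t = d / (2 * (norm v + 1))"
    have nv: "0 < norm v + 1" by (simp add: add_nonneg_pos)
    have t: "0 < t" using d(1) nv by (simp add: t_def)
    have "norm v / (2 * (norm v + 1)) < 1" using nv by (simp add: field_simps)
    then have "d * (norm v / (2 * (norm v + 1))) < d * 1" using d(1) by (rule mult_strict_left_mono)
    then have "norm ((z + t *\<^sub>R v) - z) < d" using t d(1) by (simp add: t_def)
    from d(2)[OF this] have "norm (w (z + t *\<^sub>R v) - w z - D (t *\<^sub>R v)) \<le> e * (t * norm v)" using t by simp
    moreover have "norm (w (z + t *\<^sub>R v) - w z) \<le> c * (t * norm v)"
      using lip[of "z + t *\<^sub>R v" z] t by (simp add: dist_norm)
    moreover have "norm (D (t *\<^sub>R v)) \<le> norm (w (z + t *\<^sub>R v) - w z) + norm (w (z + t *\<^sub>R v) - w z - D (t *\<^sub>R v))"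
      by (metis norm_minus_commute norm_triangle_sub add.commute)
    moreover have "norm (D (t *\<^sub>R v)) = t * norm (D v)" using t by (simp add: linear_scale[OF lin])
    ultimately have "t * norm (D v) \<le> t * (c * norm v + e * norm v)" by (simp add: algebra_simps)
    then show ?thesis using t by simp
  qed
  then have *: "norm (D v) \<le> c * norm v + e" if "0 < e" for e
  proof -
    have "0 < norm v + 1" by (simp add: add_nonneg_pos)
    then have "0 < e / (norm v + 1)" using that by simp
    from \<open>\<And>e. 0 < e \<Longrightarrow> norm (D v) \<le> c * norm v + e * norm v\<close>[OF this]
    have "norm (D v) \<le> c * norm v + e * (norm v / (norm v + 1))" by simp
    also have "\<dots> \<le> c * norm v + e * 1" using that \<open>0 < norm v + 1\<close> by (intro add_left_mono mult_left_mono) auto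
    finally show ?thesis by simp
  qed
  then show ?thesis by (rule field_le_epsilon)
qed

text \<open>The lower bound for the derivative comes from the boundedness of the derivative of the
  inverse map.\<close>

lemma conformal_map_bounds:
  fixes w :: "'e::euclidean_space \<Rightarrow> 'e" and s :: "'e \<Rightarrow> real"
  assumes gamma: "0 < \<gamma>" and diffeo: "C1_holder_diffeomorphism \<gamma> w"
    and lip: "\<And>x y. dist (w x) (w y) \<le> c * dist x y"
    and sim: "\<And>x v. norm (frechet_derivative w (at x) v) = s x * norm v"
    and Rad: "0 < Rad" and maps: "\<And>z. z \<in> cball 0 Rad \<Longrightarrow> w z \<in> cball 0 Rad"
  shows "\<exists>D. (w has_derivative D) (at z) \<and> (\<forall>v. norm (D v) = s z * norm v)"
    and "s z \<le> c"
    and "inv w differentiable (at z)"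
    and "\<exists>m>0. \<exists>H\<ge>0. \<forall>x\<in>cball 0 Rad. m \<le> s x \<and> (\<forall>y\<in>cball 0 Rad. \<bar>ln (s x) - ln (s y)\<bar> \<le> H * dist x y powr \<gamma>)"
proof -
  have bij: "bij w" and w: "C1_holder \<gamma> w" and inv: "C1_holder \<gamma> (inv w)"
    using diffeo by (auto simp: C1_holder_diffeomorphism_def)
  obtain w' :: "'e \<Rightarrow> 'e \<Rightarrow>\<^sub>L 'e" where w': "\<And>x. (w has_derivative blinfun_apply (w' x)) (at x)"
    and w'_holder: "\<And>K. compact K \<Longrightarrow> \<exists>c. \<forall>x\<in>K. \<forall>y\<in>K. norm (w' x - w' y) \<le> c * dist x y powr \<gamma>"
    using w unfolding C1_holder_def by blast
  obtain v' :: "'e \<Rightarrow> 'e \<Rightarrow>\<^sub>L 'e" where v': "\<And>x. (inv w has_derivative blinfun_apply (v' x)) (at x)"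
    and v'_holder: "\<And>K. compact K \<Longrightarrow> \<exists>c. \<forall>x\<in>K. \<forall>y\<in>K. norm (v' x - v' y) \<le> c * dist x y powr \<gamma>"
    using inv unfolding C1_holder_def by blast
  have norm_w': "norm (blinfun_apply (w' x) v) = s x * norm v" for x v
    using sim[of x v] frechet_derivative_at[OF w'[of x]] by simp
  show D: "\<exists>D. (w has_derivative D) (at z) \<and> (\<forall>v. norm (D v) = s z * norm v)" using w' norm_w' by blast
  show "inv w differentiable (at z)" using v' by (auto simp: differentiable_def)
  obtain b :: 'e where b: "b \<in> Basis" using nonempty_Basis by blast
  then have b1: "norm b = 1" by simp
  show "s z \<le> c" using derivative_norm_le_lipschitz[OF w' lip, of z b] norm_w'[of z b] b1 by simp
  let ?B = "cball (0 :: 'e) Rad"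
  obtain K1 where K1: "\<forall>x\<in>?B. \<forall>y\<in>?B. norm (w' x - w' y) \<le> K1 * dist x y powr \<gamma>" using w'_holder[of ?B] by auto
  obtain K2 where K2: "\<forall>x\<in>?B. \<forall>y\<in>?B. norm (v' x - v' y) \<le> K2 * dist x y powr \<gamma>" using v'_holder[of ?B] by auto
  \<comment> \<open>The Hoelder condition against the centre \<open>0\<close> bounds the derivative
    of the inverse on the ball; adding 1 makes the bound positive.\<close>
  define M where "M = norm (v' 0) + \<bar>K2\<bar> * Rad powr \<gamma> + 1"
  have M: "0 < M" by (simp add: M_def add_nonneg_pos)
  have v'_le: "norm (v' y) \<le> M" if y: "y \<in> ?B" for y
  proof -
    have "norm (v' y - v' 0) \<le> K2 * dist y 0 powr \<gamma>" using K2[rule_format, OF y, of 0] Rad by simp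
    also have "\<dots> \<le> \<bar>K2\<bar> * Rad powr \<gamma>" using y gamma by (intro mult_mono powr_mono2) auto
    finally show ?thesis using norm_triangle_sub[of "v' y" "v' 0"] by (simp add: M_def)
  qed
  have s_ge: "1 / M \<le> s x" if x: "x \<in> ?B" for x
  proof -
    have "inv w \<circ> w = id" using bij by (simp add: bij_is_inj)
    then have "(id has_derivative blinfun_apply (v' (w x)) \<circ> blinfun_apply (w' x)) (at x)"
      using diff_chain_at[OF w'[of x] v'[of "w x"]] by simp
    then have "blinfun_apply (v' (w x)) \<circ> blinfun_apply (w' x) = id"
      using has_derivative_unique[OF _ has_derivative_id] by (auto simp: id_def)
    then have "b = blinfun_apply (v' (w x)) (blinfun_apply (w' x) b)" by (metis comp_apply id_apply)
    then have "1 = norm (blinfun_apply (v' (w x)) (blinfun_apply (w' x) b))" using b1 by simp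
    also have "\<dots> \<le> norm (v' (w x)) * norm (blinfun_apply (w' x) b)" by (rule norm_blinfun)
    also have "norm (blinfun_apply (w' x) b) = s x" using norm_w'[of x b] b1 by simp
    finally have 1: "1 \<le> norm (v' (w x)) * s x" .
    have s0: "0 \<le> s x" using norm_w'[of x b] b1 norm_ge_zero[of "blinfun_apply (w' x) b"] by simp
    have "norm (v' (w x)) * s x \<le> M * s x" using v'_le[OF maps[OF x]] s0 by (rule mult_right_mono)
    then show ?thesis using 1 M by (simp add: field_simps)
  qed
  have s_holder: "\<bar>s x - s y\<bar> \<le> \<bar>K1\<bar> * dist x y powr \<gamma>" if "x \<in> ?B" "y \<in> ?B" for x y
  proof -
    have "\<bar>s x - s y\<bar> = \<bar>norm (blinfun_apply (w' x) b) - norm (blinfun_apply (w' y) b)\<bar>" using norm_w' b1 by simp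
    also have "\<dots> \<le> norm (blinfun_apply (w' x) b - blinfun_apply (w' y) b)" by (rule norm_triangle_ineq3)
    also have "\<dots> = norm (blinfun_apply (w' x - w' y) b)" by (simp add: blinfun.diff_left)
    also have "\<dots> \<le> norm (w' x - w' y) * norm b" by (rule norm_blinfun)
    also have "\<dots> \<le> K1 * dist x y powr \<gamma>" using K1 that b1 by simp
    also have "\<dots> \<le> \<bar>K1\<bar> * dist x y powr \<gamma>" by (intro mult_right_mono) auto
    finally show ?thesis .
  qed
  show "\<exists>m>0. \<exists>H\<ge>0. \<forall>x\<in>?B. m \<le> s x \<and> (\<forall>y\<in>?B. \<bar>ln (s x) - ln (s y)\<bar> \<le> H * dist x y powr \<gamma>)"
  proof (rule exI[of _ "1 / M"], intro conjI, simp add: M, rule exI[of _ "\<bar>K1\<bar> * M"], intro conjI ballI)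
    show "0 \<le> \<bar>K1\<bar> * M" using M by simp
    fix x y assume x: "x \<in> ?B" and y: "y \<in> ?B"
    have "\<bar>ln (s x) - ln (s y)\<bar> \<le> \<bar>s x - s y\<bar> / (1 / M)"
      using M s_ge[OF x] s_ge[OF y] by (intro abs_ln_diff_le) auto
    also have "\<dots> \<le> \<bar>K1\<bar> * dist x y powr \<gamma> / (1 / M)"
      using s_holder[OF x y] M by (intro divide_right_mono) auto
    finally show "\<bar>ln (s x) - ln (s y)\<bar> \<le> \<bar>K1\<bar> * M * dist x y powr \<gamma>" by (simp add: mult_ac)
  qed (rule s_ge)
qed

text \<open>Since \<open>\<psi>\<close> is bounded below by \<open>- ln c > 0\<close>, the quotients
  may be cleared of denominators. If no invariant measure has its ratio in \<open>C\<close>, the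
  upper bound excludes even the exponent \<open>0\<close>, so \<open>level\<close> is empty and both
  sides are minus infinity.\<close>

lemma (in ratio_spectrum) dimension_formula:
  "hausdorff_dim (\<pi> ` level) = (SUP \<mu>\<in>{\<mu> \<in> invariants. mean_ratio \<mu> \<in> C}.
     metric_entropy left_shift \<mu> / ereal (\<integral>x. \<psi> x \<partial>\<mu>))"
proof -
  have pos: "0 < (\<integral>x. \<psi> x \<partial>\<mu>)" if mu: "\<mu> \<in> invariants" for \<mu>
  proof -
    note inv = invariantsD[OF mu]
    have "- ln c \<le> (\<integral>x. \<psi> x \<partial>\<mu>)"
      by (rule prob_space.integral_ge_const[OF inv(1) integrable_continuous_X[OF inv(1,2) continuous_on_psi]])
         (use psi_ge inv(3) in auto)
    then show ?thesis using c ln_less_zero[of c] by linarith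
  qed
  show ?thesis
  proof (rule antisym)
    show "hausdorff_dim (\<pi> ` level) \<le> (SUP \<mu>\<in>{\<mu> \<in> invariants. mean_ratio \<mu> \<in> C}.
     metric_entropy left_shift \<mu> / ereal (\<integral>x. \<psi> x \<partial>\<mu>))"
    proof (rule hausdorff_dim_leI)
      fix t :: real assume "0 \<le> t" "hausdorff_measure t (\<pi> ` level) \<noteq> 0"
      then obtain \<mu> h where mu: "\<mu> \<in> invariants" "mean_ratio \<mu> \<in> C" "metric_entropy left_shift \<mu> = ereal h"
        "t * (\<integral>x. \<psi> x \<partial>\<mu>) \<le> h"
        by (rule spectrum_upper)
      have "ereal t \<le> metric_entropy left_shift \<mu> / ereal (\<integral>x. \<psi> x \<partial>\<mu>)"
        using mu(3,4) pos[OF mu(1)] by (simp add: pos_le_divide_eq)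
      then show "ereal t \<le> (SUP \<mu>\<in>{\<mu> \<in> invariants. mean_ratio \<mu> \<in> C}.
         metric_entropy left_shift \<mu> / ereal (\<integral>x. \<psi> x \<partial>\<mu>))"
        using mu(1,2) by (intro SUP_upper2[of \<mu>]) auto
    qed
  next
    show "(SUP \<mu>\<in>{\<mu> \<in> invariants. mean_ratio \<mu> \<in> C}.
     metric_entropy left_shift \<mu> / ereal (\<integral>x. \<psi> x \<partial>\<mu>)) \<le> hausdorff_dim (\<pi> ` level)"
    proof (rule SUP_least)
      fix \<mu> assume "\<mu> \<in> {\<mu> \<in> invariants. mean_ratio \<mu> \<in> C}"
      then have mu: "\<mu> \<in> invariants" "mean_ratio \<mu> \<in> C" by auto
      obtain h where h: "metric_entropy left_shift \<mu> = ereal h" using metric_entropy_blocks[OF mu(1)] by metis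
      show "metric_entropy left_shift \<mu> / ereal (\<integral>x. \<psi> x \<partial>\<mu>) \<le> hausdorff_dim (\<pi> ` level)"
      proof (rule hausdorff_dim_geI)
        show "\<pi> ` level \<noteq> {}" using spectrum_lower(1)[OF mu h] by simp
        fix t :: real assume t: "0 \<le> t" "ereal t < metric_entropy left_shift \<mu> / ereal (\<integral>x. \<psi> x \<partial>\<mu>)"
        have "t * (\<integral>x. \<psi> x \<partial>\<mu>) < h" using t(2) pos[OF mu(1)] by (simp add: h pos_less_divide_eq)
        then show "hausdorff_measure t (\<pi> ` level) \<noteq> 0" by (rule spectrum_lower(2)[OF mu h t(1)])
      qed
    qed
  qed
qed

theorem corollary5p11:
  fixes p :: nat
    and a :: "nat \<Rightarrow> nat \<Rightarrow> nat"
    and \<omega> :: "nat \<Rightarrow> nat \<Rightarrow> real ^ 'q \<Rightarrow> real ^ 'q"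
    and s :: "nat \<Rightarrow> nat \<Rightarrow> real ^ 'q \<Rightarrow> real"
    and \<gamma> :: real
    and E :: "nat \<Rightarrow> (real ^ 'q) set"
    and f g :: "'m::finite \<Rightarrow> (nat \<Rightarrow> nat) \<Rightarrow> real"
    and C :: "(real ^ 'm) set"
  assumes "p \<ge> 2"
    and "zero_one_matrix p a"
    and "irreducible_aperiodic p a"
    and "\<And>i j. \<lbrakk>i \<in> {1..p}; j \<in> {1..p}; a i j = 1\<rbrakk> \<Longrightarrow> lipschitz_contraction (\<omega> i j)"
    and "recurrent_attractor p a \<omega> E"
    and "0 < \<gamma>" and "\<gamma> \<le> 1"
    and "\<And>i j. \<lbrakk>i \<in> {1..p}; j \<in> {1..p}; a i j = 1\<rbrakk> \<Longrightarrow> C1_holder_diffeomorphism \<gamma> (\<omega> i j)"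
    and "\<And>i j x v. \<lbrakk>i \<in> {1..p}; j \<in> {1..p}; a i j = 1\<rbrakk>
           \<Longrightarrow> norm (frechet_derivative (\<omega> i j) (at x) v) = s i j x * norm v"
    and "open_set_condition p a \<omega>"
    and "\<And>i. continuous_on (subshift p a) (f i)"
    and "\<And>i. continuous_on (subshift p a) (g i)"
    and "\<And>i x. x \<in> subshift p a \<Longrightarrow> g i x \<noteq> 0"
    and "\<And>i \<mu>. \<mu> \<in> invariant_measures (subshift p a) left_shift \<Longrightarrow> (\<integral>x. g i x \<partial>\<mu>) \<noteq> 0"
    and "closed C" and "convex C"
  shows "hausdorff_dim
           (coding_map \<omega> E `
             {x \<in> subshift p a.
                accumulation_points {n. \<forall>j. ergodic_sum left_shift (g j) n x \<noteq> 0}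
                  (\<lambda>n. \<chi> j. ergodic_sum left_shift (f j) n x / ergodic_sum left_shift (g j) n x)
                \<subseteq> C})
         = (SUP \<mu>\<in>{\<mu> \<in> invariant_measures (subshift p a) left_shift.
                     (\<chi> i. (\<integral>x. f i x \<partial>\<mu>) / (\<integral>x. g i x \<partial>\<mu>)) \<in> C}.
              metric_entropy left_shift \<mu> /
              ereal (- (\<integral>x. ln (s (x 0) (x 1) (coding_map \<omega> E (left_shift x))) \<partial>\<mu>)))"
proof -
  note zero_one = assms(2) and irred = assms(3) and contr = assms(4) and attr = assms(5) and gamma = assms(6)
    and diffeo = assms(8) and sim = assms(9) and osc = assms(10)
  define Ed where "Ed = {(i, j). i \<in> {1..p} \<and> j \<in> {1..p} \<and> a i j = 1}"
  have Ed: "finite Ed" by (rule finite_subset[of _ "{1..p} \<times> {1..p}"]) (auto simp: Ed_def)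
  have EdI: "(i, j) \<in> Ed" if "i \<in> {1..p}" "j \<in> {1..p}" "a i j = 1" for i j using that by (simp add: Ed_def)
  have "\<forall>e\<in>Ed. \<exists>c<1. c-lipschitz_on UNIV (\<omega> (fst e) (snd e))"
    using contr by (auto simp: Ed_def lipschitz_contraction_def)
  then obtain cf where cf: "\<forall>e\<in>Ed. cf e < 1 \<and> (cf e)-lipschitz_on UNIV (\<omega> (fst e) (snd e))" by metis
  \<comment> \<open>Including \<open>1/2\<close> makes the common contraction ratio positive
    whatever the individual Lipschitz constants are.\<close>
  define c where "c = Max (insert (1/2) (cf ` Ed))"
  have c: "0 < c" "c < 1"
  proof -
    have "1 / 2 \<le> c" unfolding c_def using Ed by (intro Max_ge) auto
    then show "0 < c" by simp
    show "c < 1" unfolding c_def using Ed cf by (subst Max_less_iff) auto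
  qed
  have lip: "dist (\<omega> i j x) (\<omega> i j y) \<le> c * dist x y" if "i \<in> {1..p}" "j \<in> {1..p}" "a i j = 1" for i j x y
  proof -
    have e: "(i, j) \<in> Ed" by (rule EdI[OF that])
    then have "dist (\<omega> i j x) (\<omega> i j y) \<le> cf (i, j) * dist x y" using cf lipschitz_onD by fastforce
    also have "\<dots> \<le> c * dist x y" unfolding c_def using Ed e by (intro mult_right_mono Max_ge) auto
    finally show ?thesis .
  qed
  from osc[unfolded open_set_condition_def] obtain U :: "nat \<Rightarrow> (real ^ 'q) set" where U0:
      "\<forall>i\<in>{1..p}. U i \<noteq> {} \<and> bounded (U i) \<and> open (U i) \<and>
        (\<Union>j\<in>{j\<in>{1..p}. a i j = 1}. \<omega> i j ` U j) \<subseteq> U i \<and>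
        disjoint_family_on (\<lambda>j. \<omega> i j ` U j) {j\<in>{1..p}. a i j = 1}" by (elim exE)
  note U = bspec[OF U0, THEN conjunct1] bspec[OF U0, THEN conjunct2, THEN conjunct1]
    bspec[OF U0, THEN conjunct2, THEN conjunct2, THEN conjunct1]
    bspec[OF U0, THEN conjunct2, THEN conjunct2, THEN conjunct2, THEN conjunct1]
    bspec[OF U0, THEN conjunct2, THEN conjunct2, THEN conjunct2, THEN conjunct2]
  have "\<forall>i. \<exists>zr. i \<in> {1..p} \<longrightarrow> 0 < snd zr \<and> cball (fst zr) (snd zr) \<subseteq> U i"
  proof
    fix i
    show "\<exists>zr. i \<in> {1..p} \<longrightarrow> 0 < snd zr \<and> cball (fst zr) (snd zr) \<subseteq> U i"
    proof (cases "i \<in> {1..p}")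
      case True
      obtain z where "z \<in> U i" using U(1)[OF True] by (meson ex_in_conv)
      with U(3)[OF True] obtain r where "0 < r" "cball z r \<subseteq> U i" by (meson open_contains_cball)
      then show ?thesis by (intro exI[of _ "(z, r)"]) simp
    next
      case False
      then show ?thesis by (auto simp del: atLeastAtMost_iff)
    qed
  qed
  from choice[OF this] obtain zr where zr: "\<forall>i. i \<in> {1..p} \<longrightarrow> 0 < snd (zr i) \<and> cball (fst (zr i)) (snd (zr i)) \<subseteq> U i" ..
  define \<rho> where "\<rho> = Min ((\<lambda>i. snd (zr i)) ` {1..p})"
  define ctr where "ctr i = fst (zr i)" for i
  have ne: "{1..p} \<noteq> {}" using assms(1) by auto
  have rho: "0 < \<rho>" unfolding \<rho>_def using zr ne by (subst Min_gr_iff) auto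
  have rho_U: "cball (ctr i) \<rho> \<subseteq> U i" if "i \<in> {1..p}" for i
  proof -
    have "\<rho> \<le> snd (zr i)" unfolding \<rho>_def using that by (intro Min_le) auto
    then have "cball (ctr i) \<rho> \<subseteq> cball (fst (zr i)) (snd (zr i))" unfolding ctr_def by (rule subset_cball)
    then show ?thesis using zr that by blast
  qed
  have E_bounded: "bounded (E i)" if "i \<in> {1..p}" for i
    using bspec[OF attr[unfolded recurrent_attractor_def] that] by (elim conjE) (rule compact_imp_bounded)
  have "bounded (\<Union>i\<in>{1..p}. E i \<union> U i)"
    using E_bounded U(2) by (intro bounded_UN ballI) simp_all
  then have "bounded ((\<Union>i\<in>{1..p}. E i \<union> U i) \<union> (\<lambda>e. \<omega> (fst e) (snd e) 0) ` Ed)"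
    using Ed by (simp add: finite_imp_bounded)
  then obtain R0 where R0: "0 < R0" "\<forall>z\<in>(\<Union>i\<in>{1..p}. E i \<union> U i) \<union> (\<lambda>e. \<omega> (fst e) (snd e) 0) ` Ed. norm z \<le> R0"
    unfolding bounded_pos by blast
  \<comment> \<open>The solution of \<open>R0 + c * Rad = Rad\<close>, hence a radius whose ball is
    mapped into itself by every map.\<close>
  define Rad where "Rad = R0 / (1 - c)"
  have Rad: "0 < Rad" using R0(1) c by (simp add: Rad_def)
  have R0_Rad: "R0 \<le> Rad" using R0(1) c by (simp add: Rad_def field_simps)
  have EU: "E i \<subseteq> cball 0 Rad" "U i \<subseteq> cball 0 Rad" if "i \<in> {1..p}" for i
  proof -
    have "norm z \<le> Rad" if "z \<in> E i \<union> U i" for z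
      using R0(2) R0_Rad \<open>i \<in> {1..p}\<close> that by (meson UN_I UnI1 order_trans)
    then show "E i \<subseteq> cball 0 Rad" "U i \<subseteq> cball 0 Rad" by (auto simp del: atLeastAtMost_iff)
  qed
  have maps: "\<omega> i j z \<in> cball 0 Rad" if e: "i \<in> {1..p}" "j \<in> {1..p}" "a i j = 1" and z: "z \<in> cball 0 Rad" for i j z
  proof -
    have "norm (\<omega> i j z) \<le> norm (\<omega> i j 0) + dist (\<omega> i j z) (\<omega> i j 0)"
      using norm_triangle_sub[of "\<omega> i j z" "\<omega> i j 0"] by (simp add: dist_norm)
    also have "norm (\<omega> i j 0) \<le> R0" using R0(2) EdI[OF e] by force
    also have "dist (\<omega> i j z) (\<omega> i j 0) \<le> c * Rad"
      using lip[OF e, of z 0] z c by (intro order_trans[OF lip[OF e] mult_left_mono]) auto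
    also have "R0 + c * Rad = Rad" using c by (simp add: Rad_def field_simps)
    finally show ?thesis by simp
  qed
  have "\<forall>e. \<exists>mH. e \<in> Ed \<longrightarrow> 0 < fst mH \<and> 0 \<le> snd mH \<and> (\<forall>x\<in>cball 0 Rad. fst mH \<le> s (fst e) (snd e) x \<and>
      (\<forall>y\<in>cball 0 Rad. \<bar>ln (s (fst e) (snd e) x) - ln (s (fst e) (snd e) y)\<bar> \<le> snd mH * dist x y powr \<gamma>))"
  proof
    fix e
    show "\<exists>mH. e \<in> Ed \<longrightarrow> 0 < fst mH \<and> 0 \<le> snd mH \<and> (\<forall>x\<in>cball 0 Rad. fst mH \<le> s (fst e) (snd e) x \<and>
      (\<forall>y\<in>cball 0 Rad. \<bar>ln (s (fst e) (snd e) x) - ln (s (fst e) (snd e) y)\<bar> \<le> snd mH * dist x y powr \<gamma>))"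
    proof (cases "e \<in> Ed")
      case True
      then have e: "fst e \<in> {1..p}" "snd e \<in> {1..p}" "a (fst e) (snd e) = 1" by (auto simp: Ed_def)
      obtain m H where "0 < m" "0 \<le> H" "\<forall>x\<in>cball 0 Rad. m \<le> s (fst e) (snd e) x \<and>
        (\<forall>y\<in>cball 0 Rad. \<bar>ln (s (fst e) (snd e) x) - ln (s (fst e) (snd e) y)\<bar> \<le> H * dist x y powr \<gamma>)"
        using conformal_map_bounds(4)[OF gamma diffeo[OF e] lip[OF e] sim[OF e] Rad maps[OF e]] by auto
      then show ?thesis by (intro exI[of _ "(m, H)"]) simp
    qed simp
  qed
  from choice[OF this] obtain mH where mH: "\<forall>e. e \<in> Ed \<longrightarrow> 0 < fst (mH e) \<and> 0 \<le> snd (mH e) \<and> (\<forall>x\<in>cball 0 Rad. fst (mH e) \<le> s (fst e) (snd e) x \<and>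
      (\<forall>y\<in>cball 0 Rad. \<bar>ln (s (fst e) (snd e) x) - ln (s (fst e) (snd e) y)\<bar> \<le> snd (mH e) * dist x y powr \<gamma>))" ..
  \<comment> \<open>The inserted \<open>1\<close> here, and \<open>0\<close> for \<open>Hc\<close>,
    keep the extrema defined over a nonempty set and give the required signs.\<close>
  define smin where "smin = Min (insert 1 ((\<lambda>e. fst (mH e)) ` Ed))"
  define Hc where "Hc = Max (insert 0 ((\<lambda>e. snd (mH e)) ` Ed))"
  have smin: "0 < smin" unfolding smin_def using Ed mH by (subst Min_gr_iff) auto
  have smin_le: "smin \<le> s i j z" if e: "i \<in> {1..p}" "j \<in> {1..p}" "a i j = 1" and z: "z \<in> cball 0 Rad" for i j z
  proof -
    have "smin \<le> fst (mH (i, j))" unfolding smin_def using Ed EdI[OF e] by (intro Min_le) auto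
    also have "\<dots> \<le> s i j z" using mH EdI[OF e] z by fastforce
    finally show ?thesis .
  qed
  have Hc: "0 \<le> Hc" unfolding Hc_def using Ed by (intro Max_ge) auto
  have Hc_ge: "\<bar>ln (s i j z) - ln (s i j w)\<bar> \<le> Hc * dist z w powr \<gamma>"
    if e: "i \<in> {1..p}" "j \<in> {1..p}" "a i j = 1" and z: "z \<in> cball 0 Rad" "w \<in> cball 0 Rad" for i j z w
  proof -
    have "\<bar>ln (s i j z) - ln (s i j w)\<bar> \<le> snd (mH (i, j)) * dist z w powr \<gamma>" using mH EdI[OF e] z by fastforce
    also have "\<dots> \<le> Hc * dist z w powr \<gamma>"
      unfolding Hc_def using Ed EdI[OF e] by (intro mult_right_mono Max_ge) auto
    finally show ?thesis .
  qed
  interpret subshift_space p a by unfold_locales (fact assms(1-3))+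
  interpret ratio_spectrum p a \<omega> s \<gamma> c Rad smin Hc \<rho> E U ctr f g C
  proof unfold_locales
    fix i j assume e: "i \<in> {1..p}" "j \<in> {1..p}" "a i j = 1"
    note b = conformal_map_bounds[OF gamma diffeo[OF e] lip[OF e] sim[OF e] Rad maps[OF e]]
    show "\<exists>D. (\<omega> i j has_derivative D) (at z) \<and> (\<forall>v. norm (D v) = s i j z * norm v)" for z by (rule b(1))
    show "s i j z \<le> c" for z by (rule b(2))
    show "inv (\<omega> i j) differentiable (at z)" for z by (rule b(3))
    show "bij (\<omega> i j)" using diffeo[OF e] by (simp add: C1_holder_diffeomorphism_def)
    show "\<omega> i j ` U j \<subseteq> U i"
      by (rule order_trans[OF _ U(4)[OF e(1)]]) (use e(2,3) in blast)
    show "\<omega> i j ` U j \<inter> \<omega> i k ` U k = {}" if "k \<in> {1..p}" "a i k = 1" "j \<noteq> k" for k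
      by (rule disjoint_family_onD[OF U(5)[OF e(1)]]) (use e that in simp_all)
  next
    fix i assume "i \<in> {1..p}"
    then show "cball (ctr i) \<rho> \<subseteq> U i \<inter> cball 0 Rad" using rho_U EU by blast
  qed (fact gamma c lip Rad maps attr EU smin smin_le Hc Hc_ge rho assms)+
  have "{x \<in> subshift p a.
      accumulation_points {n. \<forall>j. ergodic_sum left_shift (g j) n x \<noteq> 0}
        (\<lambda>n. \<chi> j. ergodic_sum left_shift (f j) n x / ergodic_sum left_shift (g j) n x) \<subseteq> C} = level"
    by (simp add: level_def ratio_def)
  moreover have "- (\<integral>x. ln (s (x 0) (x 1) (coding_map \<omega> E (left_shift x))) \<partial>\<mu>) = (\<integral>x. \<psi> x \<partial>\<mu>)" for \<mu>
    by (simp add: \<psi>_def)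
  ultimately show ?thesis using dimension_formula by (simp only: mean_ratio_def)
qed

end
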